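(* Let the setting be as in the context, with $0<\sigma<\infty$, and assume $\Lambda<\infty$. (i) If $f\equiv\lambda$ is constant with $|\lambda|>\Lambda\,h(\Omega)$, then the problem $-\sum_{p=2}^\infty a_p\Delta_pu=f$ in $\Omega$, $u=g$ on $\partial\Omega$, has no weak solution, whatever the boundary datum $g\in C^{0,1}(\partial\Omega)$. (ii) More generally, given $0\le f\in L^1(\Omega)$, $f\not\equiv0$, set $$\Lambda_f:=\Lambda\cdot\inf\Big\{\frac{\int_\Omega|\nabla\psi|}{\int_\Omega f\psi}\ :\ \psi\in C^\infty_c(\Omega),\ \psi\ge0,\ \int_\Omega f\psi>0\Big\}.$$ Then the problem $-\sum_{p=2}^\infty a_p\Delta_pu=\mu f$ in $\Omega$, $u=g$ on $\partial\Omega$, admits no weak solution for $\mu>\Lambda_f$. (iii) In either case (i.e. with datum $\lambda$ as in (i), or datum $\mu f$ as in (ii)), for $g$ with $L\le\sigma$ the minimizer $u$ on $S_g$ of the corresponding energy $F$ exists but satisfies $\|\nabla u\|_{L^\infty(\Omega)}=\sigma$.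
   Context: $\Omega\subset\mathbb{R}^N$ ($N\ge1$) is a bounded, connected, open set with Lipschitz boundary. $\{a_p\}_{p\ge2}$ ($p$ integer) is a real sequence with $a_p\ge0$ for all $p$, $a_2>0$, and $a_p\ne0$ for infinitely many $p$; $\sigma$ is defined by $1/\sigma=\limsup_{p\to\infty}a_p^{1/p}$, and $\Lambda=\sum_{p\ge2}a_p\sigma^{p-1}\in(0,+\infty]$. Put $\Phi(t)=\sum_{p\ge2}\frac{a_p}{p}t^p$ for $t\in[0,\sigma]$ (finite, since $\Lambda<\infty$), and $G(\xi)=\Phi(|\xi|)$ if $|\xi|\le\sigma$, $G(\xi)=+\infty$ if $|\xi|>\sigma$. For $g\in C^{0,1}(\partial\Omega)$ put $L=\sup_{x\ne y\in\partial\Omega}\frac{|g(x)-g(y)|}{|x-y|}$ and $S_g=\{v\in C^{0,1}(\overline\Omega):\ \|\nabla v\|_{L^\infty(\Omega)}\le\sigma,\ v=g\text{ on }\partial\Omega\}$. For a datum $f_0\in L^1(\Omega)$ the corresponding energy is $F(v)=\int_\Omega G(\nabla v)-\int_\Omega f_0v$, $v\in S_g$. $P(E)$ is the perimeter of a set of finite perimeter $E$ in $\mathbb{R}^N$, and $h(\Omega)=\inf\{P(E)/|E|:\ E\Subset\Omega,\ 0<|E|<\infty\}$ is the Cheeger constant. Here $\Delta_pu=\operatorname{div}(|\nabla u|^{p-2}\nabla u)$. A function $u\in S_g$ is a weak solution of the Dirichlet problem with datum $f_0$ if $\sum_{p=2}^{\infty}a_p\int_\Omega|\nabla u|^{p-2}\nabla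 u\cdot\nabla\psi=\int_\Omega f_0\psi$ for every $\psi\in W^{1,\infty}_0(\Omega)$ (Lipschitz functions on $\overline\Omega$ vanishing on $\partial\Omega$) for which the series on the left is absolutely convergent, i.e. $\sum_pa_p\big|\int_\Omega|\nabla u|^{p-2}\nabla u\cdot\nabla\psi\big|<\infty$ (when $\Lambda<\infty$ this holds for every such $\psi$). *)

theory Defs
  imports "HOL-Analysis.Analysis" "HOL-Probability.Essential_Supremum"
begin

text \<open>
  Near each boundary point the set is, in suitable orthonormal coordinates, the part of a ball
  lying strictly above the graph of a Lipschitz function \<open>\<gamma>\<close> of the coordinates orthogonal to a
  unit vector \<open>e\<close>.
\<close>
definition lipschitz_boundary :: "'a::euclidean_space set \<Rightarrow> bool" where
  "lipschitz_boundary \<Omega> \<longleftrightarrow>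
     (\<forall>x0\<in>frontier \<Omega>. \<exists>r>0. \<exists>e. norm e = 1 \<and>
        (\<exists>\<gamma> K. K-lipschitz_on {y. y \<bullet> e = 0} \<gamma> \<and>
           \<Omega> \<inter> ball x0 r = {x \<in> ball x0 r. \<gamma> (x - (x \<bullet> e) *\<^sub>R e) < x \<bullet> e}))"

definition lipschitz_fun_on :: "'a::metric_space set \<Rightarrow> ('a \<Rightarrow> real) \<Rightarrow> bool" where
  "lipschitz_fun_on S v \<longleftrightarrow> (\<exists>K. K-lipschitz_on S v)"

definition lip_seminorm :: "'a::metric_space set \<Rightarrow> ('a \<Rightarrow> real) \<Rightarrow> ereal" where
  "lip_seminorm S g = (SUP (x, y) \<in> {(x, y). x \<in> S \<and> y \<in> S \<and> x \<noteq> y}. ereal (\<bar>g x - g y\<bar> / dist x y))"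

primrec C_diff :: "nat \<Rightarrow> ('a::euclidean_space \<Rightarrow> 'b::real_normed_vector) \<Rightarrow> bool" where
  "C_diff 0 f \<longleftrightarrow> continuous_on UNIV f"
| "C_diff (Suc k) f \<longleftrightarrow>
     (\<forall>x. f differentiable (at x)) \<and> (\<forall>i\<in>Basis. C_diff k (\<lambda>x. frechet_derivative f (at x) i))"

definition supp :: "('a::euclidean_space \<Rightarrow> 'b::real_normed_vector) \<Rightarrow> 'a set" where
  "supp f = closure {x. f x \<noteq> 0}"

definition test_functions :: "'a::euclidean_space set \<Rightarrow> ('a \<Rightarrow> real) set" where
  "test_functions \<Omega> = {\<phi>. (\<forall>k. C_diff k \<phi>) \<and> compact (supp \<phi>) \<and> supp \<phi> \<subseteq> \<Omega>}"

definition grad :: "('a::euclidean_space \<Rightarrow> real) \<Rightarrow> 'a \<Rightarrow> 'a" where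
  "grad f x = (\<Sum>i\<in>Basis. frechet_derivative f (at x) i *\<^sub>R i)"

definition divergence :: "('a::euclidean_space \<Rightarrow> 'a) \<Rightarrow> 'a \<Rightarrow> real" where
  "divergence T x = (\<Sum>i\<in>Basis. frechet_derivative T (at x) i \<bullet> i)"

definition is_weak_grad :: "'a::euclidean_space set \<Rightarrow> ('a \<Rightarrow> real) \<Rightarrow> ('a \<Rightarrow> 'a) \<Rightarrow> bool" where
  "is_weak_grad \<Omega> v w \<longleftrightarrow>
     w \<in> borel_measurable (lebesgue_on \<Omega>) \<and>
     (\<forall>K. compact K \<and> K \<subseteq> \<Omega> \<longrightarrow> integrable (lebesgue_on K) w) \<and>
     (\<forall>\<phi>\<in>test_functions \<Omega>.
        (LINT x|lebesgue_on \<Omega>. v x *\<^sub>R grad \<phi> x) = - (LINT x|lebesgue_on \<Omega>. \<phi> x *\<^sub>R w x))"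

text \<open>
  The gradient of a Lipschitz function is its distributional gradient, which exists, is determined
  up to a null set, and agrees almost everywhere with the pointwise gradient. The choice of
  representative is immaterial below, since only integrals and essential suprema of it occur.
\<close>
definition weak_grad :: "'a::euclidean_space set \<Rightarrow> ('a \<Rightarrow> real) \<Rightarrow> 'a \<Rightarrow> 'a" where
  "weak_grad \<Omega> v = (SOME w. is_weak_grad \<Omega> v w)"

definition grad_Linf :: "'a::euclidean_space set \<Rightarrow> ('a \<Rightarrow> real) \<Rightarrow> ereal" where
  "grad_Linf \<Omega> v = esssup (lebesgue_on \<Omega>) (\<lambda>x. ereal (norm (weak_grad \<Omega> v x)))"

definition W0_1inf :: "'a::euclidean_space set \<Rightarrow> ('a \<Rightarrow> real) set" where
  "W0_1inf \<Omega> = {\<psi>. lipschitz_fun_on (closure \<Omega>) \<psi> \<and> (\<forall>x\<in>frontier \<Omega>. \<psi> x = 0)}"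

text \<open>Functions are total; only the values on \<open>closure \<Omega>\<close> matter.\<close>
definition S_class :: "real \<Rightarrow> 'a::euclidean_space set \<Rightarrow> ('a \<Rightarrow> real) \<Rightarrow> ('a \<Rightarrow> real) set" where
  "S_class \<sigma> \<Omega> g = {v. lipschitz_fun_on (closure \<Omega>) v \<and> grad_Linf \<Omega> v \<le> ereal \<sigma> \<and>
                       (\<forall>x\<in>frontier \<Omega>. v x = g x)}"

definition perimeter :: "'a::euclidean_space set \<Rightarrow> ereal" where
  "perimeter E = (SUP T \<in> {T :: 'a \<Rightarrow> 'a. C_diff 1 T \<and> compact (supp T) \<and> (\<forall>x. norm (T x) \<le> 1)}.
                    ereal (LINT x|lebesgue_on E. divergence T x))"

definition cheeger :: "'a::euclidean_space set \<Rightarrow> ereal" where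
  "cheeger \<Omega> = (INF E \<in> {E. E \<in> sets lebesgue \<and> compact (closure E) \<and> closure E \<subseteq> \<Omega> \<and>
                            0 < emeasure lebesgue E \<and> emeasure lebesgue E < \<infinity> \<and>
                            perimeter E < \<infinity>}.
                   perimeter E / ereal (measure lebesgue E))"

text \<open>
  Series over \<open>p \<ge> 2\<close> are written with \<open>p = k + 2\<close>, \<open>k \<ge> 0\<close>; the values \<open>a 0\<close> and \<open>a 1\<close> play no role.
\<close>
definition Lambda :: "(nat \<Rightarrow> real) \<Rightarrow> real \<Rightarrow> ereal" where
  "Lambda a \<sigma> = (\<Sum>k. ereal (a (k + 2) * \<sigma> ^ (k + 1)))"

definition Phi :: "(nat \<Rightarrow> real) \<Rightarrow> real \<Rightarrow> real" where
  "Phi a t = (\<Sum>k. a (k + 2) / real (k + 2) * t ^ (k + 2))"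

definition G_fun :: "(nat \<Rightarrow> real) \<Rightarrow> real \<Rightarrow> 'a::euclidean_space \<Rightarrow> ennreal" where
  "G_fun a \<sigma> \<xi> = (if norm \<xi> \<le> \<sigma> then ennreal (Phi a (norm \<xi>)) else \<infinity>)"

definition energy ::
  "(nat \<Rightarrow> real) \<Rightarrow> real \<Rightarrow> 'a::euclidean_space set \<Rightarrow> ('a \<Rightarrow> real) \<Rightarrow> ('a \<Rightarrow> real) \<Rightarrow> ereal" where
  "energy a \<sigma> \<Omega> f0 v =
     enn2ereal (\<integral>\<^sup>+ x. G_fun a \<sigma> (weak_grad \<Omega> v x) \<partial>(lebesgue_on \<Omega>))
       - ereal (LINT x|lebesgue_on \<Omega>. f0 x * v x)"

definition is_minimizer ::
  "(nat \<Rightarrow> real) \<Rightarrow> real \<Rightarrow> 'a::euclidean_space set \<Rightarrow> ('a \<Rightarrow> real) \<Rightarrow> ('a \<Rightarrow> real) \<Rightarrow> ('a \<Rightarrow> real) \<Rightarrow> bool"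
  where
  "is_minimizer a \<sigma> \<Omega> g f0 u \<longleftrightarrow>
     u \<in> S_class \<sigma> \<Omega> g \<and> (\<forall>v \<in> S_class \<sigma> \<Omega> g. energy a \<sigma> \<Omega> f0 u \<le> energy a \<sigma> \<Omega> f0 v)"

text \<open>\<open>a\<^sub>p \<integral> |\<nabla>u|\<^sup>p\<^sup>-\<^sup>2 \<nabla>u \<cdot> \<nabla>\<psi>\<close> for \<open>p = k + 2\<close>.\<close>
definition weak_term ::
  "(nat \<Rightarrow> real) \<Rightarrow> 'a::euclidean_space set \<Rightarrow> ('a \<Rightarrow> real) \<Rightarrow> ('a \<Rightarrow> real) \<Rightarrow> nat \<Rightarrow> real" where
  "weak_term a \<Omega> u \<psi> k =
     a (k + 2) * (LINT x|lebesgue_on \<Omega>.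
        norm (weak_grad \<Omega> u x) ^ k * (weak_grad \<Omega> u x \<bullet> weak_grad \<Omega> \<psi> x))"

definition weak_solution ::
  "(nat \<Rightarrow> real) \<Rightarrow> real \<Rightarrow> 'a::euclidean_space set \<Rightarrow> ('a \<Rightarrow> real) \<Rightarrow> ('a \<Rightarrow> real) \<Rightarrow> ('a \<Rightarrow> real) \<Rightarrow> bool"
  where
  "weak_solution a \<sigma> \<Omega> g f0 u \<longleftrightarrow>
     u \<in> S_class \<sigma> \<Omega> g \<and>
     (\<forall>\<psi> \<in> W0_1inf \<Omega>. summable (\<lambda>k. \<bar>weak_term a \<Omega> u \<psi> k\<bar>) \<longrightarrow>
        (\<Sum>k. weak_term a \<Omega> u \<psi> k) = (LINT x|lebesgue_on \<Omega>. f0 x * \<psi> x))"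

definition Lambda_f :: "(nat \<Rightarrow> real) \<Rightarrow> real \<Rightarrow> 'a::euclidean_space set \<Rightarrow> ('a \<Rightarrow> real) \<Rightarrow> ereal" where
  "Lambda_f a \<sigma> \<Omega> f = Lambda a \<sigma> *
     (INF \<psi> \<in> {\<psi> \<in> test_functions \<Omega>. (\<forall>x. 0 \<le> \<psi> x) \<and> 0 < (LINT x|lebesgue_on \<Omega>. f x * \<psi> x)}.
        ereal ((LINT x|lebesgue_on \<Omega>. norm (grad \<psi> x)) / (LINT x|lebesgue_on \<Omega>. f x * \<psi> x)))"

end

theory Submission
  imports Defs "HOL-Computational_Algebra.Polynomial" "HOL-Complex_Analysis.Great_Picard"
begin

text \<open>
  Write \<open>L\<close> for the finite value of \<open>Lambda a \<sigma>\<close>; it is a Lipschitz constant of \<open>Phi a\<close> on \<open>[0, \<sigma>]\<close>, and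
  every flux of a function in \<open>S_class\<close> is bounded by it. A datum \<open>f0\<close> as in (i) or (ii) admits a
  compactly supported \<open>\<psi>\<close> of class C1 with \<open>L \<integral>|\<nabla>\<psi>| < \<integral>f0 \<psi>\<close>: in case (ii) by definition of the infimum,
  in case (i) by mollifying the indicator function of a set that almost attains the Cheeger
  constant. Testing a weak solution with \<open>\<psi>\<close> contradicts the bound on the flux. If a minimizer had
  \<open>|\<nabla>u| \<le> s < \<sigma>\<close>, then \<open>u + t\<psi>\<close> would be admissible for small \<open>t > 0\<close> and have smaller energy.

  A minimizer exists because, when the boundary datum has Lipschitz constant at most \<open>\<sigma>\<close>,
  \<open>S_class\<close> consists of the \<open>\<sigma>\<close>-Lipschitz functions on the closure with the given boundary values
  (split a segment at its first and last boundary point), and because almost minimizing gradients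
  can be chosen to converge almost everywhere (parallelogram identity in L2).
\<close>

text \<open>The constant \<open>L\<close> is formally the derivative of \<open>Phi a\<close> at
  \<sigma>, because a_p t^p / p differentiates to a_p t^(p - 1). One number therefore bounds both
  the flux and the growth of the energy, and one strict inequality for \<psi> contradicts a weak
  solution and a strict gradient bound alike. Three obstacles shape the rest. The gradient in the
  definitions is chosen among all distributional gradients, so its existence for Lipschitz
  functions, with the same constant, and its uniqueness almost everywhere must be available before
  any integral can be evaluated. Each member of \<open>S_class\<close> comes with a Lipschitz
  constant of its own, and on a domain that is not convex the gradient bound controls only segments
  inside \<Omega>, so equicontinuity has to be won from the boundary datum. Bounded sequences of
  gradients converge only weakly in general; selecting almost shortest elements from convex sets
  yields pointwise limits instead. The same selection serves twice, for difference quotients and for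
  minimizing sequences.\<close>

subsection \<open>Smooth bump functions\<close>

text \<open>Derivatives are unique, so an explicit \<open>f'\<close> may replace the chosen
  \<open>frechet_derivative\<close>; regularity proofs then become inductions on the order.\<close>

lemma C_diffI:
  assumes "\<And>x. (f has_derivative f' x) (at x)" "\<And>i. i \<in> Basis \<Longrightarrow> C_diff k (\<lambda>x. f' x i)"
  shows "C_diff (Suc k) f"
proof -
  have "frechet_derivative f (at x) = f' x" for x
    using frechet_derivative_at[OF assms(1)] by simp
  with assms show ?thesis by (auto simp: differentiable_def)
qed

lemma C_diff_Suc_has_derivative:
  assumes "C_diff (Suc k) f"
  shows "(f has_derivative frechet_derivative f (at x)) (at x)"
  using assms frechet_derivative_works by auto

lemma C_diff_Suc_imp: "C_diff (Suc k) f \<Longrightarrow> C_diff k f"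
proof (induction k arbitrary: f)
  case 0
  then show ?case
    by (auto intro!: differentiable_imp_continuous_on simp: differentiable_on_def differentiable_at_withinI)
next
  case (Suc k)
  then show ?case by auto
qed

lemma C_diff_continuous: "C_diff k f \<Longrightarrow> continuous_on UNIV f"
  by (induction k) (auto dest: C_diff_Suc_imp simp del: C_diff.simps(2))

lemma C_diff_const [simp]: "C_diff k (\<lambda>x. c)"
proof (induction k arbitrary: c)
  case (Suc k)
  show ?case by (rule C_diffI[where f'="\<lambda>x h. 0"]) (auto intro: Suc)
qed simp

lemma C_diff_add: "C_diff k f \<Longrightarrow> C_diff k g \<Longrightarrow> C_diff k (\<lambda>x. f x + g x)"
proof (induction k arbitrary: f g)
  case 0
  then show ?case by (auto intro: continuous_on_add)
next
  case (Suc k)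
  show ?case
    by (rule C_diffI[OF has_derivative_add[OF C_diff_Suc_has_derivative[OF Suc.prems(1)]
            C_diff_Suc_has_derivative[OF Suc.prems(2)]]])
      (use Suc in auto)
qed

lemma C_diff_mult:
  fixes f g :: "'a::euclidean_space \<Rightarrow> real"
  shows "C_diff k f \<Longrightarrow> C_diff k g \<Longrightarrow> C_diff k (\<lambda>x. f x * g x)"
proof (induction k arbitrary: f g)
  case 0
  then show ?case by (auto intro: continuous_on_mult)
next
  case (Suc k)
  show ?case
    by (rule C_diffI[OF has_derivative_mult[OF C_diff_Suc_has_derivative[OF Suc.prems(1)]
            C_diff_Suc_has_derivative[OF Suc.prems(2)]]])
      (use Suc C_diff_Suc_imp[OF Suc.prems(1)] C_diff_Suc_imp[OF Suc.prems(2)]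
       in \<open>auto intro!: C_diff_add Suc.IH\<close>)
qed

lemma C_diff_prod:
  fixes f :: "'i \<Rightarrow> 'a::euclidean_space \<Rightarrow> real"
  shows "(\<And>i. i \<in> I \<Longrightarrow> C_diff k (f i)) \<Longrightarrow> C_diff k (\<lambda>x. \<Prod>i\<in>I. f i x)"
  by (induction I rule: infinite_finite_induct) (auto intro: C_diff_mult)

text \<open>The flat function exp (- 1/t) with a polynomial in 1/t as factor. The whole family is
  closed under differentiation, which a single flat function is not, so smoothness follows by
  induction over all \<open>P\<close> at once.\<close>

definition exp_flat :: "real poly \<Rightarrow> real \<Rightarrow> real" where
  "exp_flat P t = (if t > 0 then poly P (1 / t) * exp (- (1 / t)) else 0)"

text \<open>The extra power carries the induction on \<open>P\<close>: splitting off a coefficient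
  leaves the remaining polynomial multiplied by one more s.\<close>

lemma tendsto_poly_exp_0:
  fixes P :: "real poly"
  shows "((\<lambda>s. s ^ k * poly P s * exp (- s)) \<longlongrightarrow> 0) at_top"
proof (induction P arbitrary: k)
  case (pCons a P)
  have "((\<lambda>s. a * (s ^ k / exp s) + s ^ Suc k * poly P s * exp (- s)) \<longlongrightarrow> a * 0 + 0) at_top"
    by (intro tendsto_intros pCons.IH tendsto_power_div_exp_0)
  then show ?case
    by (simp add: algebra_simps exp_minus divide_inverse)
qed simp

text \<open>This is the difference quotient at 0. With s = 1/t, dividing by t contributes one factor
  s on the right; on the left everything vanishes.\<close>

lemma exp_flat_tendsto_0: "((\<lambda>t. exp_flat P t / t) \<longlongrightarrow> 0) (at 0)"
proof -
  have *: "((\<lambda>s. s ^ 1 * poly P s * exp (- s)) \<longlongrightarrow> 0) at_top"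
    by (rule tendsto_poly_exp_0)
  have "((\<lambda>t. inverse t ^ 1 * poly P (inverse t) * exp (- inverse t)) \<longlongrightarrow> 0) (at_right (0::real))"
    by (rule filterlim_compose[OF * filterlim_inverse_at_top_right])
  then have "((\<lambda>t. exp_flat P t / t) \<longlongrightarrow> 0) (at_right 0)"
    by (rule Lim_transform_eventually)
       (auto simp: eventually_at_filter exp_flat_def divide_inverse mult_ac intro!: always_eventually)
  moreover have "((\<lambda>t. exp_flat P t / t) \<longlongrightarrow> 0) (at_left 0)"
    by (rule Lim_transform_eventually[OF tendsto_const])
       (auto simp: eventually_at_filter exp_flat_def intro!: always_eventually)
  ultimately show ?thesis by (simp add: filterlim_split_at)
qed

text \<open>With s = 1/t one has d/dt = - s^2 d/ds, which maps P(s) exp (- s) to s^2 (P - P')(s) exp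
  (- s). The polynomial \<open>[:0, 0, 1:]\<close> is s^2.\<close>

lemma exp_flat_has_derivative:
  "(exp_flat P has_real_derivative exp_flat ([:0, 0, 1:] * (P - pderiv P)) t) (at t)"
proof (cases t "0::real" rule: linorder_cases)
  case less
  have "((\<lambda>t::real. 0::real) has_real_derivative 0) (at t)" by simp
  then have "(exp_flat P has_real_derivative 0) (at t)"
    by (rule has_field_derivative_transform_within_open[where S="{..<0}"])
      (use less in \<open>auto simp: exp_flat_def\<close>)
  with less show ?thesis by (simp add: exp_flat_def)
next
  case equal
  then show ?thesis
    using exp_flat_tendsto_0[of P] by (simp add: has_field_derivative_iff exp_flat_def[of _ 0])
next
  case greater
  have "((\<lambda>t. poly P (1 / t) * exp (- (1 / t))) has_real_derivative
          exp_flat ([:0, 0, 1:] * (P - pderiv P)) t) (at t)"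
    using greater
    by (auto intro!: derivative_eq_intros simp: exp_flat_def field_simps power2_eq_square)
  then show ?thesis
    by (rule has_field_derivative_transform_within_open[where S="{0<..}"])
      (use greater in \<open>auto simp: exp_flat_def\<close>)
qed

lemma C_diff_exp_flat: "C_diff k (\<lambda>x::'a::euclidean_space. exp_flat P (c * (x \<bullet> i) + d))"
proof (induction k arbitrary: P)
  case 0
  have "isCont (exp_flat P) x" for x
    using exp_flat_has_derivative DERIV_isCont by blast
  then have "continuous_on UNIV (exp_flat P)"
    by (simp add: continuous_at_imp_continuous_on)
  then show ?case
    by (auto intro!: continuous_on_compose2[of UNIV "exp_flat P"] continuous_intros)
next
  case (Suc k)
  let ?Q = "[:0, 0, 1:] * (P - pderiv P)"
  show ?case
  proof (rule C_diffI)
    show "((\<lambda>x. exp_flat P (c * (x \<bullet> i) + d)) has_derivative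
       (\<lambda>h. exp_flat ?Q (c * (x \<bullet> i) + d) * (c * (h \<bullet> i)))) (at x)" for x
      by (rule DERIV_compose_FDERIV[OF exp_flat_has_derivative,
            THEN has_derivative_eq_rhs])
        (auto intro!: derivative_eq_intros simp del: mult_pCons_left)
  qed (auto intro!: C_diff_mult Suc simp del: mult_pCons_left)
qed

text \<open>The parameter \<open>n\<close> steepens the walls without moving the support: each
  factor is exp (- 1 / ((n + 1) t)), where t is a distance to a face, and tends to 1 inside the box.
  Test functions thus approximate the indicator of an open box from below.\<close>

definition bump :: "'a::euclidean_space \<Rightarrow> 'a \<Rightarrow> nat \<Rightarrow> 'a \<Rightarrow> real" where
  "bump a b n x = (\<Prod>i\<in>Basis. exp_flat 1 (Suc n * (x \<bullet> i - a \<bullet> i)) * exp_flat 1 (Suc n * (b \<bullet> i - x \<bullet> i)))"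

lemma exp_flat_1_bounds: "0 \<le> exp_flat 1 t" "exp_flat 1 t \<le> 1" "0 < exp_flat 1 t \<longleftrightarrow> 0 < t"
  by (auto simp: exp_flat_def)

lemma C_diff_bump: "C_diff k (bump a b n)"
proof -
  have "real (Suc n) * (x \<bullet> i - a \<bullet> i) = real (Suc n) * (x \<bullet> i) + - (real (Suc n) * (a \<bullet> i))" for i x :: 'a
    by (simp add: right_diff_distrib)
  then have "C_diff k (\<lambda>x. exp_flat 1 (Suc n * (x \<bullet> i - a \<bullet> i)))" for i :: 'a
    using C_diff_exp_flat[of k 1 "Suc n" i "- (Suc n * (a \<bullet> i))"] by presburger
  moreover have "real (Suc n) * (b \<bullet> i - x \<bullet> i) = - real (Suc n) * (x \<bullet> i) + real (Suc n) * (b \<bullet> i)" for i x :: 'a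
    by (simp add: algebra_simps)
  then have "C_diff k (\<lambda>x. exp_flat 1 (Suc n * (b \<bullet> i - x \<bullet> i)))" for i :: 'a
    using C_diff_exp_flat[of k 1 "- real (Suc n)" i "Suc n * (b \<bullet> i)"] by presburger
  ultimately show ?thesis
    unfolding bump_def[abs_def] by (intro C_diff_prod C_diff_mult)
qed

lemma bump_nonneg: "0 \<le> bump a b n x"
  unfolding bump_def by (intro prod_nonneg) (auto intro!: mult_nonneg_nonneg exp_flat_1_bounds)

lemma bump_le_1: "bump a b n x \<le> 1"
  unfolding bump_def
  by (intro prod_le_1) (auto intro!: mult_nonneg_nonneg mult_le_one exp_flat_1_bounds)

lemma bump_eq_0: "x \<notin> box a b \<Longrightarrow> bump a b n x = 0"
proof -
  assume "x \<notin> box a b"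
  then obtain i where "i \<in> Basis" "\<not> a \<bullet> i < x \<bullet> i \<or> \<not> x \<bullet> i < b \<bullet> i"
    by (auto simp: mem_box)
  then show ?thesis
    unfolding bump_def
    by (intro prod_zero) (auto intro!: bexI[of _ i] simp: exp_flat_def zero_less_mult_iff simp del: of_nat_Suc)
qed

lemma bump_pos: "x \<in> box a b \<Longrightarrow> 0 < bump a b n x"
  unfolding bump_def
  by (intro prod_pos ballI mult_pos_pos) (simp_all add: mem_box exp_flat_1_bounds del: of_nat_Suc)

lemma supp_bump: "supp (bump a b n) \<subseteq> cbox a b"
  unfolding supp_def
proof (rule closure_minimal)
  show "{x. bump a b n x \<noteq> 0} \<subseteq> cbox a b"
    using bump_eq_0[of _ a b n] box_subset_cbox[of a b] by auto
qed (rule closed_cbox)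

lemma compact_supp_bump: "compact (supp (bump a b n))"
proof -
  have "bounded (supp (bump a b n))" by (rule bounded_subset[OF bounded_cbox supp_bump])
  then show ?thesis by (simp add: compact_eq_bounded_closed supp_def)
qed

lemma bump_test_function: "cbox a b \<subseteq> \<Omega> \<Longrightarrow> bump a b n \<in> test_functions \<Omega>"
  unfolding test_functions_def using C_diff_bump compact_supp_bump supp_bump by blast

lemma bump_tendsto_indicator: "(\<lambda>n. bump a b n x) \<longlonglongrightarrow> indicator (box a b) x"
proof (cases "x \<in> box a b")
  case True
  have *: "(\<lambda>n. exp_flat 1 (Suc n * t)) \<longlonglongrightarrow> 1" if "t > 0" for t :: real
  proof -
    have "(\<lambda>n. exp (- (inverse (real (Suc n)) * (1 / t)))) \<longlonglongrightarrow> exp (- (0 * (1 / t)))"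
      by (intro tendsto_intros LIMSEQ_inverse_real_of_nat)
    then show ?thesis using that
      by (simp add: exp_flat_def divide_inverse zero_less_mult_iff inverse_mult_distrib del: of_nat_Suc)
  qed
  have "(\<lambda>n. bump a b n x) \<longlonglongrightarrow> (\<Prod>i\<in>(Basis::'a set). 1 * 1)"
    unfolding bump_def using True by (intro tendsto_intros *) (auto simp: mem_box)
  then show ?thesis using True by simp
qed (simp add: bump_eq_0)

subsection \<open>Compactly supported functions of class C1\<close>

lemma grad_has_derivative:
  fixes \<psi> :: "'a::euclidean_space \<Rightarrow> real"
  assumes "C_diff 1 \<psi>"
  shows "(\<psi> has_derivative (\<lambda>h. grad \<psi> x \<bullet> h)) (at x)"
proof -
  have d: "(\<psi> has_derivative frechet_derivative \<psi> (at x)) (at x)"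
    using assms C_diff_Suc_has_derivative by (metis One_nat_def)
  have "frechet_derivative \<psi> (at x) h = grad \<psi> x \<bullet> h" for h
  proof -
    interpret bounded_linear "frechet_derivative \<psi> (at x)" using d by (rule has_derivative_bounded_linear)
    have "frechet_derivative \<psi> (at x) h = frechet_derivative \<psi> (at x) (\<Sum>i\<in>Basis. (h \<bullet> i) *\<^sub>R i)"
      by (simp add: euclidean_representation)
    also have "\<dots> = grad \<psi> x \<bullet> h"
      by (simp add: sum scaleR grad_def inner_sum_left inner_sum_right mult.commute inner_commute[of h])
    finally show ?thesis .
  qed
  then show ?thesis using d by (metis (no_types, lifting) ext)
qed

lemma grad_eqI:
  fixes \<psi> :: "'a::euclidean_space \<Rightarrow> real"
  assumes "(\<psi> has_derivative (\<lambda>h. w \<bullet> h)) (at x)"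
  shows "grad \<psi> x = w"
proof -
  have "frechet_derivative \<psi> (at x) = (\<lambda>h. w \<bullet> h)"
    using frechet_derivative_at[OF assms] by simp
  then show ?thesis by (simp add: grad_def euclidean_representation)
qed

lemma grad_continuous:
  fixes \<psi> :: "'a::euclidean_space \<Rightarrow> real"
  assumes "C_diff 1 \<psi>" shows "continuous_on UNIV (grad \<psi>)"
  unfolding grad_def using assms by (auto intro!: continuous_intros)

lemma supp_eq_0: "x \<notin> supp \<psi> \<Longrightarrow> \<psi> x = 0"
  using closure_subset[of "{x. \<psi> x \<noteq> 0}"] by (auto simp: supp_def)

lemma grad_eq_0:
  fixes \<psi> :: "'a::euclidean_space \<Rightarrow> real"
  assumes "x \<notin> supp \<psi>" shows "grad \<psi> x = 0"
proof (rule grad_eqI)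
  have "open (- supp \<psi>)" by (simp add: supp_def open_Compl)
  then have "(\<psi> has_derivative (\<lambda>h. 0)) (at x)"
    by (rule has_derivative_transform_within_open[OF has_derivative_const])
       (use assms supp_eq_0[of _ \<psi>] in auto)
  then show "(\<psi> has_derivative (\<lambda>h. 0 \<bullet> h)) (at x)" by simp
qed

lemma bounded_range_if_supp:
  fixes f :: "'a::euclidean_space \<Rightarrow> 'b::real_normed_vector"
  assumes "continuous_on UNIV f" "compact K" "\<And>x. x \<notin> K \<Longrightarrow> f x = 0"
  obtains B where "B > 0" "\<And>x. norm (f x) \<le> B"
proof -
  have "compact (f ` K)"
    using assms compact_continuous_image continuous_on_subset by blast
  then obtain B where "B > 0" "\<forall>x\<in>K. norm (f x) \<le> B"
    using compact_imp_bounded bounded_pos by (metis imageI)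
  then show ?thesis using assms(3) that[of B] by (metis norm_zero less_eq_real_def)
qed

lemma C1c_bounds:
  fixes \<psi> :: "'a::euclidean_space \<Rightarrow> real"
  assumes "C_diff 1 \<psi>" "compact (supp \<psi>)"
  obtains B where "B > 0" "\<And>x. \<bar>\<psi> x\<bar> \<le> B" "\<And>x. norm (grad \<psi> x) \<le> B"
proof -
  obtain B1 where B1: "B1 > 0" "\<And>x. norm (\<psi> x) \<le> B1"
    using bounded_range_if_supp[OF C_diff_continuous[OF assms(1)] assms(2)] supp_eq_0 by blast
  obtain B2 where B2: "B2 > 0" "\<And>x. norm (grad \<psi> x) \<le> B2"
    using bounded_range_if_supp[OF grad_continuous[OF assms(1)] assms(2)] grad_eq_0 by blast
  show ?thesis
  proof (rule that[of "max B1 B2"])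
    show "\<bar>\<psi> x\<bar> \<le> max B1 B2" "norm (grad \<psi> x) \<le> max B1 B2" for x
      using B1(2)[of x] B2(2)[of x] by simp_all
  qed (use B1(1) in simp)
qed

lemma C1c_lipschitz:
  fixes \<psi> :: "'a::euclidean_space \<Rightarrow> real"
  assumes "C_diff 1 \<psi>" "\<And>x. norm (grad \<psi> x) \<le> B"
  shows "\<bar>\<psi> x - \<psi> y\<bar> \<le> B * dist x y"
proof -
  have "norm (\<psi> x - \<psi> y) \<le> B * norm (x - y)"
  proof (rule differentiable_bound[of UNIV])
    show "(\<psi> has_derivative (\<lambda>h. grad \<psi> z \<bullet> h)) (at z within UNIV)" for z
      using grad_has_derivative[OF assms(1)] by simp
    show "onorm (\<lambda>h. grad \<psi> z \<bullet> h) \<le> B" for z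
    proof (rule onorm_le)
      show "norm (grad \<psi> z \<bullet> h) \<le> B * norm h" for h
        using Cauchy_Schwarz_ineq2[of "grad \<psi> z" h] mult_right_mono[OF assms(2)[of z] norm_ge_zero[of h]]
        by simp
    qed
  qed auto
  then show ?thesis by (simp add: dist_norm)
qed

lemma test_functions_C1c:
  assumes "\<phi> \<in> test_functions \<Omega>"
  shows "C_diff 1 \<phi>" "compact (supp \<phi>)" "supp \<phi> \<subseteq> \<Omega>"
  using assms unfolding test_functions_def by auto

subsection \<open>Correlation with a kernel of class C1\<close>

lemma continuous_borel_measurable_lebesgue_on:
  fixes f :: "'a::euclidean_space \<Rightarrow> 'b::euclidean_space"
  assumes "continuous_on UNIV f"
  shows "f \<in> borel_measurable (lebesgue_on S)"
proof -
  have "f \<in> borel_measurable lebesgue"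
    using borel_measurable_continuous_onI[OF assms] by (simp add: measurable_completion)
  then show ?thesis by (rule measurable_restrict_space1)
qed

lemma integrable_bounded_scaleR:
  fixes f :: "'a \<Rightarrow> 'b::euclidean_space" and g :: "'a \<Rightarrow> real"
  assumes "integrable M f" "g \<in> borel_measurable M" "AE x in M. \<bar>g x\<bar> \<le> B"
  shows "integrable M (\<lambda>x. g x *\<^sub>R f x)"
proof (rule Bochner_Integration.integrable_bound[where f="\<lambda>x. B *\<^sub>R f x"])
  show "AE x in M. norm (g x *\<^sub>R f x) \<le> norm (B *\<^sub>R f x)"
    using assms(3) by eventually_elim (auto intro!: mult_right_mono)
qed (use assms(1,2) in auto)

text \<open>The argument y - x lets x move only the kernel, while the possibly rough
  \<open>f\<close> stays fixed. Dominated convergence then asks for nothing but continuity and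
  boundedness of the kernel.\<close>

lemma correlation_continuous:
  fixes f :: "'a::euclidean_space \<Rightarrow> 'b::euclidean_space" and \<kappa> :: "'a \<Rightarrow> real"
  assumes S: "S \<in> sets lebesgue" and f: "integrable (lebesgue_on S) f"
    and \<kappa>: "continuous_on UNIV \<kappa>" "\<And>x. \<bar>\<kappa> x\<bar> \<le> B"
  shows "continuous_on UNIV (\<lambda>x. LINT y|lebesgue_on S. \<kappa> (y - x) *\<^sub>R f y)"
  unfolding continuous_on_sequentially comp_def
proof (intro allI ballI impI, elim conjE)
  fix X :: "nat \<Rightarrow> 'a" and x assume X: "X \<longlonglongrightarrow> x"
  have m: "(\<lambda>y. \<kappa> (y - z)) \<in> borel_measurable (lebesgue_on S)" for z
    by (intro continuous_borel_measurable_lebesgue_on continuous_on_compose2[OF \<kappa>(1)])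
       (auto intro!: continuous_intros)
  show "(\<lambda>n. LINT y|lebesgue_on S. \<kappa> (y - X n) *\<^sub>R f y) \<longlonglongrightarrow> (LINT y|lebesgue_on S. \<kappa> (y - x) *\<^sub>R f y)"
  proof (rule integral_dominated_convergence[where w="\<lambda>y. B * norm (f y)"])
    have "(\<lambda>n. \<kappa> (y - X n)) \<longlonglongrightarrow> \<kappa> (y - x)" for y
    proof -
      have "isCont \<kappa> (y - x)" using \<kappa>(1) continuous_on_eq_continuous_at by blast
      then show ?thesis by (rule isCont_tendsto_compose) (intro tendsto_intros X)
    qed
    then show "AE y in lebesgue_on S. (\<lambda>n. \<kappa> (y - X n) *\<^sub>R f y) \<longlonglongrightarrow> \<kappa> (y - x) *\<^sub>R f y"
      by (intro AE_I2 tendsto_scaleR tendsto_const)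
  qed (use f m \<kappa>(2) in \<open>auto intro!: AE_I2 mult_right_mono\<close>)
qed

text \<open>Differentiation under the integral: the kernel is Lipschitz, so its difference quotients
  are dominated. The minus sign comes from x entering as y - x.\<close>

lemma correlation_has_derivative:
  fixes f :: "'a::euclidean_space \<Rightarrow> 'b::euclidean_space" and \<eta> :: "'a \<Rightarrow> real"
  assumes S: "S \<in> sets lebesgue" and f: "integrable (lebesgue_on S) f"
    and \<eta>: "C_diff 1 \<eta>" "compact (supp \<eta>)"
  shows "((\<lambda>x. LINT y|lebesgue_on S. \<eta> (y - x) *\<^sub>R f y) has_derivative
          (\<lambda>h. - (LINT y|lebesgue_on S. (grad \<eta> (y - x) \<bullet> h) *\<^sub>R f y))) (at x)"
proof -
  let ?M = "lebesgue_on S"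
  obtain B where B: "B > 0" "\<And>x. \<bar>\<eta> x\<bar> \<le> B" "\<And>x. norm (grad \<eta> x) \<le> B"
    using C1c_bounds[OF \<eta>] by blast
  have \<eta>m: "(\<lambda>y. \<eta> (y - z)) \<in> borel_measurable ?M" for z
    by (intro continuous_borel_measurable_lebesgue_on continuous_on_compose2[OF C_diff_continuous[OF \<eta>(1)]])
       (auto intro!: continuous_intros)
  have gm: "(\<lambda>y. grad \<eta> (y - z) \<bullet> h) \<in> borel_measurable ?M" for z h
    by (intro continuous_borel_measurable_lebesgue_on continuous_on_inner
          continuous_on_compose2[OF grad_continuous[OF \<eta>(1)]])
       (auto intro!: continuous_intros)
  have gb: "\<bar>grad \<eta> z \<bullet> h\<bar> \<le> B * norm h" for z h
    using Cauchy_Schwarz_ineq2[of "grad \<eta> z" h] mult_right_mono[OF B(3)[of z] norm_ge_zero[of h]] by simp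
  have i\<eta>: "integrable ?M (\<lambda>y. \<eta> (y - z) *\<^sub>R f y)" for z
    by (rule integrable_bounded_scaleR[OF f \<eta>m]) (use B(2) in auto)
  have ig: "integrable ?M (\<lambda>y. (grad \<eta> (y - z) \<bullet> h) *\<^sub>R f y)" for z h
    by (rule integrable_bounded_scaleR[OF f gm]) (use gb in auto)
  have "bounded_linear (\<lambda>h. - (LINT y|?M. (grad \<eta> (y - x) \<bullet> h) *\<^sub>R f y))"
  proof (rule bounded_linear_intro[where K="B * (LINT y|?M. norm (f y))"])
    fix h k :: 'a and r :: real
    show "- (LINT y|?M. (grad \<eta> (y - x) \<bullet> (h + k)) *\<^sub>R f y) =
      - (LINT y|?M. (grad \<eta> (y - x) \<bullet> h) *\<^sub>R f y) + - (LINT y|?M. (grad \<eta> (y - x) \<bullet> k) *\<^sub>R f y)"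
      by (simp add: inner_add_right scaleR_add_left ig)
    show "- (LINT y|?M. (grad \<eta> (y - x) \<bullet> (r *\<^sub>R h)) *\<^sub>R f y) =
      r *\<^sub>R (- (LINT y|?M. (grad \<eta> (y - x) \<bullet> h) *\<^sub>R f y))"
      unfolding integral_scaleR_right[symmetric] scaleR_minus_right by simp
    have "norm (LINT y|?M. (grad \<eta> (y - x) \<bullet> h) *\<^sub>R f y) \<le> (LINT y|?M. B * norm h * norm (f y))"
      by (rule Bochner_Integration.integral_norm_bound_integral) (use ig f gb in \<open>auto intro!: mult_right_mono\<close>)
    then show "norm (- (LINT y|?M. (grad \<eta> (y - x) \<bullet> h) *\<^sub>R f y)) \<le> norm h * (B * (LINT y|?M. norm (f y)))"
      by (simp add: mult_ac)
  qed
  moreover have "((\<lambda>z. norm ((LINT y|?M. \<eta> (y - z) *\<^sub>R f y) - (LINT y|?M. \<eta> (y - x) *\<^sub>R f y)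
            - - (LINT y|?M. (grad \<eta> (y - x) \<bullet> (z - x)) *\<^sub>R f y)) / norm (z - x)) \<longlongrightarrow> 0) (at x)"
    unfolding tendsto_at_iff_sequentially comp_def
  proof (intro allI impI)
    fix X :: "nat \<Rightarrow> 'a" assume Xne: "\<forall>i. X i \<in> UNIV - {x}" and X: "X \<longlonglongrightarrow> x"
    \<comment> \<open>The remainder of the first-order expansion of the kernel, already divided by
      the increment: bounded by \<open>2 * B\<close> uniformly, and pointwise null by
      differentiability.\<close>
    define r where "r n y = (\<eta> (y - X n) - \<eta> (y - x) + grad \<eta> (y - x) \<bullet> (X n - x)) / norm (X n - x)" for n y
    have rm: "r n \<in> borel_measurable ?M" for n
      unfolding r_def[abs_def]
      by (intro borel_measurable_divide borel_measurable_add borel_measurable_diff \<eta>m gm) auto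
    have rb: "\<bar>r n y\<bar> \<le> 2 * B" for n y
    proof -
      have "\<bar>\<eta> (y - X n) - \<eta> (y - x)\<bar> \<le> B * norm (X n - x)"
        using C1c_lipschitz[OF \<eta>(1) B(3), of "y - X n" "y - x"] by (simp add: dist_norm norm_minus_commute)
      then have "\<bar>\<eta> (y - X n) - \<eta> (y - x) + grad \<eta> (y - x) \<bullet> (X n - x)\<bar> \<le> 2 * B * norm (X n - x)"
        using gb[of "y - x" "X n - x"] by linarith
      then show ?thesis using Xne by (simp add: r_def abs_divide divide_le_eq)
    qed
    have r0: "(\<lambda>n. r n y) \<longlonglongrightarrow> 0" for y
    proof -
      have "((\<lambda>z. \<eta> (y - z)) has_derivative (\<lambda>h. grad \<eta> (y - x) \<bullet> (- h))) (at x)"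
      proof (rule has_derivative_compose[OF _ grad_has_derivative[OF \<eta>(1)]])
        show "((\<lambda>z. y - z) has_derivative (\<lambda>h. - h)) (at x)" by (auto intro!: derivative_eq_intros)
      qed
      then have "((\<lambda>z. norm (\<eta> (y - z) - \<eta> (y - x) - grad \<eta> (y - x) \<bullet> (- (z - x))) / norm (z - x)) \<longlongrightarrow> 0) (at x)"
        unfolding has_derivative_iff_norm by (rule conjunct2)
      then have "(\<lambda>n. norm (\<eta> (y - X n) - \<eta> (y - x) - grad \<eta> (y - x) \<bullet> (- (X n - x))) / norm (X n - x)) \<longlonglongrightarrow> 0"
        using Xne X unfolding tendsto_at_iff_sequentially comp_def by blast
      then have "(\<lambda>n. \<bar>r n y\<bar>) \<longlonglongrightarrow> 0"
        by (simp add: r_def abs_divide inner_diff_right algebra_simps)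
      then show ?thesis by (simp add: tendsto_rabs_zero_iff)
    qed
    have ir: "integrable ?M (\<lambda>y. r n y *\<^sub>R f y)" for n
      by (rule integrable_bounded_scaleR[OF f rm]) (use rb in auto)
    have "(\<lambda>n. LINT y|?M. r n y *\<^sub>R f y) \<longlonglongrightarrow> (LINT y|?M. 0)"
    proof (rule integral_dominated_convergence[where w="\<lambda>y. 2 * B * norm (f y)"])
      show "AE y in ?M. (\<lambda>n. r n y *\<^sub>R f y) \<longlonglongrightarrow> 0"
        using tendsto_scaleR[OF r0 tendsto_const] by (intro AE_I2) simp
    qed (use f rm rb in \<open>auto intro!: AE_I2 mult_right_mono\<close>)
    then have "(\<lambda>n. norm (LINT y|?M. r n y *\<^sub>R f y)) \<longlonglongrightarrow> 0"
      by (simp add: tendsto_norm_zero)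
    moreover have "norm (LINT y|?M. r n y *\<^sub>R f y) =
       norm ((LINT y|?M. \<eta> (y - X n) *\<^sub>R f y) - (LINT y|?M. \<eta> (y - x) *\<^sub>R f y)
            - - (LINT y|?M. (grad \<eta> (y - x) \<bullet> (X n - x)) *\<^sub>R f y)) / norm (X n - x)" for n
    proof -
      have "(LINT y|?M. r n y *\<^sub>R f y) = (LINT y|?M. (1 / norm (X n - x)) *\<^sub>R
        (\<eta> (y - X n) *\<^sub>R f y - \<eta> (y - x) *\<^sub>R f y + (grad \<eta> (y - x) \<bullet> (X n - x)) *\<^sub>R f y))"
        by (simp add: r_def scaleR_diff_left[symmetric] scaleR_add_left[symmetric])
      also have "\<dots> = (1 / norm (X n - x)) *\<^sub>R ((LINT y|?M. \<eta> (y - X n) *\<^sub>R f y)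
          - (LINT y|?M. \<eta> (y - x) *\<^sub>R f y) + (LINT y|?M. (grad \<eta> (y - x) \<bullet> (X n - x)) *\<^sub>R f y))"
        by (simp add: i\<eta> ig)
      finally show ?thesis by simp
    qed
    ultimately show "(\<lambda>n. norm ((LINT y|?M. \<eta> (y - X n) *\<^sub>R f y) - (LINT y|?M. \<eta> (y - x) *\<^sub>R f y)
            - - (LINT y|?M. (grad \<eta> (y - x) \<bullet> (X n - x)) *\<^sub>R f y)) / norm (X n - x)) \<longlonglongrightarrow> 0"
      by simp
  qed
  ultimately show ?thesis by (simp add: has_derivative_iff_norm)
qed

subsection \<open>Integration by parts\<close>

lemma integral_lebesgue_on_eq:
  fixes h :: "'a::euclidean_space \<Rightarrow> 'b::euclidean_space"
  assumes "S \<in> sets lebesgue" "\<And>x. x \<notin> S \<Longrightarrow> h x = 0"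
  shows "(LINT x|lebesgue_on S. h x) = (LINT x|lebesgue. h x)"
proof -
  have "(\<lambda>x. indicator S x *\<^sub>R h x) = h"
    using assms(2) by (auto simp: indicator_def)
  then show ?thesis using assms(1) by (simp add: integral_restrict_space)
qed

lemma integrable_lebesgue_on_iff:
  fixes h :: "'a::euclidean_space \<Rightarrow> 'b::euclidean_space"
  assumes "S \<in> sets lebesgue" "\<And>x. x \<notin> S \<Longrightarrow> h x = 0"
  shows "integrable (lebesgue_on S) h \<longleftrightarrow> integrable lebesgue h"
proof -
  have "(\<lambda>x. indicator S x *\<^sub>R h x) = h"
    using assms(2) by (auto simp: indicator_def)
  then show ?thesis using assms(1) by (simp add: integrable_restrict_space)
qed

lemma integrable_lebesgue_on_subset:
  fixes f :: "'a::euclidean_space \<Rightarrow> 'b::euclidean_space"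
  assumes "integrable (lebesgue_on S) f" "S \<in> sets lebesgue" "T \<in> sets lebesgue" "T \<subseteq> S"
  shows "integrable (lebesgue_on T) f"
proof -
  have "integrable lebesgue (\<lambda>x. indicator T x *\<^sub>R (indicator S x *\<^sub>R f x))"
    using assms(1,2) by (intro integrable_mult_indicator[OF assms(3)]) (simp add: integrable_restrict_space)
  moreover have "(\<lambda>x. indicator T x *\<^sub>R (indicator S x *\<^sub>R f x)) = (\<lambda>x. indicator T x *\<^sub>R f x)"
    using assms(4) by (auto simp: indicator_def fun_eq_iff)
  ultimately show ?thesis using assms(3) by (simp add: integrable_restrict_space)
qed

lemma integrable_scaleR_grad:
  fixes u \<phi> :: "'a::euclidean_space \<Rightarrow> real"
  assumes u: "integrable (lebesgue_on S) u" and \<phi>: "C_diff 1 \<phi>" "compact (supp \<phi>)"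
  shows "integrable (lebesgue_on S) (\<lambda>z. u z *\<^sub>R grad \<phi> (z - p))"
proof -
  obtain B where B: "\<And>z. norm (grad \<phi> z) \<le> B" using C1c_bounds[OF \<phi>] by metis
  show ?thesis
  proof (rule Bochner_Integration.integrable_bound)
    have "norm (u z *\<^sub>R grad \<phi> (z - p)) \<le> norm (B * u z)" for z
      using mult_left_mono[OF B[of "z - p"] abs_ge_zero[of "u z"]] order_trans[OF norm_ge_zero B[of z]]
      by (simp add: abs_mult mult.commute)
    then show "AE z in lebesgue_on S. norm (u z *\<^sub>R grad \<phi> (z - p)) \<le> norm (B * u z)" by simp
    show "integrable (lebesgue_on S) (\<lambda>z. B * u z)" using u by auto
    have "(\<lambda>z. grad \<phi> (z - p)) \<in> borel_measurable (lebesgue_on S)"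
      by (intro continuous_borel_measurable_lebesgue_on continuous_on_compose2[OF grad_continuous[OF \<phi>(1)]])
         (auto intro!: continuous_intros)
    then show "(\<lambda>z. u z *\<^sub>R grad \<phi> (z - p)) \<in> borel_measurable (lebesgue_on S)"
      using u by (intro borel_measurable_scaleR) auto
  qed
qed

lemma integral_lebesgue_translate:
  fixes f :: "'a::euclidean_space \<Rightarrow> 'b::euclidean_space"
  assumes f: "f \<in> borel_measurable borel"
  shows "(LINT x|lebesgue. f (x + c)) = (LINT x|lebesgue. f x)"
proof -
  have "(LINT x|lborel. f (c + x)) = (LINT x|distr lborel borel ((+) c). f x)"
    using f by (subst integral_distr) auto
  also have "\<dots> = (LINT x|lborel. f x)" by (simp add: lborel_distr_plus)
  finally show ?thesis using f
    by (simp add: integral_completion add.commute)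
qed

lemma integrable_continuous_compact:
  fixes f :: "'a::euclidean_space \<Rightarrow> 'b::euclidean_space"
  assumes "continuous_on UNIV f" "compact K"
  shows "integrable (lebesgue_on K) f"
proof -
  interpret finite_measure "lebesgue_on K"
    using assms(2) finite_measure_lebesgue_on lmeasurable_compact by blast
  have "bounded (f ` K)"
    by (intro compact_imp_bounded compact_continuous_image continuous_on_subset[OF assms(1)] assms(2)) simp
  then obtain B where B: "\<forall>x\<in>K. norm (f x) \<le> B" by (auto simp: bounded_iff)
  show ?thesis
    by (rule integrable_const_bound[where B=B])
       (use B continuous_borel_measurable_lebesgue_on[OF assms(1)] in auto)
qed

lemma integrable_continuous_compact_supp:
  fixes f :: "'a::euclidean_space \<Rightarrow> 'b::euclidean_space"
  assumes "continuous_on UNIV f" "compact K" "\<And>x. x \<notin> K \<Longrightarrow> f x = 0"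
  shows "integrable lebesgue f"
proof -
  have "K \<in> sets lebesgue" using assms(2) by (intro fmeasurableD lmeasurable_compact)
  then show ?thesis
    using integrable_continuous_compact[OF assms(1,2)] integrable_lebesgue_on_iff[of K f] assms(3) by simp
qed

text \<open>The integral of \<eta> (y - x) over y does not depend on x, by translation invariance,
  and its derivative at x = 0 is minus the integral of the gradient.\<close>

lemma integral_grad_eq_0:
  fixes \<eta> :: "'a::euclidean_space \<Rightarrow> real"
  assumes \<eta>: "C_diff 1 \<eta>" "compact (supp \<eta>)"
  shows "(LINT x|lebesgue. grad \<eta> x) = 0"
proof -
  have "bounded (supp \<eta>)" using \<eta>(2) compact_imp_bounded by blast
  then obtain R where R: "\<forall>x\<in>supp \<eta>. norm x \<le> R" by (auto simp: bounded_iff)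
  \<comment> \<open>The extra 1 makes room for all translations of length at most 1, so one compact
    domain of integration serves a whole neighbourhood of 0.\<close>
  define K where "K = cball (0::'a) (R + 1)"
  have K: "K \<in> sets lebesgue" "compact K" by (auto simp: K_def)
  have out: "y - x \<notin> supp \<eta>" if "y \<notin> K" "norm x \<le> 1" for x y
    using R that norm_triangle_ineq4[of y x] norm_triangle_ineq2[of y x] by (force simp: K_def)
  have one: "integrable (lebesgue_on K) (\<lambda>y. 1::real)"
    by (rule integrable_continuous_compact) (use K in auto)
  let ?F = "\<lambda>x. LINT y|lebesgue_on K. \<eta> (y - x) *\<^sub>R (1::real)"
  have F: "?F x = ?F 0" if "norm x < 1" for x
  proof -
    have "?F x = (LINT y|lebesgue. \<eta> (y - x))"
      using integral_lebesgue_on_eq[OF K(1), of "\<lambda>y. \<eta> (y - x)"] out that supp_eq_0[of _ \<eta>] by simp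
    also have "\<dots> = (LINT y|lebesgue. \<eta> y)"
      using integral_lebesgue_translate[of \<eta> "- x"] borel_measurable_continuous_onI[OF C_diff_continuous[OF \<eta>(1)]]
      by simp
    also have "\<dots> = ?F 0"
      using integral_lebesgue_on_eq[OF K(1), of "\<lambda>y. \<eta> (y - 0)"] out[of _ 0] supp_eq_0[of _ \<eta>] by simp
    finally show ?thesis .
  qed
  have "(?F has_derivative (\<lambda>h. 0)) (at 0)"
    by (rule has_derivative_transform_within_open[OF has_derivative_const, of "ball 0 1" 0 "?F 0"])
       (use F in auto)
  moreover have "(?F has_derivative (\<lambda>h. - (LINT y|lebesgue_on K. (grad \<eta> (y - 0) \<bullet> h) *\<^sub>R (1::real)))) (at 0)"
    by (rule correlation_has_derivative[OF K(1) one \<eta>])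
  ultimately have "(\<lambda>h. - (LINT y|lebesgue_on K. (grad \<eta> (y - 0) \<bullet> h) *\<^sub>R (1::real))) = (\<lambda>h. 0)"
    using has_derivative_unique by blast
  then have *: "(LINT y|lebesgue_on K. grad \<eta> y \<bullet> h) = 0" for h
    by (simp add: fun_eq_iff)
  have "integrable (lebesgue_on K) (grad \<eta>)"
    by (rule integrable_continuous_compact[OF grad_continuous[OF \<eta>(1)] K(2)])
  then have "(LINT y|lebesgue_on K. grad \<eta> y) \<bullet> h = 0" for h
    using * by (simp add: integral_inner_left)
  then have "(LINT y|lebesgue_on K. grad \<eta> y) = 0"
    using inner_eq_zero_iff by blast
  then show ?thesis
    using integral_lebesgue_on_eq[OF K(1), of "grad \<eta>"] grad_eq_0[of _ \<eta>] out[of _ 0] by simp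
qed

lemma grad_mult:
  fixes \<phi> \<psi> :: "'a::euclidean_space \<Rightarrow> real"
  assumes "C_diff 1 \<phi>" "C_diff 1 \<psi>"
  shows "grad (\<lambda>x. \<psi> x * \<phi> x) x = \<psi> x *\<^sub>R grad \<phi> x + \<phi> x *\<^sub>R grad \<psi> x"
  by (rule grad_eqI)
     (rule has_derivative_eq_rhs[OF has_derivative_mult[OF grad_has_derivative[OF assms(2)] grad_has_derivative[OF assms(1)]]],
      auto simp: inner_add_left)

text \<open>The gradient of the product integrates to 0; compact support of one factor suffices to
  confine the product.\<close>

lemma integral_by_parts:
  fixes \<phi> \<psi> :: "'a::euclidean_space \<Rightarrow> real"
  assumes \<phi>: "C_diff 1 \<phi>" "compact (supp \<phi>)" and \<psi>: "C_diff 1 \<psi>"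
  shows "(LINT x|lebesgue. \<psi> x *\<^sub>R grad \<phi> x) = - (LINT x|lebesgue. \<phi> x *\<^sub>R grad \<psi> x)"
proof -
  let ?p = "\<lambda>x. \<psi> x * \<phi> x"
  have "supp ?p \<subseteq> supp \<phi>" unfolding supp_def by (rule closure_mono) auto
  then have "compact (supp ?p)"
    using \<phi>(2) compact_Int_closed[of "supp \<phi>" "supp ?p"] by (simp add: supp_def inf.absorb2)
  then have "(LINT x|lebesgue. grad ?p x) = 0"
    by (intro integral_grad_eq_0 C_diff_mult \<phi> \<psi>)
  moreover have "integrable lebesgue (\<lambda>x. \<psi> x *\<^sub>R grad \<phi> x)"
    by (rule integrable_continuous_compact_supp[OF _ \<phi>(2)])
       (auto intro!: continuous_intros C_diff_continuous[OF \<psi>] grad_continuous[OF \<phi>(1)] simp: grad_eq_0)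
  moreover have "integrable lebesgue (\<lambda>x. \<phi> x *\<^sub>R grad \<psi> x)"
    by (rule integrable_continuous_compact_supp[OF _ \<phi>(2)])
       (auto intro!: continuous_intros C_diff_continuous[OF \<phi>(1)] grad_continuous[OF \<psi>] simp: supp_eq_0)
  ultimately show ?thesis
    by (simp add: grad_mult[OF \<phi>(1) \<psi>] eq_neg_iff_add_eq_0)
qed

lemma is_weak_grad_C1:
  assumes "open \<Omega>" "C_diff 1 \<psi>"
  shows "is_weak_grad \<Omega> \<psi> (grad \<psi>)"
  unfolding is_weak_grad_def
proof (intro conjI allI impI ballI)
  show "grad \<psi> \<in> borel_measurable (lebesgue_on \<Omega>)"
    by (rule continuous_borel_measurable_lebesgue_on[OF grad_continuous[OF assms(2)]])
  show "integrable (lebesgue_on K) (grad \<psi>)" if "compact K \<and> K \<subseteq> \<Omega>" for K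
    using that by (intro integrable_continuous_compact grad_continuous assms) auto
  fix \<phi> assume \<phi>: "\<phi> \<in> test_functions \<Omega>"
  have \<Omega>: "\<Omega> \<in> sets lebesgue" using assms(1) by auto
  have out: "\<phi> x = 0 \<and> grad \<phi> x = 0" if "x \<notin> \<Omega>" for x
    using that test_functions_C1c(3)[OF \<phi>] supp_eq_0[of x \<phi>] grad_eq_0[of x \<phi>] by blast
  show "(LINT x|lebesgue_on \<Omega>. \<psi> x *\<^sub>R grad \<phi> x) = - (LINT x|lebesgue_on \<Omega>. \<phi> x *\<^sub>R grad \<psi> x)"
    using integral_by_parts[OF test_functions_C1c(1,2)[OF \<phi>] assms(2)]
      integral_lebesgue_on_eq[OF \<Omega>, of "\<lambda>x. \<psi> x *\<^sub>R grad \<phi> x"]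
      integral_lebesgue_on_eq[OF \<Omega>, of "\<lambda>x. \<phi> x *\<^sub>R grad \<psi> x"] out by simp
qed

subsection \<open>Uniqueness of weak gradients\<close>

lemma integrable_compact_supp_scaleR:
  fixes w :: "'a::euclidean_space \<Rightarrow> 'b::euclidean_space" and \<phi> :: "'a \<Rightarrow> real"
  assumes \<Omega>: "\<Omega> \<in> sets lebesgue" and K: "compact K" "K \<subseteq> \<Omega>" and w: "integrable (lebesgue_on K) w"
    and \<phi>: "continuous_on UNIV \<phi>" "\<And>x. x \<notin> K \<Longrightarrow> \<phi> x = 0"
  shows "integrable (lebesgue_on \<Omega>) (\<lambda>x. \<phi> x *\<^sub>R w x)"
proof -
  have Km: "K \<in> sets lebesgue" using K(1) by (intro fmeasurableD lmeasurable_compact)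
  obtain B where B: "\<And>x. norm (\<phi> x) \<le> B" using bounded_range_if_supp[OF \<phi>(1) K(1)] \<phi>(2) by metis
  have "integrable (lebesgue_on K) (\<lambda>x. \<phi> x *\<^sub>R w x)"
    by (rule integrable_bounded_scaleR[OF w continuous_borel_measurable_lebesgue_on[OF \<phi>(1)]])
       (use B in auto)
  then show ?thesis
    using integrable_lebesgue_on_iff[OF Km, of "\<lambda>x. \<phi> x *\<^sub>R w x"]
      integrable_lebesgue_on_iff[OF \<Omega>, of "\<lambda>x. \<phi> x *\<^sub>R w x"] \<phi>(2) K(2) by (simp add: subset_iff) blast
qed

text \<open>The criterion that a function with vanishing integrals over all measurable sets is null
  asks for a sigma-finite measure.\<close>

lemma sigma_finite_lebesgue: "sigma_finite_measure (lebesgue :: 'a::euclidean_space measure)"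
proof
  obtain A :: "'a set set" where A: "countable A" "A \<subseteq> sets lborel" "\<Union>A = space lborel"
      "\<forall>a\<in>A. emeasure lborel a \<noteq> \<infinity>"
    using lborel.sigma_finite_countable by blast
  show "\<exists>A::'a set set. countable A \<and> A \<subseteq> sets lebesgue \<and> \<Union>A = space lebesgue \<and>
      (\<forall>a\<in>A. emeasure lebesgue a \<noteq> \<infinity>)"
    by (rule exI[of _ A]) (use A in \<open>auto simp: subset_iff\<close>)
qed

text \<open>Boxes are stable under intersection and generate the Borel sets, so a Dynkin argument
  extends the hypothesis to them; Lebesgue sets differ from Borel sets by null sets. Confining
  \<open>h\<close> to one box makes its total integral vanish, which the complement step
  needs.\<close>

lemma AE_eq_0_if_box_integrals:
  fixes h :: "'a::euclidean_space \<Rightarrow> 'b::euclidean_space"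
  assumes h: "integrable lebesgue h" and out: "\<And>x. x \<notin> box c d \<Longrightarrow> h x = 0"
    and box: "\<And>a b. (LINT x|lebesgue. indicator (box a b) x *\<^sub>R h x) = 0"
  shows "AE x in lebesgue. h x = 0"
proof (rule sigma_finite_measure.density_zero[OF sigma_finite_lebesgue h])
  have int: "set_integrable lebesgue A h" if "A \<in> sets lebesgue" for A
    unfolding set_integrable_def using that h integrable_mult_indicator by blast
  have borel: "set_lebesgue_integral lebesgue A h = 0" if A: "A \<in> sets borel" for A :: "'a set"
  proof -
    let ?E = "range (\<lambda>(a, b). box a b :: 'a set)"
    have "Int_stable ?E" by (auto simp: Int_stable_def box_Int_box)
    moreover have "?E \<subseteq> Pow UNIV" by auto
    moreover have "A \<in> sigma_sets UNIV ?E" using A unfolding borel_eq_box by simp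
    ultimately show ?thesis
    proof (induction rule: sigma_sets_induct_disjoint)
      case (basic A) then show ?case by (auto simp: set_lebesgue_integral_def box)
    next
      case (compl A)
      then have A: "A \<in> sets lebesgue" by (simp add: borel_eq_box)
      have "h = (\<lambda>x. indicator (box c d) x *\<^sub>R h x)" using out by (auto simp: indicator_def)
      then have "(LINT x|lebesgue. h x) = 0" using box[of c d] by metis
      moreover have "(LINT x|lebesgue. indicator (UNIV - A) x *\<^sub>R h x) =
        (LINT x|lebesgue. h x - indicator A x *\<^sub>R h x)"
        by (intro Bochner_Integration.integral_cong) (auto simp: indicator_def)
      ultimately show ?case
        using compl.IH int[OF A] h by (simp add: set_lebesgue_integral_def set_integrable_def)
    next
      case (union F)
      then have F: "F i \<in> sets lebesgue" for i by (simp add: borel_eq_box subset_eq)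
      have "set_lebesgue_integral lebesgue (\<Union>i. F i) h = (\<Sum>i. set_lebesgue_integral lebesgue (F i) h)"
        by (rule lebesgue_integral_countable_add)
           (use F union.hyps in \<open>auto intro!: int simp: disjoint_family_on_def\<close>)
      then show ?case using union.IH by simp
    qed (simp add: set_lebesgue_integral_def)
  qed
  show "set_lebesgue_integral lebesgue A h = 0" if A: "A \<in> sets lebesgue" for A
  proof -
    obtain S N N' where SN: "A = S \<union> N" "N \<subseteq> N'" "N' \<in> null_sets lborel" "S \<in> sets lborel"
      using sets_completionE[OF A] by blast
    then have "N' \<in> null_sets lebesgue" by (blast intro: null_sets_completionI)
    then have "AE x in lebesgue. x \<notin> N'" by (rule AE_not_in)
    then have "AE x in lebesgue. indicator A x *\<^sub>R h x = indicator S x *\<^sub>R h x"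
      by eventually_elim (use SN in \<open>auto simp: indicator_def\<close>)
    then have "set_lebesgue_integral lebesgue A h = set_lebesgue_integral lebesgue S h"
      unfolding set_lebesgue_integral_def
      using int[of A] int[of S] A SN(4)
      by (intro integral_cong_AE) (auto simp: set_integrable_def)
    then show ?thesis using borel[of S] SN(4) by simp
  qed
qed

text \<open>The claim is local: countably many closed boxes inside \<Omega> cover it. On each of
  them bumps are admissible test functions, and their limits are indicators of smaller
  boxes.\<close>

lemma fundamental_lemma_calculus_of_variations:
  fixes h :: "'a::euclidean_space \<Rightarrow> 'b::euclidean_space"
  assumes \<Omega>: "open \<Omega>" and h: "\<And>K. compact K \<Longrightarrow> K \<subseteq> \<Omega> \<Longrightarrow> integrable (lebesgue_on K) h"
    and 0: "\<And>\<phi>. \<phi> \<in> test_functions \<Omega> \<Longrightarrow> (LINT x|lebesgue_on \<Omega>. \<phi> x *\<^sub>R h x) = 0"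
  shows "AE x in lebesgue_on \<Omega>. h x = 0"
proof -
  have \<Omega>m: "\<Omega> \<in> sets lebesgue" using \<Omega> by auto
  have *: "AE x in lebesgue. x \<in> cbox c d \<longrightarrow> h x = 0" if cd: "cbox c d \<subseteq> \<Omega>" for c d
  proof -
    let ?h = "\<lambda>x. indicator (box c d) x *\<^sub>R h x"
    have hcd: "integrable lebesgue (\<lambda>x. indicator (cbox c d) x *\<^sub>R h x)"
      using h[OF compact_cbox cd] by (simp add: integrable_restrict_space)
    have "integrable lebesgue (\<lambda>x. indicator (box c d) x *\<^sub>R (indicator (cbox c d) x *\<^sub>R h x))"
      by (rule integrable_mult_indicator[OF _ hcd]) auto
    moreover have "(\<lambda>x. indicator (box c d) x *\<^sub>R (indicator (cbox c d) x *\<^sub>R h x)) = ?h"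
      using box_subset_cbox[of c d] by (auto simp: indicator_def fun_eq_iff)
    ultimately have int: "integrable lebesgue ?h" by simp
    have "(LINT x|lebesgue. indicator (box a b) x *\<^sub>R ?h x) = 0" for a b
    proof -
      \<comment> \<open>Cutting an arbitrary box down to the fixed one leaves a box, and its bump is
        a test function on \<Omega>. The empty case is separate because \<open>cbox a' b'\<close>
        may be nonempty even though \<open>box a' b'\<close> is empty.\<close>
      obtain a' b' where ab: "box a b \<inter> box c d = box a' b'" by (rule that[OF box_Int_box])
      show ?thesis
      proof (cases "box a' b' = {}")
        case True
        then have "(\<lambda>x. indicator (box a b) x *\<^sub>R ?h x) = (\<lambda>x. 0)"
          using ab by (auto simp: indicator_def fun_eq_iff)
        then show ?thesis by (simp only: Bochner_Integration.integral_zero)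
      next
        case False
        then have sub: "cbox a' b' \<subseteq> cbox c d"
          using ab box_subset_cbox[of c d] closure_box[of a' b'] closure_mono[of "box a' b'" "cbox c d"]
          by (metis closed_cbox closure_closed inf_le2 order_trans)
        have b0: "bump a' b' n x = 0" if "x \<notin> cbox c d" for n x
          using bump_eq_0[of x a' b' n] sub box_subset_cbox[of a' b'] that by blast
        have "(\<lambda>n. LINT x|lebesgue. bump a' b' n x *\<^sub>R (indicator (cbox c d) x *\<^sub>R h x)) \<longlonglongrightarrow>
          (LINT x|lebesgue. indicator (box a' b') x *\<^sub>R (indicator (cbox c d) x *\<^sub>R h x))"
        proof (rule integral_dominated_convergence[where w="\<lambda>x. norm (indicator (cbox c d) x *\<^sub>R h x)"])
          have m: "bump a' b' n \<in> borel_measurable lebesgue" for n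
            using continuous_borel_measurable_lebesgue_on[of "bump a' b' n" UNIV]
              C_diff_continuous[OF C_diff_bump, of a' b' n] by (simp add: lebesgue_on_UNIV_eq)
          show "(\<lambda>x. bump a' b' n x *\<^sub>R (indicator (cbox c d) x *\<^sub>R h x)) \<in> borel_measurable lebesgue" for n
            by (rule borel_measurable_scaleR[OF m borel_measurable_integrable[OF hcd]])
          show "(\<lambda>x. indicator (box a' b') x *\<^sub>R (indicator (cbox c d) x *\<^sub>R h x)) \<in> borel_measurable lebesgue"
            by (intro borel_measurable_scaleR[OF _ borel_measurable_integrable[OF hcd]] borel_measurable_indicator) simp
          show "AE x in lebesgue. (\<lambda>n. bump a' b' n x *\<^sub>R (indicator (cbox c d) x *\<^sub>R h x)) \<longlonglongrightarrow>
              indicator (box a' b') x *\<^sub>R (indicator (cbox c d) x *\<^sub>R h x)"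
            by (intro AE_I2 tendsto_scaleR bump_tendsto_indicator tendsto_const)
          show "AE x in lebesgue. norm (bump a' b' n x *\<^sub>R (indicator (cbox c d) x *\<^sub>R h x))
             \<le> norm (indicator (cbox c d) x *\<^sub>R h x)" for n
            by (intro AE_I2)
               (simp add: bump_nonneg bump_le_1 mult_left_le_one_le mult.assoc)
        qed (rule integrable_norm[OF hcd])
        moreover have "(LINT x|lebesgue. bump a' b' n x *\<^sub>R (indicator (cbox c d) x *\<^sub>R h x)) = 0" for n
        proof -
          have "(LINT x|lebesgue. bump a' b' n x *\<^sub>R (indicator (cbox c d) x *\<^sub>R h x)) =
             (LINT x|lebesgue. bump a' b' n x *\<^sub>R h x)"
          proof (intro Bochner_Integration.integral_cong refl)
            show "bump a' b' n x *\<^sub>R (indicator (cbox c d) x *\<^sub>R h x) = bump a' b' n x *\<^sub>R h x" for x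
              by (cases "x \<in> cbox c d") (simp_all add: b0)
          qed
          also have "\<dots> = (LINT x|lebesgue_on \<Omega>. bump a' b' n x *\<^sub>R h x)"
            using cd b0 by (intro integral_lebesgue_on_eq[symmetric] \<Omega>m) (auto simp: subset_iff)
          also have "\<dots> = 0" by (rule 0[OF bump_test_function]) (use sub cd in blast)
          finally show ?thesis .
        qed
        ultimately have "(LINT x|lebesgue. indicator (box a' b') x *\<^sub>R (indicator (cbox c d) x *\<^sub>R h x)) = 0"
          by (simp add: LIMSEQ_const_iff)
        moreover have "(\<lambda>x. indicator (box a' b') x *\<^sub>R (indicator (cbox c d) x *\<^sub>R h x)) =
            (\<lambda>x. indicator (box a b) x *\<^sub>R ?h x)"
          using ab box_subset_cbox[of c d] by (auto simp: indicator_def set_eq_iff fun_eq_iff)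
        ultimately show ?thesis by (simp only:)
      qed
    qed
    then have ae: "AE x in lebesgue. ?h x = 0"
      by (intro AE_eq_0_if_box_integrals[OF int, of c d]) auto
    \<comment> \<open>The faces are a null set; closed boxes are what the covering below
      provides.\<close>
    have "cbox c d - box c d \<in> null_sets lebesgue"
      using negligible_frontier_interval[of c d] by (simp only: negligible_iff_null_sets)
    then have "AE x in lebesgue. x \<notin> cbox c d - box c d" by (rule AE_not_in)
    with ae show ?thesis by eventually_elim (auto simp: indicator_def)
  qed
  obtain D where D: "countable D" "D \<subseteq> Pow \<Omega>" "\<And>X. X \<in> D \<Longrightarrow> \<exists>a b. X = cbox a b" "\<Union>D = \<Omega>"
    using open_countable_Union_open_cbox[OF \<Omega>] by metis
  have "AE x in lebesgue. \<forall>X\<in>D. x \<in> X \<longrightarrow> h x = 0"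
    unfolding AE_ball_countable[OF D(1)]
  proof
    fix X assume "X \<in> D"
    then obtain a b where "X = cbox a b" "cbox a b \<subseteq> \<Omega>" using D(2,3) by blast
    then show "AE x in lebesgue. x \<in> X \<longrightarrow> h x = 0" using * by blast
  qed
  then have "AE x in lebesgue. x \<in> \<Omega> \<longrightarrow> h x = 0"
    by eventually_elim (use D(4) in blast)
  then show ?thesis using \<Omega>m by (simp add: AE_restrict_space_iff)
qed

lemma is_weak_grad_unique:
  assumes \<Omega>: "open \<Omega>" and w: "is_weak_grad \<Omega> v w" and w': "is_weak_grad \<Omega> v w'"
  shows "AE x in lebesgue_on \<Omega>. w x = w' x"
proof -
  have \<Omega>m: "\<Omega> \<in> sets lebesgue" using \<Omega> by auto
  have "AE x in lebesgue_on \<Omega>. w x - w' x = 0"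
  proof (rule fundamental_lemma_calculus_of_variations[OF \<Omega>])
    show "integrable (lebesgue_on K) (\<lambda>x. w x - w' x)" if "compact K" "K \<subseteq> \<Omega>" for K
      using w w' that by (auto simp: is_weak_grad_def)
    fix \<phi> assume \<phi>: "\<phi> \<in> test_functions \<Omega>"
    note \<phi>' = test_functions_C1c[OF \<phi>]
    have "integrable (lebesgue_on \<Omega>) (\<lambda>x. \<phi> x *\<^sub>R u x)" if "is_weak_grad \<Omega> v u" for u
      using that \<phi>' by (intro integrable_compact_supp_scaleR[OF \<Omega>m \<phi>'(2,3)] C_diff_continuous[OF \<phi>'(1)] supp_eq_0)
        (auto simp: is_weak_grad_def)
    moreover have "(LINT x|lebesgue_on \<Omega>. \<phi> x *\<^sub>R w x) = (LINT x|lebesgue_on \<Omega>. \<phi> x *\<^sub>R w' x)"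
      using w w' \<phi> unfolding is_weak_grad_def by (metis minus_equation_iff)
    ultimately show "(LINT x|lebesgue_on \<Omega>. \<phi> x *\<^sub>R (w x - w' x)) = 0"
      using w w' by (simp add: scaleR_diff_right)
  qed
  then show ?thesis by simp
qed

lemma weak_grad_works:
  assumes "is_weak_grad \<Omega> v w"
  shows "is_weak_grad \<Omega> v (weak_grad \<Omega> v)"
  unfolding weak_grad_def by (rule someI[where P="is_weak_grad \<Omega> v", OF assms])

lemma weak_grad_eq:
  assumes "open \<Omega>" "is_weak_grad \<Omega> v w"
  shows "AE x in lebesgue_on \<Omega>. weak_grad \<Omega> v x = w x"
  using is_weak_grad_unique[OF assms(1) weak_grad_works[OF assms(2)] assms(2)] .

subsection \<open>Lipschitz bounds from weak gradient bounds\<close>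

lemma bump_translate: "bump (a + p) (b + p) n z = bump a b n (z - p)"
  by (simp add: bump_def inner_diff_left inner_add_left algebra_simps)

lemma grad_translate:
  fixes \<phi> :: "'a::euclidean_space \<Rightarrow> real"
  assumes "C_diff 1 \<phi>"
  shows "grad (\<lambda>z. \<phi> (z - p)) z = grad \<phi> (z - p)"
proof (rule grad_eqI, rule has_derivative_compose[OF _ grad_has_derivative[OF assms]])
  show "((\<lambda>z. z - p) has_derivative (\<lambda>h. h)) (at z)" by (auto intro!: derivative_eq_intros)
qed

lemma norm_weak_integral_le:
  fixes w :: "'a::euclidean_space \<Rightarrow> 'b::euclidean_space"
  assumes "integrable M \<phi>" "integrable M (\<lambda>x. \<phi> x *\<^sub>R w x)" "\<And>x. 0 \<le> \<phi> x" "AE x in M. norm (w x) \<le> s"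
  shows "norm (LINT x|M. \<phi> x *\<^sub>R w x) \<le> s * (LINT x|M. \<phi> x)"
proof -
  have "norm (LINT x|M. \<phi> x *\<^sub>R w x) \<le> (LINT x|M. norm (\<phi> x *\<^sub>R w x))"
    by (rule integral_norm_bound)
  also have "\<dots> \<le> (LINT x|M. \<phi> x * s)"
  proof (rule integral_mono_AE)
    show "AE x in M. norm (\<phi> x *\<^sub>R w x) \<le> \<phi> x * s"
      using assms(4) by eventually_elim (use assms(3) in \<open>auto intro!: mult_left_mono\<close>)
  next
    show "integrable M (\<lambda>x. norm (\<phi> x *\<^sub>R w x))" by (rule integrable_norm[OF assms(2)])
    show "integrable M (\<lambda>x. \<phi> x * s)" using assms(1) by simp
  qed
  finally show ?thesis by (simp add: mult.commute)
qed

lemma test_function_bump_integral_pos: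
  assumes "box a b \<noteq> {}"
  shows "0 < (LINT x|lebesgue. bump a b n x)"
proof -
  have int: "integrable lebesgue (bump a b n)"
    by (rule integrable_continuous_compact_supp[OF C_diff_continuous[OF C_diff_bump] compact_supp_bump])
       (rule supp_eq_0)
  have "(LINT x|lebesgue. bump a b n x) \<noteq> 0"
  proof
    assume "(LINT x|lebesgue. bump a b n x) = 0"
    then have "AE x in lebesgue. bump a b n x = 0"
      using integral_nonneg_eq_0_iff_AE[OF int AE_I2[OF bump_nonneg]] by simp
    then have "AE x in lebesgue. x \<notin> box a b"
      by eventually_elim (use bump_pos[of _ a b n] in force)
    then have "box a b \<in> null_sets lebesgue" by (simp add: AE_iff_null_sets)
    then show False using open_not_negligible[OF open_box assms] by (simp add: negligible_iff_null_sets)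
  qed
  moreover have "0 \<le> (LINT x|lebesgue. bump a b n x)"
    by (intro Bochner_Integration.integral_nonneg bump_nonneg)
  ultimately show ?thesis by simp
qed

lemma small_cbox:
  fixes x :: "'a::euclidean_space"
  assumes "r > 0"
  obtains e where "e > 0" "cbox (x - e *\<^sub>R One) (x + e *\<^sub>R One) \<subseteq> cball x r" "box (x - e *\<^sub>R One) (x + e *\<^sub>R One) \<noteq> {}"
proof -
  \<comment> \<open>The norm is at most the l1 norm, a sum of \<open>DIM('a)\<close> coordinates of
    size at most \<open>e\<close>.\<close>
  define e where "e = r / DIM('a)"
  have e: "e > 0" using assms by (simp add: e_def)
  have "dist x z \<le> r" if z: "z \<in> cbox (x - e *\<^sub>R One) (x + e *\<^sub>R One)" for z
  proof -
    have "dist x z = norm (z - x)" by (simp add: dist_norm norm_minus_commute)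
    also have "\<dots> \<le> (\<Sum>i\<in>Basis. \<bar>(z - x) \<bullet> i\<bar>)" by (rule norm_le_l1)
    also have "\<dots> \<le> (\<Sum>i\<in>(Basis::'a set). e)"
      by (rule sum_mono) (use z in \<open>auto simp: mem_box inner_diff_left inner_add_left abs_le_iff algebra_simps\<close>)
    also have "\<dots> = r" by (simp add: e_def)
    finally show ?thesis .
  qed
  moreover have "x \<in> box (x - e *\<^sub>R One) (x + e *\<^sub>R One)"
    using e by (auto simp: mem_box inner_diff_left inner_add_left)
  ultimately show ?thesis using that[OF e] by (auto simp: subset_iff)
qed

text \<open>Nothing is known about \<open>w\<close> on a given line, so the mean value inequality is
  applied to averages of \<open>v\<close> against a bump sliding along the segment. The derivative
  of such an average is the average of \<open>w\<close> in the direction of the segment. At both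
  ends a narrow bump compares the average with the value of \<open>v\<close>.\<close>

lemma weak_grad_bound_segment:
  fixes v :: "'a::euclidean_space \<Rightarrow> real"
  assumes \<Omega>: "open \<Omega>" and w: "is_weak_grad \<Omega> v w" and ws: "AE x in lebesgue_on \<Omega>. norm (w x) \<le> s"
    and v: "continuous_on \<Omega> v" "integrable (lebesgue_on \<Omega>) v" and xy: "closed_segment x y \<subseteq> \<Omega>"
  shows "\<bar>v x - v y\<bar> \<le> s * dist x y"
proof (rule field_le_epsilon)
  fix \<delta>' :: real assume "\<delta>' > 0"
  define \<delta> where "\<delta> = \<delta>' / 2"
  have \<delta>: "\<delta> > 0" using \<open>\<delta>' > 0\<close> by (simp add: \<delta>_def)
  have \<Omega>m: "\<Omega> \<in> sets lebesgue" using \<Omega> by auto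
  define h where "h = y - x"
  have seg: "x + t *\<^sub>R h \<in> \<Omega>" if "0 \<le> t" "t \<le> 1" for t
  proof -
    have "x + t *\<^sub>R h = (1 - t) *\<^sub>R x + t *\<^sub>R y" by (simp add: h_def algebra_simps)
    then show ?thesis using that xy by (auto simp: closed_segment_def)
  qed
  obtain r where r0: "r > 0" "(\<Union>z\<in>closed_segment x y. cball z r) \<subseteq> \<Omega>"
    by (rule compact_subset_open_imp_cball_epsilon_subset[OF compact_segment \<Omega> xy])
  then have r: "cball z r \<subseteq> \<Omega>" if "z \<in> closed_segment x y" for z
    using that by (simp add: UN_subset_iff)
  have "isCont v x" "isCont v y"
    using v(1) \<Omega> xy by (auto simp: continuous_on_eq_continuous_at)
  then obtain d1 d2 where d: "d1 > 0" "d2 > 0" "\<And>z. dist z x < d1 \<Longrightarrow> dist (v z) (v x) < \<delta>"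
      "\<And>z. dist z y < d2 \<Longrightarrow> dist (v z) (v y) < \<delta>"
    using \<delta> unfolding continuous_at_eps_delta by metis
  \<comment> \<open>At most \<open>r\<close>, so that every translated bump is supported in
    \<Omega>; below \<open>d1\<close> and \<open>d2\<close>, so that \<open>v\<close> varies by less
    than \<delta> on the bump at either end.\<close>
  define r' where "r' = min r (min (d1 / 2) (d2 / 2))"
  have r': "r' > 0" "r' \<le> r" "r' < d1" "r' < d2" using r0(1) d by (auto simp: r'_def)
  obtain e where e: "e > 0" "cbox (x - e *\<^sub>R One) (x + e *\<^sub>R One) \<subseteq> cball x r'"
      "box (x - e *\<^sub>R One) (x + e *\<^sub>R One) \<noteq> {}"
    using small_cbox[OF r'(1)] by blast
  define a b where "a = x - e *\<^sub>R One" and "b = x + e *\<^sub>R One"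
  define \<phi> where "\<phi> = bump a b 0"
  \<comment> \<open>The bump is not normalized; all averages carry the factor \<open>I\<close>,
    which is divided out at the end.\<close>
  define I where "I = (LINT z|lebesgue. \<phi> z)"
  have I: "I > 0" unfolding I_def \<phi>_def by (rule test_function_bump_integral_pos) (use e a_def b_def in simp)
  have \<phi>: "C_diff 1 \<phi>" "compact (supp \<phi>)" "\<And>z. 0 \<le> \<phi> z"
    by (auto simp: \<phi>_def C_diff_bump compact_supp_bump bump_nonneg)
  have \<phi>0: "dist z (x + p) \<le> r'" if "\<phi> (z - p) \<noteq> 0" for z p
  proof -
    have "z - p \<in> cbox a b" using that bump_eq_0[of "z - p" a b 0] box_subset_cbox[of a b] by (auto simp: \<phi>_def)
    then have "dist x (z - p) \<le> r'" using e(2) by (auto simp: a_def b_def)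
    then show ?thesis by (simp add: dist_norm algebra_simps norm_minus_commute)
  qed
  have test: "(\<lambda>z. \<phi> (z - t *\<^sub>R h)) \<in> test_functions \<Omega>" if t: "0 \<le> t" "t \<le> 1" for t
  proof -
    have "cbox (a + t *\<^sub>R h) (b + t *\<^sub>R h) = (+) (t *\<^sub>R h) ` cbox a b"
      by (simp only: add.commute[of _ "t *\<^sub>R h"] cbox_translation)
    also have "\<dots> \<subseteq> cball (x + t *\<^sub>R h) r"
    proof clarify
      fix z assume "z \<in> cbox a b"
      then have "dist x z \<le> r" using e(2) r'(2) by (force simp: a_def b_def)
      then show "t *\<^sub>R h + z \<in> cball (x + t *\<^sub>R h) r" by (simp add: dist_norm)
    qed
    also have "\<dots> \<subseteq> \<Omega>"
      by (rule r) (use t in \<open>auto simp: closed_segment_def h_def algebra_simps intro!: exI[of _ t]\<close>)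
    finally have "bump (a + t *\<^sub>R h) (b + t *\<^sub>R h) 0 \<in> test_functions \<Omega>" by (rule bump_test_function)
    then show ?thesis by (simp add: bump_translate[abs_def] \<phi>_def)
  qed
  have \<phi>I: "(LINT z|lebesgue_on \<Omega>. \<phi> (z - t *\<^sub>R h)) = I" "integrable (lebesgue_on \<Omega>) (\<lambda>z. \<phi> (z - t *\<^sub>R h))"
    if t: "0 \<le> t" "t \<le> 1" for t
  proof -
    note T = test_functions_C1c[OF test[OF t]]
    have z: "\<phi> (z - t *\<^sub>R h) = 0" if "z \<notin> \<Omega>" for z using supp_eq_0[of z "\<lambda>z. \<phi> (z - t *\<^sub>R h)"] T(3) that by blast
    show "(LINT z|lebesgue_on \<Omega>. \<phi> (z - t *\<^sub>R h)) = I"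
      using integral_lebesgue_on_eq[OF \<Omega>m, of "\<lambda>z. \<phi> (z - t *\<^sub>R h)"] z
        integral_lebesgue_translate[of \<phi> "- (t *\<^sub>R h)"] borel_measurable_continuous_onI[OF C_diff_continuous[OF \<phi>(1)]]
      by (simp add: I_def)
    have "integrable lebesgue (\<lambda>z. \<phi> (z - t *\<^sub>R h))"
      by (rule integrable_continuous_compact_supp[OF C_diff_continuous[OF T(1)] T(2)]) (rule supp_eq_0)
    then show "integrable (lebesgue_on \<Omega>) (\<lambda>z. \<phi> (z - t *\<^sub>R h))"
      using integrable_lebesgue_on_iff[OF \<Omega>m, of "\<lambda>z. \<phi> (z - t *\<^sub>R h)"] z by blast
  qed
  define F where "F p = (LINT z|lebesgue_on \<Omega>. \<phi> (z - p) *\<^sub>R v z)" for p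
  obtain B where B: "\<And>z. norm (\<phi> z) \<le> B"
    using C1c_bounds[OF \<phi>(1,2)] by (metis real_norm_def)
  have \<phi>v: "integrable (lebesgue_on \<Omega>) (\<lambda>z. \<phi> (z - p) *\<^sub>R v z)" for p
    by (rule integrable_bounded_scaleR[OF v(2) continuous_borel_measurable_lebesgue_on])
       (use B in \<open>auto intro!: continuous_on_compose2[OF C_diff_continuous[OF \<phi>(1)]] continuous_intros\<close>)
  have near: "\<bar>F (t *\<^sub>R h) - v q * I\<bar> \<le> \<delta> * I"
    if t: "0 \<le> t" "t \<le> 1" and q: "\<And>z. dist z (x + t *\<^sub>R h) \<le> r' \<Longrightarrow> dist (v z) (v q) < \<delta>" for t q
  proof -
    have "F (t *\<^sub>R h) - v q * I = (LINT z|lebesgue_on \<Omega>. \<phi> (z - t *\<^sub>R h) *\<^sub>R v z - v q * \<phi> (z - t *\<^sub>R h))"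
      using \<phi>v \<phi>I(2)[OF t] \<phi>I(1)[OF t] by (simp add: F_def)
    also have "norm \<dots> \<le> (LINT z|lebesgue_on \<Omega>. \<delta> * \<phi> (z - t *\<^sub>R h))"
    proof (rule Bochner_Integration.integral_norm_bound_integral)
      fix z
      show "norm (\<phi> (z - t *\<^sub>R h) *\<^sub>R v z - v q * \<phi> (z - t *\<^sub>R h)) \<le> \<delta> * \<phi> (z - t *\<^sub>R h)"
      proof (cases "\<phi> (z - t *\<^sub>R h) = 0")
        case False
        have "norm (\<phi> (z - t *\<^sub>R h) *\<^sub>R v z - v q * \<phi> (z - t *\<^sub>R h)) = \<phi> (z - t *\<^sub>R h) * \<bar>v z - v q\<bar>"
        proof -
          have "\<phi> (z - t *\<^sub>R h) *\<^sub>R v z - v q * \<phi> (z - t *\<^sub>R h) = \<phi> (z - t *\<^sub>R h) * (v z - v q)"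
            by (simp add: algebra_simps)
          then show ?thesis using \<phi>(3)[of "z - t *\<^sub>R h"] by (simp add: abs_mult)
        qed
        also have "\<dots> \<le> \<phi> (z - t *\<^sub>R h) * \<delta>"
          using q[OF \<phi>0[OF False]] \<phi>(3)[of "z - t *\<^sub>R h"] by (intro mult_left_mono) (auto simp: dist_real_def)
        finally show ?thesis by (simp add: mult.commute)
      qed simp
    qed (use \<phi>v \<phi>I(2)[OF t] in auto)
    also have "\<dots> = \<delta> * I" using \<phi>I(1)[OF t] by simp
    finally show ?thesis by simp
  qed
  have "norm (F (1 *\<^sub>R h) - F (0 *\<^sub>R h)) \<le> (s * norm h * I) * norm (1 - 0::real)"
  proof (rule differentiable_bound[where S="{0..1}" and f="\<lambda>t. F (t *\<^sub>R h)"])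
    fix t :: real assume "t \<in> {0..1}"
    then have t: "0 \<le> t" "t \<le> 1" by auto
    let ?D = "\<lambda>k. - (LINT z|lebesgue_on \<Omega>. (grad \<phi> (z - t *\<^sub>R h) \<bullet> (k *\<^sub>R h)) *\<^sub>R v z)"
    have "((\<lambda>t. F (t *\<^sub>R h)) has_derivative ?D) (at t)"
      unfolding F_def
    proof (rule has_derivative_compose[OF _ correlation_has_derivative[OF \<Omega>m v(2) \<phi>(1,2)]])
      show "((\<lambda>t. t *\<^sub>R h) has_derivative (\<lambda>k. k *\<^sub>R h)) (at t)" by (auto intro!: derivative_eq_intros)
    qed
    then show "((\<lambda>t. F (t *\<^sub>R h)) has_derivative ?D) (at t within {0..1})"
      by (rule has_derivative_at_withinI)
    note T = test_functions_C1c[OF test[OF t]]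
    have wi: "integrable (lebesgue_on \<Omega>) (\<lambda>z. \<phi> (z - t *\<^sub>R h) *\<^sub>R w z)"
      by (rule integrable_compact_supp_scaleR[OF \<Omega>m T(2,3) _ C_diff_continuous[OF T(1)]])
         (use w T(2,3) supp_eq_0[of _ "\<lambda>z. \<phi> (z - t *\<^sub>R h)"] in \<open>auto simp: is_weak_grad_def\<close>)
    note gi = integrable_scaleR_grad[OF v(2) \<phi>(1,2), of "t *\<^sub>R h"]
    \<comment> \<open>The gradient falls on the translated bump, a test function, so the defining
      identity of the weak gradient turns the derivative into an average of
      \<open>w\<close>.\<close>
    have D: "?D k = k * ((LINT z|lebesgue_on \<Omega>. \<phi> (z - t *\<^sub>R h) *\<^sub>R w z) \<bullet> h)" for k
    proof -
      have "?D k = - (LINT z|lebesgue_on \<Omega>. (v z *\<^sub>R grad \<phi> (z - t *\<^sub>R h)) \<bullet> (k *\<^sub>R h))"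
        by (simp add: mult_ac)
      also have "\<dots> = - (LINT z|lebesgue_on \<Omega>. v z *\<^sub>R grad (\<lambda>z. \<phi> (z - t *\<^sub>R h)) z) \<bullet> (k *\<^sub>R h)"
        by (simp only: integral_inner_left[OF gi] grad_translate[OF \<phi>(1)] inner_minus_left)
      also have "\<dots> = (LINT z|lebesgue_on \<Omega>. \<phi> (z - t *\<^sub>R h) *\<^sub>R w z) \<bullet> (k *\<^sub>R h)"
        using w test[OF t] by (simp add: is_weak_grad_def)
      finally show ?thesis by simp
    qed
    have Q: "\<bar>(LINT z|lebesgue_on \<Omega>. \<phi> (z - t *\<^sub>R h) *\<^sub>R w z) \<bullet> h\<bar> \<le> (s * I) * norm h"
    proof -
      have "norm (LINT z|lebesgue_on \<Omega>. \<phi> (z - t *\<^sub>R h) *\<^sub>R w z) \<le> s * I"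
        using norm_weak_integral_le[OF \<phi>I(2)[OF t] wi \<phi>(3) ws] \<phi>I(1)[OF t] by simp
      then show ?thesis
        using Cauchy_Schwarz_ineq2 mult_right_mono[OF _ norm_ge_zero] order_trans by blast
    qed
    show "onorm ?D \<le> s * norm h * I"
    proof (rule onorm_le)
      fix k :: real
      have "norm (?D k) = \<bar>k\<bar> * \<bar>(LINT z|lebesgue_on \<Omega>. \<phi> (z - t *\<^sub>R h) *\<^sub>R w z) \<bullet> h\<bar>"
        by (simp only: D[of k] real_norm_def abs_mult)
      also have "\<dots> \<le> \<bar>k\<bar> * ((s * I) * norm h)" by (rule mult_left_mono[OF Q]) simp
      finally show "norm (?D k) \<le> s * norm h * I * norm k" by (simp only: real_norm_def mult_ac)
    qed
  qed auto
  then have "\<bar>F (1 *\<^sub>R h) - F (0 *\<^sub>R h)\<bar> \<le> s * norm h * I" by simp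
  moreover have "\<bar>F (0 *\<^sub>R h) - v x * I\<bar> \<le> \<delta> * I"
    by (rule near) (use d r' in auto)
  moreover have "\<bar>F (1 *\<^sub>R h) - v y * I\<bar> \<le> \<delta> * I"
    by (rule near) (use d r' in \<open>auto simp: h_def\<close>)
  moreover have "\<delta>' * I = \<delta> * I + \<delta> * I" by (simp add: \<delta>_def)
  ultimately have "\<bar>v x * I - v y * I\<bar> \<le> s * norm h * I + \<delta>' * I" by linarith
  then have "\<bar>v x - v y\<bar> * I \<le> (s * norm h + \<delta>') * I"
    using I by (simp add: abs_mult[symmetric] left_diff_distrib distrib_right) (simp add: abs_mult left_diff_distrib[symmetric])
  then show "\<bar>v x - v y\<bar> \<le> s * dist x y + \<delta>'"
    using I by (simp add: h_def dist_norm norm_minus_commute)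
qed

text \<open>
  On a segment between two points of the closure, only the parts before the first and after the
  last boundary point need the interior estimate; the boundary values control the part in between.
\<close>
lemma lipschitz_on_closure_from_frontier:
  fixes v :: "'a::euclidean_space \<Rightarrow> real"
  assumes \<Omega>: "open \<Omega>" and v: "continuous_on (closure \<Omega>) v" and s: "0 \<le> s"
    and int: "\<And>x y. closed_segment x y \<subseteq> \<Omega> \<Longrightarrow> \<bar>v x - v y\<bar> \<le> s * dist x y"
    and bd: "\<And>x y. x \<in> frontier \<Omega> \<Longrightarrow> y \<in> frontier \<Omega> \<Longrightarrow> \<bar>v x - v y\<bar> \<le> s * dist x y"
  shows "s-lipschitz_on (closure \<Omega>) v"
proof (rule lipschitz_onI[OF _ s])
  fix x y assume x: "x \<in> closure \<Omega>" and y: "y \<in> closure \<Omega>"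
  define h where "h = y - x"
  define p where "p t = x + t *\<^sub>R h" for t
  have p01: "p 0 = x" "p 1 = y" by (auto simp: p_def h_def)
  have pd: "dist (p t) (p u) = \<bar>t - u\<bar> * norm h" for t u
    by (simp add: p_def dist_norm scaleR_diff_left[symmetric])
  have pc: "continuous_on A p" for A unfolding p_def by (intro continuous_intros)
  have pseg: "closed_segment (p t) (p u) = p ` closed_segment t u" for t u
  proof -
    have "p z = x + z *\<^sub>R h" for z by (simp add: p_def)
    then have "p ` closed_segment t u = (\<lambda>z. x + z) ` ((\<lambda>z. z *\<^sub>R h) ` closed_segment t u)"
      by (auto simp: image_image)
    also have "(\<lambda>z. z *\<^sub>R h) ` closed_segment t u = closed_segment (t *\<^sub>R h) (u *\<^sub>R h)"
      by (rule closed_segment_linear_image[symmetric]) (auto intro: linearI simp: scaleR_add_left)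
    also have "(\<lambda>z. x + z) ` \<dots> = closed_segment (x + t *\<^sub>R h) (x + u *\<^sub>R h)"
      by (rule closed_segment_translation[symmetric])
    finally show ?thesis by (simp add: p_def)
  qed
  have inner: "\<bar>v (p t) - v (p u)\<bar> \<le> s * dist (p t) (p u)"
    if tu: "t < u" and sub: "\<And>z. t < z \<Longrightarrow> z < u \<Longrightarrow> p z \<in> \<Omega>" for t u
  proof -
    \<comment> \<open>The interior estimate needs a closed segment inside \<Omega>. Both ends are
      moved inwards by some e below half the length, and continuity on the closure lets e tend to
      0.\<close>
    define c where "c = (u - t) / 2"
    have c: "c > 0" using tu by (simp add: c_def)
    have cl: "p z \<in> closure \<Omega>" if "t \<le> z" "z \<le> u" for z
    proof -
      have "p ` closure {t<..<u} \<subseteq> closure \<Omega>"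
        by (rule image_closure_subset[OF pc]) (use sub closure_subset[of \<Omega>] in auto)
      then show ?thesis using that tu by auto
    qed
    have "\<bar>v (p (t + 0)) - v (p (u - 0))\<bar> \<le> s * (u - t) * norm h"
    proof (rule continuous_le_on_closure[where S="{0<..<c}" and f="\<lambda>e. \<bar>v (p (t + e)) - v (p (u - e))\<bar>"])
      show "continuous_on (closure {0<..<c}) (\<lambda>e. \<bar>v (p (t + e)) - v (p (u - e))\<bar>)"
        using c by (auto intro!: continuous_intros continuous_on_compose2[OF v] continuous_on_compose2[OF pc[of UNIV]] cl
            simp: c_def field_simps)
      fix e assume e: "e \<in> {0<..<c}"
      have "closed_segment (p (t + e)) (p (u - e)) \<subseteq> \<Omega>"
        unfolding pseg using e by (auto simp: closed_segment_eq_real_ivl c_def field_simps intro!: sub)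
      then have "\<bar>v (p (t + e)) - v (p (u - e))\<bar> \<le> s * (\<bar>t + e - (u - e)\<bar> * norm h)"
        using int pd by metis
      also have "\<dots> \<le> s * ((u - t) * norm h)"
        using e s by (intro mult_left_mono mult_right_mono) (auto simp: c_def)
      finally show "\<bar>v (p (t + e)) - v (p (u - e))\<bar> \<le> s * (u - t) * norm h" by (simp add: mult.assoc)
    qed (use c in auto)
    then show ?thesis using tu by (simp add: pd)
  qed
  \<comment> \<open>A segment that starts in \<Omega> can leave it only through the
    frontier.\<close>
  have stay: "p z \<in> \<Omega>" if "p q \<in> \<Omega>" "\<And>k. k \<in> closed_segment q z \<Longrightarrow> p k \<notin> frontier \<Omega>" for q z
  proof (rule ccontr)
    assume "p z \<notin> \<Omega>"
    then have "closed_segment (p q) (p z) \<inter> frontier \<Omega> \<noteq> {}"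
      using that(1) by (intro connected_Int_frontier) auto
    then show False using that(2) by (auto simp: pseg)
  qed
  have in\<Omega>: "z \<in> \<Omega>" if "z \<in> closure \<Omega>" "z \<notin> frontier \<Omega>" for z
    using that \<Omega> by (simp add: frontier_def interior_open)
  define T where "T = {t \<in> {0..1}. p t \<in> frontier \<Omega>}"
  have "compact T"
  proof -
    have T: "T = {0..1} \<inter> p -` frontier \<Omega>" by (auto simp: T_def)
    have "closed T"
      unfolding T by (rule continuous_closed_preimage[OF pc closed_real_atLeastAtMost frontier_closed])
    moreover have "bounded T" by (rule bounded_subset[of "{0..1}"]) (auto simp: T_def)
    ultimately show ?thesis by (simp add: compact_eq_bounded_closed)
  qed
  show "dist (v x) (v y) \<le> s * dist x y"
  proof (cases "T = {}")
    case True
    then have nf: "p k \<notin> frontier \<Omega>" if "0 \<le> k" "k \<le> 1" for k using that by (auto simp: T_def)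
    have p: "p 0 \<in> \<Omega>" using in\<Omega>[of x] x nf[of 0] p01 by simp
    have "p z \<in> \<Omega>" if "0 < z" "z < 1" for z
      by (rule stay[OF p]) (use that in \<open>auto simp: closed_segment_eq_real_ivl nf\<close>)
    then show ?thesis using inner[of 0 1] p01 by (simp add: dist_real_def)
  next
    case False
    obtain t0 where t0: "t0 \<in> T" "\<And>t. t \<in> T \<Longrightarrow> t0 \<le> t"
      using compact_attains_inf[OF \<open>compact T\<close> False] by blast
    obtain t1 where t1: "t1 \<in> T" "\<And>t. t \<in> T \<Longrightarrow> t \<le> t1"
      using compact_attains_sup[OF \<open>compact T\<close> False] by blast
    have t01: "0 \<le> t0" "t0 \<le> t1" "t1 \<le> 1" using t0 t1 by (auto simp: T_def)
    have "\<bar>v (p 0) - v (p t0)\<bar> \<le> s * dist (p 0) (p t0)"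
    proof (cases "t0 = 0")
      case False
      then have pos: "0 < t0" using t01 by simp
      have nf: "p k \<notin> frontier \<Omega>" if "0 \<le> k" "k < t0" for k
        using t0(2)[of k] that t01 by (auto simp: T_def)
      have p: "p 0 \<in> \<Omega>" using in\<Omega>[of x] x nf[of 0] p01 pos by simp
      have "p z \<in> \<Omega>" if "0 < z" "z < t0" for z
        by (rule stay[OF p]) (use that in \<open>auto simp: closed_segment_eq_real_ivl nf\<close>)
      then show ?thesis using inner[OF pos] by blast
    qed simp
    \<comment> \<open>Between these two contacts the segment may run outside the closure; no
      interior information is used there.\<close>
    moreover have "\<bar>v (p t0) - v (p t1)\<bar> \<le> s * dist (p t0) (p t1)"
      using bd t0(1) t1(1) by (auto simp: T_def)
    moreover have "\<bar>v (p t1) - v (p 1)\<bar> \<le> s * dist (p t1) (p 1)"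
    proof (cases "t1 = 1")
      case False
      then have pos: "t1 < 1" using t01 by simp
      have nf: "p k \<notin> frontier \<Omega>" if "t1 < k" "k \<le> 1" for k
        using t1(2)[of k] that t01 by (auto simp: T_def)
      have p: "p 1 \<in> \<Omega>" using in\<Omega>[of y] y nf[of 1] p01 pos by simp
      have "p z \<in> \<Omega>" if "t1 < z" "z < 1" for z
        by (rule stay[OF p]) (use that in \<open>auto simp: closed_segment_eq_real_ivl nf\<close>)
      then show ?thesis using inner[OF pos] by blast
    qed simp
    moreover have "dist (p 0) (p 1) = dist (p 0) (p t0) + dist (p t0) (p t1) + dist (p t1) (p 1)"
      using t01 by (simp add: pd distrib_right[symmetric])
    ultimately have "\<bar>v (p 0) - v (p 1)\<bar> \<le> s * dist (p 0) (p 1)"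
      by (simp add: distrib_left)
    then show ?thesis by (simp add: p01 dist_real_def)
  qed
qed

subsection \<open>Almost everywhere convergent selections from convex sets of functions\<close>

lemma (in finite_measure) integrable_bounded_power:
  fixes c :: "'a \<Rightarrow> 'b::euclidean_space"
  assumes "c \<in> borel_measurable M" "AE x in M. norm (c x) \<le> R"
  shows "integrable M (\<lambda>x. norm (c x) ^ k)"
proof (rule integrable_const_bound[where B="R ^ k"])
  show "AE x in M. norm (norm (c x) ^ k) \<le> R ^ k"
    using assms(2) by eventually_elim (auto intro!: power_mono)
qed (use assms(1) in auto)

text \<open>As for the completeness of L1: the sum of the norms of the increments is integrable,
  hence finite almost everywhere, and the sequence telescopes.\<close>

lemma (in finite_measure) AE_convergent_if_summable_L1:
  fixes c :: "nat \<Rightarrow> 'a \<Rightarrow> 'b::euclidean_space"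
  assumes int: "\<And>n. integrable M (c n)"
    and sum: "summable (\<lambda>n. LINT x|M. norm (c (Suc n) x - c n x))"
  shows "AE x in M. convergent (\<lambda>n. c n x)"
proof -
  let ?t = "\<lambda>n x. norm (c (Suc n) x - c n x)"
  have it: "integrable M (?t n)" for n using int by auto
  have "(\<integral>\<^sup>+x. (\<Sum>n. ennreal (?t n x)) \<partial>M) = (\<Sum>n. \<integral>\<^sup>+x. ennreal (?t n x) \<partial>M)"
    using it by (intro nn_integral_suminf) auto
  also have "\<dots> = (\<Sum>n. ennreal (LINT x|M. ?t n x))"
    using it by (subst nn_integral_eq_integral) auto
  also have "\<dots> = ennreal (\<Sum>n. LINT x|M. ?t n x)"
    by (rule suminf_ennreal2[OF _ sum]) auto
  finally have "(\<integral>\<^sup>+x. (\<Sum>n. ennreal (?t n x)) \<partial>M) \<noteq> \<infinity>" by simp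
  then have "AE x in M. (\<Sum>n. ennreal (?t n x)) \<noteq> \<infinity>"
    using it by (intro nn_integral_PInf_AE) auto
  then show ?thesis
  proof eventually_elim
    fix x assume "(\<Sum>n. ennreal (?t n x)) \<noteq> \<infinity>"
    then have "summable (\<lambda>n. ?t n x)" by (intro summable_suminf_not_top) auto
    then have "summable (\<lambda>n. c (Suc n) x - c n x)" by (rule summable_norm_cancel)
    then have "convergent (\<lambda>n. \<Sum>i<n. c (Suc i) x - c i x)" by (simp add: summable_iff_convergent)
    then have "convergent (\<lambda>n. c n x - c 0 x)" using sum_lessThan_telescope[of "\<lambda>n. c n x"] by simp
    then have "convergent (\<lambda>n. (c n x - c 0 x) + c 0 x)" by (intro convergent_add convergent_const)
    then show "convergent (\<lambda>n. c n x)" by simp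
  qed
qed

text \<open>
  Elements of almost minimal L2 norm in a decreasing sequence of midpoint convex sets form a
  Cauchy sequence, by the parallelogram identity. This replaces weak compactness.
\<close>
lemma (in finite_measure) convex_selection_AE_convergent:
  fixes C :: "nat \<Rightarrow> ('a \<Rightarrow> 'b::euclidean_space) set"
  assumes ne: "\<And>n. C n \<noteq> {}" and dec: "\<And>n. C (Suc n) \<subseteq> C n"
    and mid: "\<And>n c c'. c \<in> C n \<Longrightarrow> c' \<in> C n \<Longrightarrow> (\<lambda>x. (1/2) *\<^sub>R (c x + c' x)) \<in> C n"
    and meas: "\<And>n c. c \<in> C n \<Longrightarrow> c \<in> borel_measurable M"
    and bnd: "\<And>n c. c \<in> C n \<Longrightarrow> AE x in M. norm (c x) \<le> R"
  obtains c w where "\<And>n. c n \<in> C n" "w \<in> borel_measurable M" "AE x in M. (\<lambda>n. c n x) \<longlonglongrightarrow> w x"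
proof -
  define N where "N c = (LINT x|M. norm (c x) ^ 2)" for c :: "'a \<Rightarrow> 'b"
  \<comment> \<open>The sets shrink, so these infima increase; the bound \<open>R\<close> keeps them
    bounded, hence they converge.\<close>
  define d where "d n = (INF c\<in>C n. N c)" for n
  have decm: "C m \<subseteq> C n" if "n \<le> m" for n m
    using lift_Suc_antimono_le[of C, OF dec that] .
  have N0: "0 \<le> N c" for c unfolding N_def by simp
  have bb: "bdd_below (N ` A)" for A using N0 by (intro bdd_belowI[of _ 0]) auto
  have dmono: "d n \<le> d m" if "n \<le> m" for n m
    unfolding d_def by (rule cINF_superset_mono[OF ne bb decm[OF that]]) simp
  have NR: "N c \<le> R ^ 2 * measure M (space M)" if c: "c \<in> C n" for c n
  proof -
    have "N c \<le> (LINT x|M. R ^ 2)" unfolding N_def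
    proof (rule integral_mono_AE[OF integrable_bounded_power[OF meas[OF c] bnd[OF c]]])
      show "AE x in M. norm (c x) ^ 2 \<le> R ^ 2"
        using bnd[OF c] by eventually_elim (auto intro!: power_mono)
    qed simp
    then show ?thesis by (simp add: mult.commute)
  qed
  have dle: "d n \<le> N c" if "c \<in> C n" for c n
    unfolding d_def by (rule cINF_lower[OF bb that])
  have dR: "d n \<le> R ^ 2 * measure M (space M)" for n
    using ne[of n] dle NR by (meson ex_in_conv order_trans)
  have "incseq d" using dmono by (auto simp: incseq_def)
  then obtain D where D: "d \<longlonglongrightarrow> D" "\<And>n. d n \<le> D"
    using incseq_convergent[of d] dR by blast
  have "\<exists>c\<in>C n. N c < d n + inverse (Suc n)" for n
    using cINF_less_iff[OF ne bb, of n "d n + inverse (Suc n)"] by (simp add: d_def)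
  then obtain c where c: "\<And>n. c n \<in> C n" "\<And>n. N (c n) < d n + inverse (Suc n)" by metis
  \<comment> \<open>For m above n the parallelogram identity gives at most 2 (d n + 1/(n+1)) + 2 (d
    m + 1/(m+1)) - 4 d n, since the midpoint lies in \<open>C n\<close> and costs at least
    \<open>d n\<close>. Bounding \<open>d m\<close> by \<open>D\<close> removes m.\<close>
  define \<epsilon> where "\<epsilon> n = 2 * (D - d n) + 4 * inverse (real (Suc n))" for n
  have "\<epsilon> \<longlonglongrightarrow> 2 * (D - D) + 4 * 0"
    unfolding \<epsilon>_def by (intro tendsto_intros D LIMSEQ_inverse_real_of_nat)
  then have \<epsilon>: "\<epsilon> \<longlonglongrightarrow> 0" by simp
  have cauchy: "(LINT x|M. norm (c m x - c n x) ^ 2) \<le> \<epsilon> n" if nm: "n \<le> m" for n m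
  proof -
    have cm: "c m \<in> C n" using c(1)[of m] decm[OF nm] by blast
    let ?h = "\<lambda>x. (1/2) *\<^sub>R (c n x + c m x)"
    have h: "?h \<in> C n" by (rule mid[OF c(1) cm])
    have i: "integrable M (\<lambda>x. norm (c n x) ^ 2)" "integrable M (\<lambda>x. norm (c m x) ^ 2)"
      "integrable M (\<lambda>x. norm (?h x) ^ 2)"
      using integrable_bounded_power[OF meas bnd] c(1) h by blast+
    have "norm (q - p) ^ 2 = 2 * norm p ^ 2 + 2 * norm q ^ 2 - 4 * norm ((1/2) *\<^sub>R (p + q)) ^ 2" for p q :: 'b
      unfolding power2_norm_eq_inner
      by (simp add: inner_add_left inner_add_right inner_diff_left inner_diff_right inner_commute field_simps)
    then have "(LINT x|M. norm (c m x - c n x) ^ 2) =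
       (LINT x|M. 2 * norm (c n x) ^ 2 + 2 * norm (c m x) ^ 2 - 4 * norm (?h x) ^ 2)"
      by simp
    also have "\<dots> = 2 * N (c n) + 2 * N (c m) - 4 * N ?h"
      using i by (simp add: N_def)
    also have "\<dots> \<le> 2 * (d n + inverse (Suc n)) + 2 * (d m + inverse (Suc m)) - 4 * d n"
      using c(2)[of n] c(2)[of m] dle[OF h] by argo
    also have "\<dots> \<le> \<epsilon> n"
    proof -
      have "inverse (real (Suc m)) \<le> inverse (real (Suc n))" using nm by (intro le_imp_inverse_le) auto
      then show ?thesis using D(2)[of m] unfolding \<epsilon>_def by argo
    qed
    finally show ?thesis .
  qed
  obtain r :: "nat \<Rightarrow> nat" where r: "strict_mono r" "\<And>k. \<epsilon> (r k) \<le> (1/4) ^ k"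
  proof -
    have "\<exists>N. \<forall>n\<ge>N. \<epsilon> n \<le> (1/4) ^ k" for k
      using order_tendstoD(2)[OF \<epsilon>, of "(1/4) ^ k"] by (auto simp: eventually_sequentially intro: less_imp_le)
    then obtain K where K: "\<And>k n. n \<ge> K k \<Longrightarrow> \<epsilon> n \<le> (1/4) ^ k" by metis
    \<comment> \<open>Partial sums of positive terms increase strictly, and the last term alone puts
      \<open>r k\<close> beyond the threshold \<open>K k\<close>.\<close>
    define r where "r k = (\<Sum>i\<le>k. Suc (K i))" for k
    have "strict_mono r" by (auto simp: strict_mono_Suc_iff r_def)
    moreover have "K k \<le> r k" for k
      unfolding r_def by (rule order_trans[OF _ member_le_sum[of k]]) auto
    ultimately show ?thesis using that K by blast
  qed
  define c' where "c' k = c (r k)" for k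
  have c'C: "c' k \<in> C k" for k
    using c(1)[of "r k"] decm[OF seq_suble[OF r(1)], of k] by (auto simp: c'_def)
  have L1: "(LINT x|M. norm (c' (Suc k) x - c' k x)) \<le> (measure M (space M) + 1) / 2 * (1/2) ^ k" for k
  proof -
    have m: "(\<lambda>x. c' (Suc k) x - c' k x) \<in> borel_measurable M" using meas c'C by (intro borel_measurable_diff) auto
    have "AE x in M. norm (c' (Suc k) x - c' k x) \<le> 2 * R"
      using bnd[OF c'C[of "Suc k"]] bnd[OF c'C[of k]]
      by eventually_elim (use norm_triangle_ineq4 in \<open>smt (verit)\<close>)
    note i = integrable_bounded_power[OF m this, of 1] integrable_bounded_power[OF m this, of 2]
    have "(LINT x|M. norm (c' (Suc k) x - c' k x)) \<le>
       (LINT x|M. ((1/2) ^ k + 2 ^ k * norm (c' (Suc k) x - c' k x) ^ 2) / 2)"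
    proof (rule integral_mono)
      fix x
      let ?t = "norm (c' (Suc k) x - c' k x)" and ?q = "2 ^ k :: real"
      \<comment> \<open>Young's inequality with weight 2^k bounds the L1 distance by the squared L2
        distance. The latter is at most 4^(-k), so this weight makes both summands of order
        2^(-k).\<close>
      have "0 \<le> (?q * ?t - 1) ^ 2" by simp
      then have "2 * (?q * ?t) \<le> ?q ^ 2 * ?t ^ 2 + 1" by (simp add: power2_diff power_mult_distrib)
      then show "?t \<le> ((1/2) ^ k + ?q * ?t ^ 2) / 2"
        by (simp add: power_divide field_simps power2_eq_square)
    qed (use i in auto)
    also have "\<dots> = ((1/2) ^ k * measure M (space M) + 2 ^ k * (LINT x|M. norm (c' (Suc k) x - c' k x) ^ 2)) / 2"
      using i by (simp add: mult.commute)
    also have "\<dots> \<le> ((1/2) ^ k * measure M (space M) + 2 ^ k * (1/4) ^ k) / 2"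
      using order_trans[OF cauchy r(2), of k "r (Suc k)"] r(1)
      by (auto simp: c'_def strict_mono_less_eq intro!: divide_right_mono add_left_mono mult_left_mono)
    also have "(2::real) ^ k * (1/4) ^ k = (1/2) ^ k" by (simp add: power_mult_distrib[symmetric])
    finally show ?thesis by (simp add: field_simps)
  qed
  have ic': "integrable M (c' n)" for n
  proof -
    have "integrable M (\<lambda>x. norm (c' n x) ^ 1)"
      by (rule integrable_bounded_power[OF meas[OF c'C] bnd[OF c'C]])
    then show ?thesis using meas[OF c'C] by (simp add: integrable_norm_iff)
  qed
  have "summable (\<lambda>k. (measure M (space M) + 1) / 2 * (1/2 :: real) ^ k)"
    by (intro summable_mult summable_geometric) simp
  then have "summable (\<lambda>k. LINT x|M. norm (c' (Suc k) x - c' k x))"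
    by (rule summable_comparison_test') (use L1 in auto)
  from AE_convergent_if_summable_L1[OF ic' this]
  have "AE x in M. (\<lambda>n. c' n x) \<longlonglongrightarrow> lim (\<lambda>n. c' n x)"
    by eventually_elim (simp add: convergent_LIMSEQ_iff)
  moreover have "(\<lambda>x. lim (\<lambda>n. c' n x)) \<in> borel_measurable M"
    using meas[OF c'C] by (intro borel_measurable_lim_metric) auto
  ultimately show ?thesis using that[OF c'C] by blast
qed

subsection \<open>Weak gradients of Lipschitz functions\<close>

text \<open>McShane's extension, the infimum of the cones of slope \<open>K\<close> over the graph.
  It makes difference quotients meaningful near the boundary, and it shows that the admissible class
  is nonempty.\<close>

lemma lipschitz_extension_UNIV:
  fixes v :: "'a::metric_space \<Rightarrow> real"
  assumes v: "K-lipschitz_on S v"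
  obtains V where "K-lipschitz_on UNIV V" "\<And>x. x \<in> S \<Longrightarrow> V x = v x"
\<comment> \<open>An infimum over the empty set carries no information, hence the separate
  case.\<close>
proof (cases "S = {}")
  case True
  then show ?thesis using that[of "\<lambda>_. 0"] lipschitz_on_nonneg[OF v] by (auto simp: lipschitz_on_def)
next
  case False
  have K: "0 \<le> K" by (rule lipschitz_on_nonneg[OF v])
  define V where "V x = (INF y\<in>S. v y + K * dist x y)" for x
  have vd: "v z \<le> v y + K * dist z y" if "y \<in> S" "z \<in> S" for y z
    using lipschitz_onD[OF v that] by (auto simp: dist_real_def dist_commute abs_le_iff)
  have bb: "bdd_below ((\<lambda>y. v y + K * dist x y) ` S)" for x
  proof -
    obtain z where z: "z \<in> S" using False by blast
    have "v z - K * dist x z \<le> v y + K * dist x y" if y: "y \<in> S" for y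
    proof -
      have "K * dist z y \<le> K * (dist x z + dist x y)"
        using K by (intro mult_left_mono) (metis add.commute dist_commute dist_triangle)
      then show ?thesis using vd[OF y z] by (simp add: distrib_left)
    qed
    then show ?thesis by (intro bdd_belowI2)
  qed
  have le: "V x \<le> V x' + K * dist x x'" for x x'
  proof -
    have "V x - K * dist x x' \<le> V x'"
      unfolding V_def[of x']
    proof (rule cINF_greatest[OF False])
      fix y assume y: "y \<in> S"
      have "V x \<le> v y + K * dist x y" unfolding V_def by (rule cINF_lower[OF bb y])
      also have "K * dist x y \<le> K * (dist x x' + dist x' y)"
        using K by (intro mult_left_mono dist_triangle)
      finally show "V x - K * dist x x' \<le> v y + K * dist x' y" by (simp add: distrib_left)
    qed
    then show ?thesis by simp
  qed
  have "K-lipschitz_on UNIV V"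
  proof (rule lipschitz_onI[OF _ K])
    show "dist (V x) (V y) \<le> K * dist x y" for x y
      using le[of x y] le[of y x] by (simp add: dist_real_def abs_le_iff dist_commute)
  qed
  moreover have "V x = v x" if x: "x \<in> S" for x
  proof (rule antisym)
    show "V x \<le> v x" using cINF_lower[OF bb x, of x] by (simp add: V_def)
    show "v x \<le> V x" unfolding V_def by (rule cINF_greatest[OF False]) (rule vd[OF _ x])
  qed
  ultimately show ?thesis by (rule that)
qed

text \<open>Integration by parts for difference quotients: a change of variables moves the
  translation from \<open>V\<close> to the smooth \<phi>. The result is a difference quotient of a
  correlation, whose derivative is known.\<close>

lemma difference_quotient_tendsto:
  fixes V :: "'a::euclidean_space \<Rightarrow> real"
  assumes \<Omega>: "open \<Omega>" "bounded \<Omega>" and V: "continuous_on UNIV V" and \<phi>: "\<phi> \<in> test_functions \<Omega>"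
  shows "(\<lambda>m. LINT x|lebesgue_on \<Omega>. \<phi> x * ((V (x + inverse (real (Suc m)) *\<^sub>R e) - V x) * real (Suc m))) \<longlonglongrightarrow>
    - (LINT x|lebesgue_on \<Omega>. V x * (grad \<phi> x \<bullet> e))"
proof -
  note T = test_functions_C1c[OF \<phi>]
  have \<Omega>m: "\<Omega> \<in> sets lebesgue" using \<Omega> by auto
  have \<phi>0: "\<phi> x = 0" "grad \<phi> x = 0" if "x \<notin> \<Omega>" for x
    using that T(3) supp_eq_0[of x \<phi>] grad_eq_0[of x \<phi>] by auto
  obtain R where R: "\<forall>x\<in>\<Omega>. norm x \<le> R" using \<Omega>(2) by (auto simp: bounded_iff)
  \<comment> \<open>The radius allows for shifts up to the length of \<open>e\<close>, so all
    translates of \<phi> that occur live in one compact set, on which \<open>V\<close> is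
    integrable.\<close>
  define B where "B = cball (0::'a) (R + norm e)"
  have B: "B \<in> sets lebesgue" "compact B" by (auto simp: B_def)
  define F where "F p = (LINT y|lebesgue_on B. \<phi> (y - p) *\<^sub>R V y)" for p
  have VB: "integrable (lebesgue_on B) V" by (rule integrable_continuous_compact[OF V B(2)])
  have out: "\<phi> (y - p) = 0" "grad \<phi> (y - p) = 0" if "y \<notin> B" "norm p \<le> norm e" for y p
  proof -
    have "y - p \<notin> \<Omega>"
    proof
      assume "y - p \<in> \<Omega>"
      then have "norm (y - p) \<le> R" using R by blast
      then show False using that norm_triangle_sub[of y p] by (simp add: B_def)
    qed
    then show "\<phi> (y - p) = 0" "grad \<phi> (y - p) = 0" using \<phi>0 by auto
  qed
  have \<phi>V: "integrable (lebesgue_on \<Omega>) (\<lambda>x. \<phi> x * V (x + p))" for p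
  proof -
    have "integrable lebesgue (\<lambda>x. \<phi> x * V (x + p))"
      by (rule integrable_continuous_compact_supp[OF _ T(2)])
         (auto intro!: continuous_intros C_diff_continuous[OF T(1)] continuous_on_compose2[OF V] simp: supp_eq_0)
    then show ?thesis using integrable_lebesgue_on_iff[OF \<Omega>m, of "\<lambda>x. \<phi> x * V (x + p)"] \<phi>0 by simp
  qed
  have F: "F p = (LINT x|lebesgue_on \<Omega>. \<phi> x * V (x + p))" if p: "norm p \<le> norm e" for p
  proof -
    have "F p = (LINT y|lebesgue. \<phi> (y - p) * V y)"
      unfolding F_def using integral_lebesgue_on_eq[OF B(1), of "\<lambda>y. \<phi> (y - p) * V y"] out[OF _ p] by simp
    also have "\<dots> = (LINT y|lebesgue. \<phi> (y + p - p) * V (y + p))"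
      by (rule integral_lebesgue_translate[of "\<lambda>y. \<phi> (y - p) * V y" p, symmetric])
         (intro borel_measurable_continuous_onI continuous_on_mult V continuous_on_compose2[OF C_diff_continuous[OF T(1)]];
          auto intro!: continuous_intros)
    also have "\<dots> = (LINT x|lebesgue_on \<Omega>. \<phi> x * V (x + p))"
      using integral_lebesgue_on_eq[OF \<Omega>m, of "\<lambda>y. \<phi> y * V (y + p)"] \<phi>0 by simp
    finally show ?thesis .
  qed
  have "((\<lambda>t. F (t *\<^sub>R e)) has_derivative
      (\<lambda>k. - (LINT y|lebesgue_on B. (grad \<phi> (y - 0 *\<^sub>R e) \<bullet> (k *\<^sub>R e)) *\<^sub>R V y))) (at (0::real))"
    unfolding F_def
  proof (rule has_derivative_compose[OF _ correlation_has_derivative[OF B(1) VB T(1,2)]])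
    show "((\<lambda>t. t *\<^sub>R e) has_derivative (\<lambda>k. k *\<^sub>R e)) (at (0::real))" by (auto intro!: derivative_eq_intros)
  qed
  moreover have "(LINT y|lebesgue_on B. grad \<phi> y \<bullet> e * V y) = (LINT y|lebesgue_on \<Omega>. V y * (grad \<phi> y \<bullet> e))"
    using integral_lebesgue_on_eq[OF B(1), of "\<lambda>y. grad \<phi> y \<bullet> e * V y"] out(2)[of _ 0]
      integral_lebesgue_on_eq[OF \<Omega>m, of "\<lambda>y. V y * (grad \<phi> y \<bullet> e)"] \<phi>0(2)
    by (simp add: mult.commute)
  ultimately have "((\<lambda>t. F (t *\<^sub>R e)) has_derivative (\<lambda>k. - (k * (LINT y|lebesgue_on \<Omega>. V y * (grad \<phi> y \<bullet> e))))) (at 0)"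
    by (simp add: mult_ac)
  moreover have "(\<lambda>k. - (k * z)) = (*) (- z)" for z :: real by (simp add: fun_eq_iff)
  ultimately have "((\<lambda>t. F (t *\<^sub>R e)) has_real_derivative - (LINT y|lebesgue_on \<Omega>. V y * (grad \<phi> y \<bullet> e))) (at 0)"
    by (simp only: has_field_derivative_def)
  then have "((\<lambda>h. (F (h *\<^sub>R e) - F 0) / h) \<longlongrightarrow> - (LINT y|lebesgue_on \<Omega>. V y * (grad \<phi> y \<bullet> e))) (at 0)"
    by (simp add: has_field_derivative_iff)
  moreover have "filterlim (\<lambda>m. inverse (real (Suc m))) (at 0) sequentially"
    unfolding filterlim_at using LIMSEQ_inverse_real_of_nat by (auto simp del: of_nat_Suc)
  ultimately have "(\<lambda>m. (F (inverse (real (Suc m)) *\<^sub>R e) - F 0) / inverse (real (Suc m))) \<longlonglongrightarrow>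
       - (LINT y|lebesgue_on \<Omega>. V y * (grad \<phi> y \<bullet> e))"
    by (rule filterlim_compose)
  moreover have "(F (inverse (real (Suc m)) *\<^sub>R e) - F 0) / inverse (real (Suc m)) =
     (LINT x|lebesgue_on \<Omega>. \<phi> x * ((V (x + inverse (real (Suc m)) *\<^sub>R e) - V x) * real (Suc m)))" for m
  proof -
    have "norm (inverse (real (Suc m)) *\<^sub>R e) \<le> norm e"
      by (simp add: mult_left_le_one_le inverse_le_1_iff)
    then have "F (inverse (real (Suc m)) *\<^sub>R e) - F 0 =
       (LINT x|lebesgue_on \<Omega>. \<phi> x * V (x + inverse (real (Suc m)) *\<^sub>R e) - \<phi> x * V (x + 0))"
      using \<phi>V[of "inverse (real (Suc m)) *\<^sub>R e"] \<phi>V[of 0] by (simp add: F del: of_nat_Suc)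
    moreover have "\<dots> / inverse (real (Suc m)) = (LINT x|lebesgue_on \<Omega>.
        (\<phi> x * V (x + inverse (real (Suc m)) *\<^sub>R e) - \<phi> x * V (x + 0)) / inverse (real (Suc m)))"
      by (rule integral_divide_zero[symmetric])
    ultimately show ?thesis
      by (simp add: divide_inverse algebra_simps del: of_nat_Suc)
  qed
  ultimately show ?thesis by simp
qed

text \<open>Difference quotients of a Lipschitz function are bounded but need not converge
  pointwise. Passing to convex sets that contain their tails yields an almost everywhere convergent
  sequence with the same limit against test functions.\<close>

lemma weak_directional_derivative_exists:
  fixes V :: "'a::euclidean_space \<Rightarrow> real"
  assumes \<Omega>: "open \<Omega>" "bounded \<Omega>" and V: "K-lipschitz_on UNIV V"
  obtains c where "c \<in> borel_measurable (lebesgue_on \<Omega>)" "AE x in lebesgue_on \<Omega>. \<bar>c x\<bar> \<le> K * norm e"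
    "\<And>\<phi>. \<phi> \<in> test_functions \<Omega> \<Longrightarrow>
      (LINT x|lebesgue_on \<Omega>. \<phi> x * c x) = - (LINT x|lebesgue_on \<Omega>. V x * (grad \<phi> x \<bullet> e))"
proof -
  let ?M = "lebesgue_on \<Omega>"
  have "\<Omega> \<in> lmeasurable" using \<Omega> by (simp add: lmeasurable_open)
  then interpret finite_measure ?M by (rule finite_measure_lebesgue_on)
  have K: "0 \<le> K" by (rule lipschitz_on_nonneg[OF V])
  have Vc: "continuous_on UNIV V" by (rule lipschitz_on_continuous_on[OF V])
  define D where "D m x = (V (x + inverse (real (Suc m)) *\<^sub>R e) - V x) * real (Suc m)" for m x
  \<comment> \<open>The defect of \<open>c\<close> in the identity for a weak derivative in
    direction \<open>e\<close>.\<close>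
  define E where "E \<phi> c = \<bar>(LINT x|?M. \<phi> x * c x) + (LINT x|?M. V x * (grad \<phi> x \<bullet> e))\<bar>" for \<phi> c
  have D0: "(\<lambda>m. E \<phi> (D m)) \<longlonglongrightarrow> 0" if "\<phi> \<in> test_functions \<Omega>" for \<phi>
    using tendsto_add[OF difference_quotient_tendsto[OF \<Omega> Vc that, of e] tendsto_const, of "LINT x|?M. V x * (grad \<phi> x \<bullet> e)"]
    by (simp add: E_def D_def tendsto_rabs_zero_iff)
  \<comment> \<open>A substitute for the closed convex hull of \<open>D n\<close>,
    \<open>D (Suc n)\<close> and so on: an element must satisfy every bound on the defect that holds
    along the whole tail. Bounds of this kind survive midpoints, and the sets decrease in n.\<close>
  define C where "C n = {c \<in> borel_measurable ?M. (AE x in ?M. norm (c x) \<le> K * norm e) \<and>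
     (\<forall>\<phi>\<in>test_functions \<Omega>. \<forall>\<epsilon>. (\<forall>m\<ge>n. E \<phi> (D m) \<le> \<epsilon>) \<longrightarrow> E \<phi> c \<le> \<epsilon>)}" for n :: nat
  have Dm: "D m \<in> borel_measurable ?M" for m
    unfolding D_def
    by (intro continuous_borel_measurable_lebesgue_on)
       (auto intro!: continuous_intros continuous_on_compose2[OF Vc])
  have Db: "\<bar>D m x\<bar> \<le> K * norm e" for m x
  proof -
    have "\<bar>V (x + inverse (real (Suc m)) *\<^sub>R e) - V x\<bar> \<le> K * norm (inverse (real (Suc m)) *\<^sub>R e)"
      using lipschitz_onD[OF V, of "x + inverse (real (Suc m)) *\<^sub>R e" x] by (simp add: dist_norm)
    then have "\<bar>V (x + inverse (real (Suc m)) *\<^sub>R e) - V x\<bar> * real (Suc m) \<le>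
        K * norm (inverse (real (Suc m)) *\<^sub>R e) * real (Suc m)"
      by (rule mult_right_mono) simp
    also have "\<dots> = K * norm e" by simp
    finally show ?thesis by (simp add: D_def abs_mult del: of_nat_Suc)
  qed
  have DC: "D n \<in> C n" for n using Dm Db by (auto simp: C_def)
  have \<phi>c: "integrable ?M (\<lambda>x. \<phi> x * c x)" "AE x in ?M. norm (\<phi> x * c x) \<le> norm (\<phi> x) * (K * norm e)"
    "integrable ?M (\<lambda>x. norm (\<phi> x) * (K * norm e))" "\<phi> \<in> borel_measurable ?M"
    if \<phi>: "\<phi> \<in> test_functions \<Omega>" and c: "c \<in> borel_measurable ?M" "AE x in ?M. norm (c x) \<le> K * norm e" for \<phi> c
  proof -
    note T = test_functions_C1c[OF \<phi>]
    obtain B where B: "\<And>x. \<bar>\<phi> x\<bar> \<le> B" using C1c_bounds[OF T(1,2)] by metis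
    show m: "\<phi> \<in> borel_measurable ?M"
      by (rule continuous_borel_measurable_lebesgue_on[OF C_diff_continuous[OF T(1)]])
    show i: "integrable ?M (\<lambda>x. norm (\<phi> x) * (K * norm e))"
      using m B by (intro integrable_const_bound[where B="B * (K * norm e)"] AE_I2)
        (auto simp: abs_mult K intro!: mult_right_mono mult_nonneg_nonneg)
    show ae: "AE x in ?M. norm (\<phi> x * c x) \<le> norm (\<phi> x) * (K * norm e)"
      using c(2) by eventually_elim (auto simp: abs_mult intro!: mult_left_mono)
    show "integrable ?M (\<lambda>x. \<phi> x * c x)"
      by (rule Bochner_Integration.integrable_bound[OF i])
         (use m c ae in \<open>auto simp: abs_mult K\<close>)
  qed
  obtain c w where cw: "\<And>n. c n \<in> C n" "w \<in> borel_measurable ?M" "AE x in ?M. (\<lambda>n. c n x) \<longlonglongrightarrow> w x"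
  proof (rule convex_selection_AE_convergent[of C "K * norm e"])
    show "C n \<noteq> {}" for n using DC by blast
    show "C (Suc n) \<subseteq> C n" for n by (auto simp: C_def)
    fix n c assume c: "c \<in> C n"
    show "c \<in> borel_measurable ?M" "AE x in ?M. norm (c x) \<le> K * norm e"
      using c by (auto simp: C_def)
    fix c' assume c': "c' \<in> C n"
    have ae: "AE x in ?M. norm ((1/2) *\<^sub>R (c x + c' x)) \<le> K * norm e"
    proof -
      have "AE x in ?M. norm (c x) \<le> K * norm e" "AE x in ?M. norm (c' x) \<le> K * norm e"
        using c c' by (auto simp: C_def)
      then show ?thesis by eventually_elim (auto simp: abs_le_iff field_simps)
    qed
    have "E \<phi> (\<lambda>x. (1/2) *\<^sub>R (c x + c' x)) \<le> \<epsilon>" if \<phi>: "\<phi> \<in> test_functions \<Omega>" and e: "\<forall>m\<ge>n. E \<phi> (D m) \<le> \<epsilon>" for \<phi> \<epsilon>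
    proof -
      have i: "integrable ?M (\<lambda>x. \<phi> x * c x)" "integrable ?M (\<lambda>x. \<phi> x * c' x)"
        using \<phi>c(1)[OF \<phi>] c c' by (auto simp: C_def)
      have "(LINT x|?M. \<phi> x * ((1/2) *\<^sub>R (c x + c' x))) = (LINT x|?M. (1/2) * (\<phi> x * c x + \<phi> x * c' x))"
        by (intro Bochner_Integration.integral_cong refl) (simp add: algebra_simps)
      also have "\<dots> = (1/2) * ((LINT x|?M. \<phi> x * c x) + (LINT x|?M. \<phi> x * c' x))"
        by (simp only: integral_mult_right_zero Bochner_Integration.integral_add[OF i])
      finally have "E \<phi> (\<lambda>x. (1/2) *\<^sub>R (c x + c' x)) \<le> (E \<phi> c + E \<phi> c') / 2"
        unfolding E_def by (simp add: abs_le_iff field_simps) linarith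
      moreover have "E \<phi> c \<le> \<epsilon>" "E \<phi> c' \<le> \<epsilon>" using c c' \<phi> e by (auto simp: C_def)
      ultimately show ?thesis by argo
    qed
    then show "(\<lambda>x. (1/2) *\<^sub>R (c x + c' x)) \<in> C n"
      using c c' ae by (auto simp: C_def)
  qed blast
  have cb: "AE x in ?M. norm (c n x) \<le> K * norm e" "c n \<in> borel_measurable ?M" for n
    using cw(1)[of n] by (auto simp: C_def)
  have "AE x in ?M. \<forall>n. norm (c n x) \<le> K * norm e" using cb(1) by (simp add: AE_all_countable)
  with cw(3) have wb: "AE x in ?M. \<bar>w x\<bar> \<le> K * norm e"
  proof eventually_elim
    case (elim x)
    show ?case
      using LIMSEQ_le_const2[OF tendsto_rabs[OF elim(1)]] elim(2) by (metis real_norm_def)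
  qed
  show ?thesis
  proof (rule that[OF cw(2) wb])
    fix \<phi> assume \<phi>: "\<phi> \<in> test_functions \<Omega>"
    have "(\<lambda>n. LINT x|?M. \<phi> x * c n x) \<longlonglongrightarrow> (LINT x|?M. \<phi> x * w x)"
    proof (rule integral_dominated_convergence[where w="\<lambda>x. norm (\<phi> x) * (K * norm e)"])
      show "AE x in ?M. (\<lambda>n. \<phi> x * c n x) \<longlonglongrightarrow> \<phi> x * w x"
        using cw(3) by eventually_elim (intro tendsto_intros)
    qed (use \<phi>c[OF \<phi> cb(2,1)] cw(2) cb in auto)
    then have "(\<lambda>n. E \<phi> (c n)) \<longlonglongrightarrow> E \<phi> w" unfolding E_def by (intro tendsto_intros)
    moreover have "(\<lambda>n. E \<phi> (c n)) \<longlonglongrightarrow> 0"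
    proof (rule LIMSEQ_I)
      fix r :: real assume "r > 0"
      then obtain n where n: "\<forall>m\<ge>n. E \<phi> (D m) < r / 2"
        using LIMSEQ_D[OF D0[OF \<phi>], of "r / 2"] by (auto simp: E_def)
      \<comment> \<open>The bound on the tail of \<open>D\<close> passes to \<open>c k\<close> by
        the very condition that defines \<open>C k\<close>.\<close>
      have "E \<phi> (c k) \<le> r / 2" if "k \<ge> n" for k
      proof -
        have "\<forall>m\<ge>k. E \<phi> (D m) \<le> r / 2" using n that by (meson less_imp_le order_trans)
        then show ?thesis using cw(1)[of k, unfolded C_def] \<phi> by blast
      qed
      then show "\<exists>n. \<forall>k\<ge>n. norm (E \<phi> (c k) - 0) < r"
      proof (intro exI allI impI)
        fix k assume "n \<le> k"
        then have "E \<phi> (c k) \<le> r / 2" by fact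
        moreover have "norm (E \<phi> (c k) - 0) = E \<phi> (c k)" by (simp add: E_def)
        ultimately show "norm (E \<phi> (c k) - 0) < r" using \<open>r > 0\<close> by argo
      qed
    qed
    ultimately have "E \<phi> w = 0" by (rule LIMSEQ_unique)
    then show "(LINT x|?M. \<phi> x * w x) = - (LINT x|?M. V x * (grad \<phi> x \<bullet> e))"
      by (simp add: E_def)
  qed
qed

text \<open>The bound is a closed condition on \<open>e\<close>, so density extends it to every
  direction, and e = w gives the norm. A countable \<open>D\<close> will keep the exceptional sets
  of the separate directions within one null set.\<close>

lemma countable_dense_inner_bound:
  fixes w :: "'a::euclidean_space"
  assumes D: "\<And>X::'a set. open X \<Longrightarrow> X \<noteq> {} \<Longrightarrow> \<exists>d\<in>D. d \<in> X" and le: "\<And>e. e \<in> D \<Longrightarrow> \<bar>w \<bullet> e\<bar> \<le> K * norm e"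
    and K: "0 \<le> K"
  shows "norm w \<le> K"
proof -
  have "closed {e. \<bar>w \<bullet> e\<bar> \<le> K * norm e}"
    by (intro closed_Collect_le continuous_intros)
  then have "open (- {e. \<bar>w \<bullet> e\<bar> \<le> K * norm e})" by (rule open_Compl)
  then have "- {e. \<bar>w \<bullet> e\<bar> \<le> K * norm e} = {}"
  proof (rule contrapos_pp)
    assume "- {e. \<bar>w \<bullet> e\<bar> \<le> K * norm e} \<noteq> {}"
    then show "\<not> open (- {e. \<bar>w \<bullet> e\<bar> \<le> K * norm e})"
      using D[of "- {e. \<bar>w \<bullet> e\<bar> \<le> K * norm e}"] le by auto
  qed
  then have "w \<in> {e. \<bar>w \<bullet> e\<bar> \<le> K * norm e}" by (metis Compl_iff empty_iff)
  then have "\<bar>w \<bullet> w\<bar> \<le> K * norm w" by simp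
  then have "norm w * norm w \<le> K * norm w" by (simp add: norm_eq_sqrt_inner)
  then show ?thesis using K by (cases "w = 0") auto
qed

text \<open>Estimating the coordinates one by one would cost a factor depending on the dimension,
  whereas the sharp \<open>K\<close> is essential for the bound \<sigma>. So derivatives in all
  directions are used: linearity and uniqueness identify them with inner products of the assembled
  vector.\<close>

lemma is_weak_grad_lipschitz_UNIV:
  fixes V :: "'a::euclidean_space \<Rightarrow> real"
  assumes \<Omega>: "open \<Omega>" "bounded \<Omega>" and V: "K-lipschitz_on UNIV V"
  obtains w where "is_weak_grad \<Omega> V w" "AE x in lebesgue_on \<Omega>. norm (w x) \<le> K"
proof -
  let ?M = "lebesgue_on \<Omega>"
  have \<Omega>m: "\<Omega> \<in> sets lebesgue" using \<Omega> by auto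
  have "\<Omega> \<in> lmeasurable" using \<Omega> by (simp add: lmeasurable_open)
  then interpret finite_measure ?M by (rule finite_measure_lebesgue_on)
  have K: "0 \<le> K" by (rule lipschitz_on_nonneg[OF V])
  have Vc: "continuous_on UNIV V" by (rule lipschitz_on_continuous_on[OF V])
  have "\<forall>e. \<exists>c. c \<in> borel_measurable ?M \<and> (AE x in ?M. \<bar>c x\<bar> \<le> K * norm e) \<and>
    (\<forall>\<phi>\<in>test_functions \<Omega>. (LINT x|?M. \<phi> x * c x) = - (LINT x|?M. V x * (grad \<phi> x \<bullet> e)))"
  proof
    show "\<exists>c. c \<in> borel_measurable ?M \<and> (AE x in ?M. \<bar>c x\<bar> \<le> K * norm e) \<and>
      (\<forall>\<phi>\<in>test_functions \<Omega>. (LINT x|?M. \<phi> x * c x) = - (LINT x|?M. V x * (grad \<phi> x \<bullet> e)))" for e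
      by (rule weak_directional_derivative_exists[OF \<Omega> V, of e]) blast
  qed
  from choice[OF this]
  obtain c where c: "\<And>e. c e \<in> borel_measurable ?M" "\<And>e. AE x in ?M. \<bar>c e x\<bar> \<le> K * norm e"
    "\<And>e \<phi>. \<phi> \<in> test_functions \<Omega> \<Longrightarrow> (LINT x|?M. \<phi> x * c e x) = - (LINT x|?M. V x * (grad \<phi> x \<bullet> e))"
    by blast
  define w where "w x = (\<Sum>i\<in>Basis. c i x *\<^sub>R i)" for x :: 'a
  have wi: "w x \<bullet> i = c i x" if "i \<in> Basis" for x i using that by (simp add: w_def inner_sum_left_Basis)
  have ci: "integrable ?M (c e)" for e
    using c(1,2)[of e] by (intro integrable_const_bound[where B="K * norm e"]) auto
  have wint: "integrable ?M w" unfolding w_def using ci by auto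
  have K_int: "integrable (lebesgue_on S) f" if "compact S" "S \<subseteq> \<Omega>" "integrable ?M f" for S and f :: "'a \<Rightarrow> 'b::euclidean_space"
    by (rule integrable_lebesgue_on_subset[OF that(3) \<Omega>m fmeasurableD[OF lmeasurable_compact[OF that(1)]] that(2)])
  have \<phi>int: "integrable ?M (\<lambda>x. \<phi> x *\<^sub>R f x)" if \<phi>: "\<phi> \<in> test_functions \<Omega>" and f: "integrable ?M f"
    for \<phi> and f :: "'a \<Rightarrow> 'b::euclidean_space"
  proof -
    note T = test_functions_C1c[OF \<phi>]
    show ?thesis
      by (rule integrable_compact_supp_scaleR[OF \<Omega>m T(2,3) K_int[OF T(2,3) f] C_diff_continuous[OF T(1)]])
         (rule supp_eq_0)
  qed
  have Vg: "integrable ?M (\<lambda>x. V x *\<^sub>R grad \<phi> x)" if \<phi>: "\<phi> \<in> test_functions \<Omega>" for \<phi>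
  proof -
    note T = test_functions_C1c[OF \<phi>]
    have "integrable lebesgue (\<lambda>x. V x *\<^sub>R grad \<phi> x)"
      by (rule integrable_continuous_compact_supp[OF _ T(2)])
         (auto intro!: continuous_intros Vc grad_continuous[OF T(1)] simp: grad_eq_0)
    then show ?thesis
      using integrable_lebesgue_on_iff[OF \<Omega>m, of "\<lambda>x. V x *\<^sub>R grad \<phi> x"] T(3) grad_eq_0[of _ \<phi>] by auto
  qed
  have dir: "(LINT x|?M. \<phi> x * (w x \<bullet> e)) = - (LINT x|?M. V x * (grad \<phi> x \<bullet> e))"
    if \<phi>: "\<phi> \<in> test_functions \<Omega>" for \<phi> e
  proof -
    have "(LINT x|?M. \<phi> x *\<^sub>R w x) \<bullet> i = (- (LINT x|?M. V x *\<^sub>R grad \<phi> x)) \<bullet> i" if i: "i \<in> Basis" for i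
    proof -
      have "(LINT x|?M. \<phi> x *\<^sub>R w x) \<bullet> i = (LINT x|?M. \<phi> x * c i x)"
        using i by (simp add: integral_inner_left[OF \<phi>int[OF \<phi> wint], symmetric] wi)
      also have "\<dots> = - (LINT x|?M. V x * (grad \<phi> x \<bullet> i))" by (rule c(3)[OF \<phi>])
      also have "\<dots> = (- (LINT x|?M. V x *\<^sub>R grad \<phi> x)) \<bullet> i"
        by (simp add: integral_inner_left[OF Vg[OF \<phi>], symmetric])
      finally show ?thesis .
    qed
    then have eq: "(LINT x|?M. \<phi> x *\<^sub>R w x) = - (LINT x|?M. V x *\<^sub>R grad \<phi> x)"
      by (rule euclidean_eqI)
    have "(LINT x|?M. \<phi> x * (w x \<bullet> e)) = (LINT x|?M. \<phi> x *\<^sub>R w x) \<bullet> e"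
      by (simp add: integral_inner_left[OF \<phi>int[OF \<phi> wint], symmetric])
    also have "\<dots> = - (LINT x|?M. V x * (grad \<phi> x \<bullet> e))"
      by (simp add: eq integral_inner_left[OF Vg[OF \<phi>], symmetric])
    finally show ?thesis .
  qed
  have wg: "is_weak_grad \<Omega> V w"
    unfolding is_weak_grad_def
  proof (intro conjI allI impI ballI)
    show "w \<in> borel_measurable ?M" using wint by auto
    show "integrable (lebesgue_on S) w" if "compact S \<and> S \<subseteq> \<Omega>" for S using that K_int wint by blast
    fix \<phi> assume \<phi>: "\<phi> \<in> test_functions \<Omega>"
    show "(LINT x|?M. V x *\<^sub>R grad \<phi> x) = - (LINT x|?M. \<phi> x *\<^sub>R w x)"
    proof (rule euclidean_eqI)
      fix i :: 'a assume "i \<in> Basis"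
      show "(LINT x|?M. V x *\<^sub>R grad \<phi> x) \<bullet> i = (- (LINT x|?M. \<phi> x *\<^sub>R w x)) \<bullet> i"
        using dir[OF \<phi>, of i]
        by (simp add: integral_inner_left[OF Vg[OF \<phi>], symmetric] integral_inner_left[OF \<phi>int[OF \<phi> wint], symmetric])
    qed
  qed
  \<comment> \<open>Both \<open>w x \<bullet> e\<close> and \<open>c e x\<close> represent the weak
    derivative in direction \<open>e\<close>, so the bound on the latter carries over.\<close>
  have ae: "AE x in ?M. \<bar>w x \<bullet> e\<bar> \<le> K * norm e" for e
  proof -
    have "AE x in ?M. w x \<bullet> e - c e x = 0"
    proof (rule fundamental_lemma_calculus_of_variations[OF \<Omega>(1)])
      have i: "integrable ?M (\<lambda>x. w x \<bullet> e)" using wint by auto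
      show "integrable (lebesgue_on S) (\<lambda>x. w x \<bullet> e - c e x)" if "compact S" "S \<subseteq> \<Omega>" for S
        by (rule K_int[OF that]) (use i ci in auto)
      fix \<phi> assume \<phi>: "\<phi> \<in> test_functions \<Omega>"
      show "(LINT x|?M. \<phi> x *\<^sub>R (w x \<bullet> e - c e x)) = 0"
        using \<phi>int[OF \<phi> i] \<phi>int[OF \<phi> ci[of e]] dir[OF \<phi>, of e] c(3)[OF \<phi>, of e]
        by (simp add: right_diff_distrib)
    qed
    with c(2)[of e] show ?thesis by eventually_elim simp
  qed
  obtain D :: "'a set" where D: "countable D" "\<And>X. open X \<Longrightarrow> X \<noteq> {} \<Longrightarrow> \<exists>d\<in>D. d \<in> X"
    using countable_dense_exists by blast
  have "AE x in ?M. \<forall>e\<in>D. \<bar>w x \<bullet> e\<bar> \<le> K * norm e"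
    using ae by (simp add: AE_ball_countable[OF D(1)])
  then have "AE x in ?M. norm (w x) \<le> K"
    by eventually_elim (rule countable_dense_inner_bound[OF D(2) _ K], auto)
  with wg show ?thesis by (rule that)
qed

lemma is_weak_grad_cong:
  assumes "is_weak_grad \<Omega> v w" "\<And>x. x \<in> \<Omega> \<Longrightarrow> v x = v' x"
  shows "is_weak_grad \<Omega> v' w"
proof -
  have "(LINT x|lebesgue_on \<Omega>. v x *\<^sub>R grad \<phi> x) = (LINT x|lebesgue_on \<Omega>. v' x *\<^sub>R grad \<phi> x)" for \<phi>
    using assms(2) by (intro Bochner_Integration.integral_cong) auto
  then show ?thesis using assms(1) by (simp add: is_weak_grad_def)
qed

text \<open>Difference quotients step outside the closure. The extension supplies values there
  without raising \<open>K\<close>, and agreement on \<Omega> makes its weak gradient one of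
  \<open>v\<close>.\<close>

lemma weak_grad_lipschitz:
  assumes \<Omega>: "open \<Omega>" "bounded \<Omega>" and v: "K-lipschitz_on (closure \<Omega>) v"
  shows "is_weak_grad \<Omega> v (weak_grad \<Omega> v)" "AE x in lebesgue_on \<Omega>. norm (weak_grad \<Omega> v x) \<le> K"
proof -
  obtain V where V: "K-lipschitz_on UNIV V" "\<And>x. x \<in> closure \<Omega> \<Longrightarrow> V x = v x"
    using lipschitz_extension_UNIV[OF v] by blast
  obtain w where w: "is_weak_grad \<Omega> V w" "AE x in lebesgue_on \<Omega>. norm (w x) \<le> K"
    using is_weak_grad_lipschitz_UNIV[OF \<Omega> V(1)] by blast
  have vw: "is_weak_grad \<Omega> v w"
    by (rule is_weak_grad_cong[OF w(1)]) (use V(2) closure_subset in blast)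
  then show "is_weak_grad \<Omega> v (weak_grad \<Omega> v)" by (rule weak_grad_works)
  show "AE x in lebesgue_on \<Omega>. norm (weak_grad \<Omega> v x) \<le> K"
    using weak_grad_eq[OF \<Omega>(1) vw] w(2) by eventually_elim simp
qed

text \<open>Frees later arguments from the chosen representative: any weak gradient at hand decides
  the bound.\<close>

lemma grad_Linf_le_iff:
  assumes \<Omega>: "open \<Omega>" and w: "is_weak_grad \<Omega> v w"
  shows "grad_Linf \<Omega> v \<le> ereal s \<longleftrightarrow> (AE x in lebesgue_on \<Omega>. norm (w x) \<le> s)"
proof
  let ?f = "\<lambda>x. ereal (norm (weak_grad \<Omega> v x))"
  have eq: "AE x in lebesgue_on \<Omega>. weak_grad \<Omega> v x = w x" by (rule weak_grad_eq[OF assms])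
  have m: "?f \<in> borel_measurable (lebesgue_on \<Omega>)"
    using weak_grad_works[OF w] by (auto simp: is_weak_grad_def)
  {
    assume le: "grad_Linf \<Omega> v \<le> ereal s"
    have "AE x in lebesgue_on \<Omega>. ?f x \<le> grad_Linf \<Omega> v"
      unfolding grad_Linf_def by (rule esssup_AE)
    with eq show "AE x in lebesgue_on \<Omega>. norm (w x) \<le> s"
    proof eventually_elim
      case (elim x)
      then show ?case using order_trans[OF elim(2) le] by simp
    qed
  }
  assume "AE x in lebesgue_on \<Omega>. norm (w x) \<le> s"
  with eq have "AE x in lebesgue_on \<Omega>. ?f x \<le> ereal s" by eventually_elim simp
  then show "grad_Linf \<Omega> v \<le> ereal s" unfolding grad_Linf_def by (rule esssup_I[OF m])
qed

section \<open>Lipschitz functions on the closure and the admissible class\<close>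

lemma lipschitz_closure_bounded:
  fixes v :: "'a::euclidean_space \<Rightarrow> real"
  assumes "bounded \<Omega>" "K-lipschitz_on (closure \<Omega>) v"
  obtains B where "\<And>x. x \<in> closure \<Omega> \<Longrightarrow> \<bar>v x\<bar> \<le> B"
proof -
  have "compact (closure \<Omega>)" using assms(1) by simp
  then have "bounded (v ` closure \<Omega>)"
    by (intro compact_imp_bounded compact_continuous_image lipschitz_on_continuous_on[OF assms(2)])
  then show ?thesis using that by (auto simp: bounded_iff)
qed

lemma lipschitz_closure_measurable:
  fixes v :: "'a::euclidean_space \<Rightarrow> real"
  assumes "K-lipschitz_on (closure \<Omega>) v"
  shows "v \<in> borel_measurable (lebesgue_on \<Omega>)"
proof -
  obtain V where V: "K-lipschitz_on UNIV V" "\<And>x. x \<in> closure \<Omega> \<Longrightarrow> V x = v x"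
    using lipschitz_extension_UNIV[OF assms] by blast
  have "V \<in> borel_measurable (lebesgue_on \<Omega>)"
    by (intro continuous_borel_measurable_lebesgue_on lipschitz_on_continuous_on[OF V(1)])
  moreover have "V x = v x" if "x \<in> space (lebesgue_on \<Omega>)" for x
    using V(2) that closure_subset[of \<Omega>] by auto
  ultimately show ?thesis using measurable_cong[of "lebesgue_on \<Omega>" V v borel] by blast
qed

lemma lipschitz_closure_integrable:
  fixes v :: "'a::euclidean_space \<Rightarrow> real"
  assumes \<Omega>: "open \<Omega>" "bounded \<Omega>" and v: "K-lipschitz_on (closure \<Omega>) v"
  shows "integrable (lebesgue_on \<Omega>) v"
proof -
  have "\<Omega> \<in> lmeasurable" using \<Omega> by (simp add: lmeasurable_open)
  then interpret finite_measure "lebesgue_on \<Omega>" by (rule finite_measure_lebesgue_on)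
  obtain B where "\<And>x. x \<in> closure \<Omega> \<Longrightarrow> \<bar>v x\<bar> \<le> B"
    using lipschitz_closure_bounded[OF \<Omega>(2) v] by blast
  then show ?thesis
    using closure_subset[of \<Omega>]
    by (intro integrable_const_bound[where B=B] AE_I2 lipschitz_closure_measurable[OF v]) auto
qed

text \<open>Replaces the unspecified Lipschitz constant of each member by the common
  \<open>s\<close>. With s = \<sigma> this gives equicontinuity; with s = 0 it shows that a function
  with vanishing gradient and zero boundary values is constant.\<close>

lemma S_class_iff:
  fixes g :: "'a::euclidean_space \<Rightarrow> real"
  assumes \<Omega>: "open \<Omega>" "bounded \<Omega>" and g: "s-lipschitz_on (frontier \<Omega>) g"
  shows "v \<in> S_class s \<Omega> g \<longleftrightarrow> s-lipschitz_on (closure \<Omega>) v \<and> (\<forall>x\<in>frontier \<Omega>. v x = g x)"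
proof
  assume v: "v \<in> S_class s \<Omega> g"
  then obtain K where K: "K-lipschitz_on (closure \<Omega>) v" and vg: "\<forall>x\<in>frontier \<Omega>. v x = g x"
    and Linf: "grad_Linf \<Omega> v \<le> ereal s"
    by (auto simp: S_class_def lipschitz_fun_on_def)
  have vc: "continuous_on (closure \<Omega>) v" by (rule lipschitz_on_continuous_on[OF K])
  note w = weak_grad_lipschitz[OF \<Omega> K]
  have ws: "AE x in lebesgue_on \<Omega>. norm (weak_grad \<Omega> v x) \<le> s"
    using Linf grad_Linf_le_iff[OF \<Omega>(1) w(1)] by blast
  have vi: "integrable (lebesgue_on \<Omega>) v" by (rule lipschitz_closure_integrable[OF \<Omega> K])
  have s: "0 \<le> s" by (rule lipschitz_on_nonneg[OF g])
  have "s-lipschitz_on (closure \<Omega>) v"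
  proof (rule lipschitz_on_closure_from_frontier[OF \<Omega>(1) vc s])
    show "\<bar>v x - v y\<bar> \<le> s * dist x y" if "closed_segment x y \<subseteq> \<Omega>" for x y
      by (rule weak_grad_bound_segment[OF \<Omega>(1) w(1) ws continuous_on_subset[OF vc closure_subset] vi that])
    show "\<bar>v x - v y\<bar> \<le> s * dist x y" if "x \<in> frontier \<Omega>" "y \<in> frontier \<Omega>" for x y
      using lipschitz_onD[OF g that] vg that by (simp add: dist_real_def)
  qed
  then show "s-lipschitz_on (closure \<Omega>) v \<and> (\<forall>x\<in>frontier \<Omega>. v x = g x)" using vg by blast
next
  assume v: "s-lipschitz_on (closure \<Omega>) v \<and> (\<forall>x\<in>frontier \<Omega>. v x = g x)"
  then have "grad_Linf \<Omega> v \<le> ereal s"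
    using weak_grad_lipschitz[OF \<Omega>] grad_Linf_le_iff[OF \<Omega>(1)] by blast
  then show "v \<in> S_class s \<Omega> g" using v by (auto simp: S_class_def lipschitz_fun_on_def)
qed

subsection \<open>The energy density\<close>

locale power_series_density =
  fixes a :: "nat \<Rightarrow> real" and \<sigma> :: real
  assumes a_nonneg: "\<And>p. p \<ge> 2 \<Longrightarrow> a p \<ge> 0" and a2_pos: "a 2 > 0" and \<sigma>_pos: "0 < \<sigma>"
    and Lambda_finite: "Lambda a \<sigma> < \<infinity>"
begin

definition L :: real where "L = (\<Sum>k. a (k + 2) * \<sigma> ^ (k + 1))"

text \<open>Both shapes, because simplification rewrites \<open>k + 2\<close> to
  \<open>Suc (Suc k)\<close>.\<close>

lemma a_nonneg' [simp]: "0 \<le> a (k + 2)" "0 \<le> a (Suc (Suc k))"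
  by (simp_all add: a_nonneg)

lemma summable_L: "summable (\<lambda>k. a (k + 2) * \<sigma> ^ (k + 1))"
proof -
  have "summable (\<lambda>k. real_of_ereal (ereal (a (k + 2) * \<sigma> ^ (k + 1))))"
    using Lambda_finite \<sigma>_pos by (intro summable_real_of_ereal) (auto simp: Lambda_def)
  then show ?thesis by (simp only: real_of_ereal.simps)
qed

lemma Lambda_eq: "Lambda a \<sigma> = ereal L"
  unfolding Lambda_def L_def by (rule suminf_ereal'[OF summable_L])

lemma L_pos: "0 < L"
  unfolding L_def
proof (rule suminf_pos2[OF summable_L])
  show "0 \<le> a (n + 2) * \<sigma> ^ (n + 1)" for n using \<sigma>_pos by simp
  show "0 < a (0 + 2) * \<sigma> ^ (0 + 1)" using a2_pos \<sigma>_pos by (simp add: numeral_2_eq_2)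
qed

lemma summable_Phi:
  assumes t: "0 \<le> t" "t \<le> \<sigma>"
  shows "summable (\<lambda>k. a (k + 2) / real (k + 2) * t ^ (k + 2))"
\<comment> \<open>Dropping the division by k + 2 and raising t to \<sigma> leaves \<sigma> times the
  series of \<open>L\<close>.\<close>
proof (rule summable_comparison_test'[where g="\<lambda>k. \<sigma> * (a (k + 2) * \<sigma> ^ (k + 1))"])
  show "summable (\<lambda>k. \<sigma> * (a (k + 2) * \<sigma> ^ (k + 1)))" by (rule summable_mult[OF summable_L])
  fix k :: nat
  have "a (k + 2) / real (k + 2) * t ^ (k + 2) \<le> a (k + 2) * \<sigma> ^ (k + 2)"
  proof (rule mult_mono)
    show "a (k + 2) / real (k + 2) \<le> a (k + 2)"
      using a_nonneg'(2)[of k] by (simp add: divide_le_eq mult_le_cancel_left1 not_less)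
    show "t ^ (k + 2) \<le> \<sigma> ^ (k + 2)" by (rule power_mono[OF t(2,1)])
  qed (use t in auto)
  then show "norm (a (k + 2) / real (k + 2) * t ^ (k + 2)) \<le> \<sigma> * (a (k + 2) * \<sigma> ^ (k + 1))"
    using t by (simp add: mult_ac)
qed

lemma Phi_nonneg: "0 \<le> t \<Longrightarrow> t \<le> \<sigma> \<Longrightarrow> 0 \<le> Phi a t"
  unfolding Phi_def by (rule suminf_nonneg[OF summable_Phi]) auto

lemma Phi_mono:
  assumes "0 \<le> s" "s \<le> t" "t \<le> \<sigma>"
  shows "Phi a s \<le> Phi a t"
  unfolding Phi_def using assms
  by (intro suminf_le summable_Phi mult_left_mono power_mono) auto

text \<open>The mean value bound for a power; its factor \<open>Suc n\<close> is what cancels the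
  denominators of \<open>Phi\<close> and leaves the series of \<open>L\<close>.\<close>

lemma power_diff_le:
  fixes s t :: real
  assumes "0 \<le> s" "s \<le> t" "t \<le> r"
  shows "t ^ Suc n - s ^ Suc n \<le> real (Suc n) * r ^ n * (t - s)"
proof -
  have "t ^ Suc n - s ^ Suc n = (t - s) * (\<Sum>i<Suc n. s ^ (Suc n - Suc i) * t ^ i)"
    by (rule power_diff_sumr2)
  also have "\<dots> \<le> (t - s) * (\<Sum>i<Suc n. r ^ n)"
  proof (intro mult_left_mono sum_mono)
    fix i assume "i \<in> {..<Suc n}"
    then have i: "Suc n - Suc i + i = n" by simp
    have "s ^ (Suc n - Suc i) * t ^ i \<le> r ^ (Suc n - Suc i) * r ^ i"
      using assms by (intro mult_mono power_mono) auto
    also have "\<dots> = r ^ n" by (simp only: power_add[symmetric] i)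
    finally show "s ^ (Suc n - Suc i) * t ^ i \<le> r ^ n" .
  qed (use assms in simp)
  also have "\<dots> = real (Suc n) * r ^ n * (t - s)" by (simp add: mult_ac)
  finally show ?thesis .
qed

lemma Phi_diff_le:
  assumes st: "0 \<le> s" "s \<le> t" "t \<le> \<sigma>"
  shows "Phi a t - Phi a s \<le> L * (t - s)"
proof -
  have s: "s \<le> \<sigma>" and t: "0 \<le> t" using st by auto
  have "Phi a t - Phi a s = (\<Sum>k. a (k + 2) / real (k + 2) * t ^ (k + 2) - a (k + 2) / real (k + 2) * s ^ (k + 2))"
    unfolding Phi_def by (rule suminf_diff[OF summable_Phi[OF t st(3)] summable_Phi[OF st(1) s]])
  also have "\<dots> \<le> (\<Sum>k. a (k + 2) * \<sigma> ^ (k + 1) * (t - s))"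
  proof (rule suminf_le)
    fix k :: nat
    have "t ^ (k + 2) - s ^ (k + 2) \<le> real (k + 2) * \<sigma> ^ (k + 1) * (t - s)"
      using power_diff_le[OF st, of "k + 1"] by simp
    then have "a (k + 2) / real (k + 2) * (t ^ (k + 2) - s ^ (k + 2)) \<le>
       a (k + 2) / real (k + 2) * (real (k + 2) * \<sigma> ^ (k + 1) * (t - s))"
      by (intro mult_left_mono) auto
    also have "\<dots> = a (k + 2) * \<sigma> ^ (k + 1) * (t - s)"
      by (simp del: of_nat_add of_nat_Suc)
    finally show "a (k + 2) / real (k + 2) * t ^ (k + 2) - a (k + 2) / real (k + 2) * s ^ (k + 2)
      \<le> a (k + 2) * \<sigma> ^ (k + 1) * (t - s)" by (simp only: right_diff_distrib)
  qed (intro summable_diff summable_Phi st s t summable_mult2 summable_L)+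
  also have "\<dots> = L * (t - s)" unfolding L_def by (rule suminf_mult2[OF summable_L, symmetric])
  finally show ?thesis .
qed

text \<open>Perturbing a gradient may lengthen or shorten it; this form covers both cases with one
  bound on the increase.\<close>

lemma Phi_add_le:
  assumes "0 \<le> s" "s \<le> \<sigma>" "0 \<le> t" "t \<le> \<sigma>" "t \<le> s + d" "0 \<le> d"
  shows "Phi a t \<le> Phi a s + L * d"
proof (cases "s \<le> t")
  case True
  have "L * (t - s) \<le> L * d" using L_pos assms by (intro mult_left_mono) auto
  then show ?thesis using Phi_diff_le[OF assms(1) True assms(4)] by simp
next
  case False
  have "0 \<le> L * d" using L_pos assms by simp
  then show ?thesis using Phi_mono[of t s] False assms by simp
qed

text \<open>Induction by Chebyshev's inequality: \<open>s - t\<close> and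
  \<open>s ^ n - t ^ n\<close> have the same sign, so the product of the means is at most the mean
  of the products.\<close>

lemma power_midpoint_le:
  fixes s t :: real
  assumes "0 \<le> s" "0 \<le> t"
  shows "((s + t) / 2) ^ n \<le> (s ^ n + t ^ n) / 2"
proof (induction n)
  case (Suc n)
  have "0 \<le> (s - t) * (s ^ n - t ^ n)"
  proof (cases "s \<le> t")
    case True
    then show ?thesis using power_mono[OF True assms(1), of n] by (intro mult_nonpos_nonpos) auto
  next
    case False
    then show ?thesis using power_mono[of t s n] assms by (intro mult_nonneg_nonneg) auto
  qed
  then have *: "(s + t) / 2 * ((s ^ n + t ^ n) / 2) \<le> (s ^ Suc n + t ^ Suc n) / 2"
    by (simp add: field_simps)
  have "((s + t) / 2) ^ Suc n \<le> (s + t) / 2 * ((s ^ n + t ^ n) / 2)"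
    using mult_left_mono[OF Suc, of "(s + t) / 2"] assms by simp
  with * show ?case by (rule order_trans[rotated])
qed simp

text \<open>The quadratic term, present since \<open>a 2 > 0\<close>, yields the uniform convexity.\<close>
lemma Phi_midpoint:
  fixes \<xi> \<eta> :: "'a::euclidean_space"
  assumes \<xi>: "norm \<xi> \<le> \<sigma>" and \<eta>: "norm \<eta> \<le> \<sigma>"
  shows "Phi a (norm ((1/2) *\<^sub>R (\<xi> + \<eta>))) + a 2 / 8 * norm (\<xi> - \<eta>) ^ 2 \<le> (Phi a (norm \<xi>) + Phi a (norm \<eta>)) / 2"
proof -
  let ?m = "norm ((1/2) *\<^sub>R (\<xi> + \<eta>))"
  let ?T = "\<lambda>t k. a (k + 2) / real (k + 2) * t ^ (k + 2)"
  let ?c = "a 2 / 8 * norm (\<xi> - \<eta>) ^ 2"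
  have m_le: "?m \<le> (norm \<xi> + norm \<eta>) / 2" using norm_triangle_ineq[of \<xi> \<eta>] by simp
  also have "\<dots> \<le> \<sigma>" using \<xi> \<eta> by simp
  finally have m: "?m \<le> \<sigma>" .
  \<comment> \<open>The whole convexity gain is charged to the quadratic term k = 0, where the
    parallelogram identity gives equality with a2/8 = (a2/2) / 4. The other terms contribute plain
    convexity.\<close>
  have "(\<lambda>k. if k = 0 then ?c else 0) sums ?c" by (rule sums_single)
  then have lhs: "(\<lambda>k. ?T ?m k + (if k = 0 then ?c else 0)) sums (Phi a ?m + ?c)"
    unfolding Phi_def by (intro sums_add summable_sums summable_Phi m norm_ge_zero)
  have rhs: "(\<lambda>k. (?T (norm \<xi>) k + ?T (norm \<eta>) k) / 2) sums ((Phi a (norm \<xi>) + Phi a (norm \<eta>)) / 2)"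
    unfolding Phi_def by (intro sums_divide sums_add summable_sums summable_Phi \<xi> \<eta> norm_ge_zero)
  have "?T ?m k + (if k = 0 then ?c else 0) \<le> (?T (norm \<xi>) k + ?T (norm \<eta>) k) / 2" for k
  proof (cases k)
    case 0
    have "?m ^ 2 = (norm \<xi> ^ 2 + norm \<eta> ^ 2) / 2 - norm (\<xi> - \<eta>) ^ 2 / 4"
      unfolding power2_norm_eq_inner
      by (simp add: inner_add_left inner_add_right inner_diff_left inner_diff_right inner_commute field_simps)
    moreover have "a 2 / 2 * X + a 2 / 8 * D = (a 2 / 2 * P + a 2 / 2 * Q) / 2"
      if "X = (P + Q) / 2 - D / 4" for X P Q D :: real
      by (simp add: that field_simps)
    ultimately have "a 2 / 2 * ?m ^ 2 + ?c = (a 2 / 2 * norm \<xi> ^ 2 + a 2 / 2 * norm \<eta> ^ 2) / 2"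
      by blast
    then show ?thesis using 0 by (simp add: numeral_2_eq_2)
  next
    case (Suc j)
    have "?m ^ (k + 2) \<le> ((norm \<xi> + norm \<eta>) / 2) ^ (k + 2)"
      by (rule power_mono[OF m_le]) simp
    also have "\<dots> \<le> (norm \<xi> ^ (k + 2) + norm \<eta> ^ (k + 2)) / 2"
      by (rule power_midpoint_le) auto
    finally have "?T ?m k \<le> a (k + 2) / real (k + 2) * ((norm \<xi> ^ (k + 2) + norm \<eta> ^ (k + 2)) / 2)"
      by (intro mult_left_mono) auto
    also have "\<dots> = (?T (norm \<xi>) k + ?T (norm \<eta>) k) / 2" by (simp only: distrib_left add_divide_distrib times_divide_eq_right)
    finally show ?thesis using Suc by simp
  qed
  then show ?thesis by (rule sums_le[OF _ lhs rhs])
qed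

end

subsection \<open>Linear combinations of weak gradients\<close>

lemma is_weak_grad_linear_combination:
  fixes v v' :: "'a::euclidean_space \<Rightarrow> real"
  assumes \<Omega>: "open \<Omega>" and v: "integrable (lebesgue_on \<Omega>) v" "integrable (lebesgue_on \<Omega>) v'"
    and w: "is_weak_grad \<Omega> v w" "is_weak_grad \<Omega> v' w'"
  shows "is_weak_grad \<Omega> (\<lambda>x. \<alpha> * v x + \<beta> * v' x) (\<lambda>x. \<alpha> *\<^sub>R w x + \<beta> *\<^sub>R w' x)"
  unfolding is_weak_grad_def
proof (intro conjI allI impI ballI)
  let ?M = "lebesgue_on \<Omega>"
  have \<Omega>m: "\<Omega> \<in> sets lebesgue" using \<Omega> by auto
  show "(\<lambda>x. \<alpha> *\<^sub>R w x + \<beta> *\<^sub>R w' x) \<in> borel_measurable ?M"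
    using w by (auto simp: is_weak_grad_def)
  show "integrable (lebesgue_on K) (\<lambda>x. \<alpha> *\<^sub>R w x + \<beta> *\<^sub>R w' x)" if "compact K \<and> K \<subseteq> \<Omega>" for K
    using w that by (auto simp: is_weak_grad_def)
  fix \<phi> assume \<phi>: "\<phi> \<in> test_functions \<Omega>"
  note T = test_functions_C1c[OF \<phi>]
  note gi = integrable_scaleR_grad[OF _ T(1,2), where p=0, unfolded diff_zero]
  have wi: "integrable ?M (\<lambda>x. \<phi> x *\<^sub>R z x)" if "is_weak_grad \<Omega> y z" for y z
    by (rule integrable_compact_supp_scaleR[OF \<Omega>m T(2,3) _ C_diff_continuous[OF T(1)]])
       (use that T supp_eq_0[of _ \<phi>] in \<open>auto simp: is_weak_grad_def\<close>)
  have "(LINT x|?M. (\<alpha> * v x + \<beta> * v' x) *\<^sub>R grad \<phi> x) =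
     \<alpha> *\<^sub>R (LINT x|?M. v x *\<^sub>R grad \<phi> x) + \<beta> *\<^sub>R (LINT x|?M. v' x *\<^sub>R grad \<phi> x)"
    unfolding scaleR_add_left scaleR_scaleR[symmetric] using gi[OF v(1)] gi[OF v(2)]
    by (simp del: scaleR_scaleR)
  also have "\<dots> = - (\<alpha> *\<^sub>R (LINT x|?M. \<phi> x *\<^sub>R w x) + \<beta> *\<^sub>R (LINT x|?M. \<phi> x *\<^sub>R w' x))"
    using w \<phi> by (simp add: is_weak_grad_def)
  also have "\<alpha> *\<^sub>R (LINT x|?M. \<phi> x *\<^sub>R w x) + \<beta> *\<^sub>R (LINT x|?M. \<phi> x *\<^sub>R w' x) =
     (LINT x|?M. \<alpha> *\<^sub>R (\<phi> x *\<^sub>R w x) + \<beta> *\<^sub>R (\<phi> x *\<^sub>R w' x))"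
    using wi[OF w(1)] wi[OF w(2)] by (simp del: scaleR_scaleR)
  also have "\<dots> = (LINT x|?M. \<phi> x *\<^sub>R (\<alpha> *\<^sub>R w x + \<beta> *\<^sub>R w' x))"
    by (simp add: scaleR_add_right mult.commute)
  finally show "(LINT x|?M. (\<alpha> * v x + \<beta> * v' x) *\<^sub>R grad \<phi> x) =
     - (LINT x|?M. \<phi> x *\<^sub>R (\<alpha> *\<^sub>R w x + \<beta> *\<^sub>R w' x))" .
qed

lemma lipschitz_on_linear_combination:
  fixes v v' :: "'a::metric_space \<Rightarrow> real"
  assumes "K-lipschitz_on S v" "K'-lipschitz_on S v'"
  shows "(\<bar>\<alpha>\<bar> * K + \<bar>\<beta>\<bar> * K')-lipschitz_on S (\<lambda>x. \<alpha> * v x + \<beta> * v' x)"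
  by (intro lipschitz_on_add lipschitz_on_cmult_real assms)

subsection \<open>Existence and uniqueness of minimizers\<close>

locale energy_problem = power_series_density a \<sigma> for a \<sigma> +
  fixes \<Omega> :: "'a::euclidean_space set"
  assumes \<Omega>_open: "open \<Omega>" and \<Omega>_bounded: "bounded \<Omega>" and \<Omega>_ne: "\<Omega> \<noteq> {}"
begin

abbreviation "M \<equiv> lebesgue_on \<Omega>"

lemma \<Omega>_measurable: "\<Omega> \<in> sets lebesgue" "\<Omega> \<in> lmeasurable"
  using \<Omega>_open \<Omega>_bounded by (auto simp: lmeasurable_open)

lemma finite_measure_M: "finite_measure M"
  by (rule finite_measure_lebesgue_on[OF \<Omega>_measurable(2)])

section \<open>The energy as a real number\<close>

definition J :: "('a \<Rightarrow> 'a) \<Rightarrow> real" where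
  "J w = (LINT x|M. Phi a (norm (w x)))"

text \<open>The gradient is an argument of its own: limits and perturbations come with an explicit
  weak gradient, not with the one chosen by \<open>weak_grad\<close>.\<close>

definition E :: "('a \<Rightarrow> real) \<Rightarrow> ('a \<Rightarrow> real) \<Rightarrow> ('a \<Rightarrow> 'a) \<Rightarrow> real" where
  "E f0 v w = J w - (LINT x|M. f0 x * v x)"

lemma Phi_measurable [measurable]: "Phi a \<in> borel_measurable borel"
  unfolding Phi_def[abs_def] by measurable

lemma Phi_norm_measurable:
  fixes w :: "'a \<Rightarrow> 'a"
  assumes "w \<in> borel_measurable M"
  shows "(\<lambda>x. Phi a (norm (w x))) \<in> borel_measurable M"
  by (rule measurable_compose[OF assms measurable_compose[OF borel_measurable_norm Phi_measurable]])

lemma Phi_norm_bounds: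
  assumes "norm \<xi> \<le> \<sigma>"
  shows "0 \<le> Phi a (norm \<xi>)" "Phi a (norm \<xi>) \<le> Phi a \<sigma>"
  using assms by (auto intro: Phi_nonneg Phi_mono)

lemma Phi_norm_integrable:
  fixes w :: "'a \<Rightarrow> 'a"
  assumes "w \<in> borel_measurable M" "AE x in M. norm (w x) \<le> \<sigma>"
  shows "integrable M (\<lambda>x. Phi a (norm (w x)))"
proof -
  interpret finite_measure M by (rule finite_measure_M)
  show ?thesis
  proof (rule integrable_const_bound[where B="Phi a \<sigma>"])
    show "AE x in M. norm (Phi a (norm (w x))) \<le> Phi a \<sigma>"
      using assms(2) by eventually_elim (simp add: Phi_norm_bounds)
  qed (rule Phi_norm_measurable[OF assms(1)])
qed

text \<open>Under the gradient bound the infinite value of \<open>G_fun\<close> occurs at most on a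
  null set, so energies can be compared by real arithmetic.\<close>

lemma energy_eq:
  assumes w: "is_weak_grad \<Omega> v w" "AE x in M. norm (w x) \<le> \<sigma>"
  shows "energy a \<sigma> \<Omega> f0 v = ereal (E f0 v w)"
proof -
  have wm: "w \<in> borel_measurable M" using w(1) by (auto simp: is_weak_grad_def)
  have nn: "AE x in M. 0 \<le> Phi a (norm (w x))"
    using w(2) by eventually_elim (simp add: Phi_norm_bounds)
  have "AE x in M. G_fun a \<sigma> (weak_grad \<Omega> v x) = ennreal (Phi a (norm (w x)))"
    using weak_grad_eq[OF \<Omega>_open w(1)] w(2) by eventually_elim (simp add: G_fun_def)
  then have "(\<integral>\<^sup>+x. G_fun a \<sigma> (weak_grad \<Omega> v x) \<partial>M) = (\<integral>\<^sup>+x. ennreal (Phi a (norm (w x))) \<partial>M)"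
    by (rule nn_integral_cong_AE)
  also have "\<dots> = ennreal (J w)"
    unfolding J_def by (rule nn_integral_eq_integral[OF Phi_norm_integrable[OF wm w(2)] nn])
  finally show ?thesis
    using integral_nonneg_AE[OF nn] by (simp add: energy_def E_def J_def enn2ereal_ennreal)
qed

lemma S_class_weak_grad:
  assumes "v \<in> S_class \<sigma> \<Omega> g"
  shows "is_weak_grad \<Omega> v (weak_grad \<Omega> v)" "AE x in M. norm (weak_grad \<Omega> v x) \<le> \<sigma>"
proof -
  obtain K where "K-lipschitz_on (closure \<Omega>) v" "grad_Linf \<Omega> v \<le> ereal \<sigma>"
    using assms by (auto simp: S_class_def lipschitz_fun_on_def)
  then show "is_weak_grad \<Omega> v (weak_grad \<Omega> v)" "AE x in M. norm (weak_grad \<Omega> v x) \<le> \<sigma>"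
    using weak_grad_lipschitz(1)[OF \<Omega>_open \<Omega>_bounded] grad_Linf_le_iff[OF \<Omega>_open] by blast+
qed

text \<open>A bounded nonempty set is not the whole space. A frontier point fixes the additive
  constant that a gradient bound leaves open.\<close>

lemma frontier_nonempty: "frontier \<Omega> \<noteq> {}"
  using \<Omega>_bounded \<Omega>_ne by (intro frontier_not_empty) (auto simp: not_bounded_UNIV)

lemma integrable_mult_lipschitz:
  fixes f0 v :: "'a \<Rightarrow> real"
  assumes f0: "integrable M f0" and v: "K-lipschitz_on (closure \<Omega>) v"
  shows "integrable M (\<lambda>x. f0 x * v x)"
proof -
  obtain B where B: "\<And>x. x \<in> closure \<Omega> \<Longrightarrow> \<bar>v x\<bar> \<le> B"
    using lipschitz_closure_bounded[OF \<Omega>_bounded v] by blast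
  have "integrable M (\<lambda>x. v x *\<^sub>R f0 x)"
    by (rule integrable_bounded_scaleR[OF f0 lipschitz_closure_measurable[OF v], where B=B])
       (use B closure_subset[of \<Omega>] in \<open>auto intro!: AE_I2\<close>)
  then show ?thesis by (simp add: mult.commute)
qed

text \<open>The datum enters linearly, so the full convexity gain of the density survives. It makes
  the sublevel sets midpoint convex and later forces minimizers to share their gradient.\<close>

lemma E_midpoint:
  assumes f0: "integrable M f0" and v: "K-lipschitz_on (closure \<Omega>) v" "K'-lipschitz_on (closure \<Omega>) v'"
    and w: "w \<in> borel_measurable M" "AE x in M. norm (w x) \<le> \<sigma>" "w' \<in> borel_measurable M" "AE x in M. norm (w' x) \<le> \<sigma>"
  shows "E f0 (\<lambda>x. (1/2) * v x + (1/2) * v' x) (\<lambda>x. (1/2) *\<^sub>R (w x + w' x))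
      + a 2 / 8 * (LINT x|M. norm (w x - w' x) ^ 2) \<le> (E f0 v w + E f0 v' w') / 2"
proof -
  interpret finite_measure M by (rule finite_measure_M)
  let ?m = "\<lambda>x. (1/2) *\<^sub>R (w x + w' x)"
  have mm: "?m \<in> borel_measurable M" using w by measurable
  have mb: "AE x in M. norm (?m x) \<le> \<sigma>"
    using w(2,4)
  proof eventually_elim
    case (elim x)
    then show ?case using norm_triangle_ineq[of "w x" "w' x"] by simp
  qed
  have db: "AE x in M. norm (w x - w' x) \<le> 2 * \<sigma>"
    using w(2,4)
  proof eventually_elim
    case (elim x)
    then show ?case using norm_triangle_ineq4[of "w x" "w' x"] by simp
  qed
  have "integrable M (\<lambda>x. norm (w x - w' x) ^ 2)"
    by (rule integrable_bounded_power[OF _ db]) (use w in auto)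
  note i = this Phi_norm_integrable[OF w(1,2)] Phi_norm_integrable[OF w(3,4)] Phi_norm_integrable[OF mm mb]
  have "J ?m + a 2 / 8 * (LINT x|M. norm (w x - w' x) ^ 2) =
     (LINT x|M. Phi a (norm (?m x)) + a 2 / 8 * norm (w x - w' x) ^ 2)"
    unfolding J_def using i by (simp del: norm_scaleR)
  also have "\<dots> \<le> (LINT x|M. (Phi a (norm (w x)) + Phi a (norm (w' x))) / 2)"
  proof (rule integral_mono_AE)
    show "AE x in M. Phi a (norm (?m x)) + a 2 / 8 * norm (w x - w' x) ^ 2 \<le> (Phi a (norm (w x)) + Phi a (norm (w' x))) / 2"
      using w(2,4) by eventually_elim (rule Phi_midpoint)
  qed (use i in \<open>auto simp del: norm_scaleR\<close>)
  also have "\<dots> = (J w + J w') / 2" unfolding J_def using i by simp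
  finally have J: "J ?m + a 2 / 8 * (LINT x|M. norm (w x - w' x) ^ 2) \<le> (J w + J w') / 2" .
  have "(LINT x|M. f0 x * ((1/2) * v x + (1/2) * v' x)) = (LINT x|M. (1/2) * (f0 x * v x + f0 x * v' x))"
    by (intro Bochner_Integration.integral_cong refl) (simp add: algebra_simps)
  also have "\<dots> = (1/2) * ((LINT x|M. f0 x * v x) + (LINT x|M. f0 x * v' x))"
    by (simp only: integral_mult_right_zero
        Bochner_Integration.integral_add[OF integrable_mult_lipschitz[OF f0 v(1)] integrable_mult_lipschitz[OF f0 v(2)]])
  finally show ?thesis using J unfolding E_def by argo
qed

lemma S_class_iff': "\<sigma>-lipschitz_on (frontier \<Omega>) g \<Longrightarrow>
    v \<in> S_class \<sigma> \<Omega> g \<longleftrightarrow> \<sigma>-lipschitz_on (closure \<Omega>) v \<and> (\<forall>x\<in>frontier \<Omega>. v x = g x)"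
  by (rule S_class_iff[OF \<Omega>_open \<Omega>_bounded])

lemma S_class_bounded:
  assumes g: "\<sigma>-lipschitz_on (frontier \<Omega>) g"
  obtains B where "0 \<le> B" "\<And>v x. v \<in> S_class \<sigma> \<Omega> g \<Longrightarrow> x \<in> closure \<Omega> \<Longrightarrow> \<bar>v x\<bar> \<le> B"
proof -
  obtain z where z: "z \<in> frontier \<Omega>" using frontier_nonempty by blast
  have zc: "z \<in> closure \<Omega>" using z by (simp add: frontier_def)
  obtain R where R: "\<And>x. x \<in> closure \<Omega> \<Longrightarrow> dist z x \<le> R"
    using bounded_closure[OF \<Omega>_bounded] bounded_any_center[of "closure \<Omega>" z] by auto
  have R0: "0 \<le> R" using R[OF zc] by simp
  show ?thesis
  proof (rule that[of "\<bar>g z\<bar> + \<sigma> * R"])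
    show "0 \<le> \<bar>g z\<bar> + \<sigma> * R" using R0 \<sigma>_pos by simp
    fix v x assume v: "v \<in> S_class \<sigma> \<Omega> g" and x: "x \<in> closure \<Omega>"
    then have "\<bar>v z - v x\<bar> \<le> \<sigma> * dist z x" "v z = g z"
      using S_class_iff'[OF g, of v] lipschitz_onD[of \<sigma> "closure \<Omega>" v z x] z zc by (auto simp: dist_real_def)
    moreover have "\<sigma> * dist z x \<le> \<sigma> * R" using R[OF x] \<sigma>_pos by simp
    ultimately show "\<bar>v x\<bar> \<le> \<bar>g z\<bar> + \<sigma> * R" by argo
  qed
qed

lemma Phi_norm_tendsto:
  assumes c: "c \<longlonglongrightarrow> (\<xi> :: 'a)" and b: "\<And>n. norm (c n) \<le> \<sigma>" and \<xi>: "norm \<xi> \<le> \<sigma>"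
  shows "(\<lambda>n. Phi a (norm (c n))) \<longlonglongrightarrow> Phi a (norm \<xi>)"
proof (rule LIM_zero_cancel, rule tendsto_0_le[where K=L])
  show "(\<lambda>n. norm (c n) - norm \<xi>) \<longlonglongrightarrow> 0"
    using tendsto_diff[OF tendsto_norm[OF c] tendsto_const, of "norm \<xi>"] by simp
  have "\<bar>Phi a (norm (c n)) - Phi a (norm \<xi>)\<bar> \<le> \<bar>norm (c n) - norm \<xi>\<bar> * L" for n
  proof -
    have "Phi a (norm (c n)) \<le> Phi a (norm \<xi>) + L * \<bar>norm (c n) - norm \<xi>\<bar>"
      "Phi a (norm \<xi>) \<le> Phi a (norm (c n)) + L * \<bar>norm (c n) - norm \<xi>\<bar>"
      using b \<xi> by (auto intro!: Phi_add_le)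
    then show ?thesis by (simp add: abs_le_iff mult.commute)
  qed
  then show "\<forall>\<^sub>F n in sequentially. norm (Phi a (norm (c n)) - Phi a (norm \<xi>)) \<le> norm (norm (c n) - norm \<xi>) * L"
    by simp
qed

text \<open>The direct method, with the selection applied to gradients instead of functions. Almost
  everywhere convergence of bounded gradients lets the nonlinear part of the energy pass to the
  limit by dominated convergence.\<close>

lemma minimizer_exists:
  assumes g: "\<sigma>-lipschitz_on (frontier \<Omega>) g" and f0: "integrable M f0"
  obtains u where "is_minimizer a \<sigma> \<Omega> g f0 u"
proof -
  interpret finite_measure M by (rule finite_measure_M)
  let ?S = "S_class \<sigma> \<Omega> g"
  let ?E = "\<lambda>v. E f0 v (weak_grad \<Omega> v)"
  note S = S_class_iff'[OF g]
  obtain B where B: "0 \<le> B" "\<And>v x. v \<in> ?S \<Longrightarrow> x \<in> closure \<Omega> \<Longrightarrow> \<bar>v x\<bar> \<le> B"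
    using S_class_bounded[OF g] by blast
  have Sne: "?S \<noteq> {}"
  proof -
    obtain V where V: "\<sigma>-lipschitz_on UNIV V" "\<And>x. x \<in> frontier \<Omega> \<Longrightarrow> V x = g x"
      using lipschitz_extension_UNIV[OF g] by blast
    have "V \<in> ?S" unfolding S using V(2) lipschitz_on_subset[OF V(1)] by blast
    then show ?thesis by blast
  qed
  have lip: "\<sigma>-lipschitz_on (closure \<Omega>) v" if "v \<in> ?S" for v using S that by blast
  have fv: "integrable M (\<lambda>x. f0 x * v x)" if "v \<in> ?S" for v
    by (rule integrable_mult_lipschitz[OF f0 lip[OF that]])
  have fvb: "norm (f0 x * v x) \<le> B * norm (f0 x)" if "v \<in> ?S" "x \<in> \<Omega>" for v x
  proof -
    have "\<bar>v x\<bar> \<le> B" using B(2)[OF that(1), of x] that(2) closure_subset[of \<Omega>] by blast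
    then have "\<bar>v x\<bar> * \<bar>f0 x\<bar> \<le> B * \<bar>f0 x\<bar>" by (rule mult_right_mono) simp
    then show ?thesis by (simp add: abs_mult mult.commute)
  qed
  have bb: "bdd_below (?E ` ?S)"
  proof (rule bdd_belowI2)
    fix v assume v: "v \<in> ?S"
    have "AE x in M. 0 \<le> Phi a (norm (weak_grad \<Omega> v x))"
      using S_class_weak_grad(2)[OF v] by eventually_elim (simp add: Phi_norm_bounds)
    then have "0 \<le> J (weak_grad \<Omega> v)" unfolding J_def by (rule integral_nonneg_AE)
    moreover have "(LINT x|M. f0 x * v x) \<le> (LINT x|M. B * norm (f0 x))"
      by (rule integral_mono[OF fv[OF v]]) (use f0 fvb[OF v] in \<open>auto simp: abs_le_iff\<close>)
    ultimately show "- (LINT x|M. B * norm (f0 x)) \<le> ?E v" unfolding E_def by argo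
  qed
  define m where "m = (INF v\<in>?S. ?E v)"
  have m_le: "m \<le> ?E v" if "v \<in> ?S" for v unfolding m_def by (rule cINF_lower[OF bb that])
  \<comment> \<open>The functions are hidden behind an existential quantifier, because the selection
    works on gradients alone; choice recovers them afterwards.\<close>
  define C where "C n = {c. \<exists>v\<in>?S. is_weak_grad \<Omega> v c \<and> (AE x in M. norm (c x) \<le> \<sigma>) \<and> E f0 v c \<le> m + inverse (real (Suc n))}"
    for n
  have Cm: "c \<in> borel_measurable M" "AE x in M. norm (c x) \<le> \<sigma>" if "c \<in> C n" for c n
    using that by (auto simp: C_def is_weak_grad_def)
  obtain c w where cw: "\<And>n. c n \<in> C n" "w \<in> borel_measurable M" "AE x in M. (\<lambda>n. c n x) \<longlonglongrightarrow> w x"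
  proof (rule convex_selection_AE_convergent[of C \<sigma>])
    fix n
    show "C n \<noteq> {}"
    proof -
      have "m < m + inverse (real (Suc n))" by simp
      then obtain v where v: "v \<in> ?S" "?E v < m + inverse (real (Suc n))"
        unfolding m_def using cINF_less_iff[OF Sne bb] by blast
      then have "weak_grad \<Omega> v \<in> C n" using S_class_weak_grad[OF v(1)] by (auto simp: C_def intro: less_imp_le)
      then show ?thesis by blast
    qed
    have "inverse (real (Suc (Suc n))) \<le> inverse (real (Suc n))" by (intro le_imp_inverse_le) auto
    then have "E f0 v c \<le> m + inverse (real (Suc n))" if "E f0 v c \<le> m + inverse (real (Suc (Suc n)))" for v c
      using that by argo
    then show "C (Suc n) \<subseteq> C n" unfolding C_def by blast
    fix c c' assume cC: "c \<in> C n" and c'C: "c' \<in> C n"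
    obtain v where v: "v \<in> ?S" "is_weak_grad \<Omega> v c" "AE x in M. norm (c x) \<le> \<sigma>" "E f0 v c \<le> m + inverse (real (Suc n))"
      using cC unfolding C_def by blast
    obtain v' where v': "v' \<in> ?S" "is_weak_grad \<Omega> v' c'" "AE x in M. norm (c' x) \<le> \<sigma>" "E f0 v' c' \<le> m + inverse (real (Suc n))"
      using c'C unfolding C_def by blast
    let ?v = "\<lambda>x. (1/2) * v x + (1/2) * v' x"
    let ?c = "\<lambda>x. (1/2) *\<^sub>R (c x + c' x)"
    have "?v \<in> ?S"
      unfolding S using lipschitz_on_linear_combination[OF lip[OF v(1)] lip[OF v'(1)], of "1/2" "1/2"] S[of v] S[of v'] v(1) v'(1)
      by simp
    moreover have "is_weak_grad \<Omega> ?v ?c"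
      using is_weak_grad_linear_combination[OF \<Omega>_open lipschitz_closure_integrable[OF \<Omega>_open \<Omega>_bounded lip[OF v(1)]]
          lipschitz_closure_integrable[OF \<Omega>_open \<Omega>_bounded lip[OF v'(1)]] v(2) v'(2), of "1/2" "1/2"]
      by (simp add: scaleR_add_right)
    moreover have "AE x in M. norm (?c x) \<le> \<sigma>"
      using v(3) v'(3)
    proof eventually_elim
      case (elim x)
      then show ?case using norm_triangle_ineq[of "c x" "c' x"] by simp
    qed
    moreover have "E f0 ?v ?c \<le> m + inverse (real (Suc n))"
    proof -
      have "0 \<le> a 2 / 8 * (LINT x|M. norm (c x - c' x) ^ 2)"
        using a2_pos by (intro mult_nonneg_nonneg Bochner_Integration.integral_nonneg) auto
      then show ?thesis
        using E_midpoint[OF f0 lip[OF v(1)] lip[OF v'(1)] Cm[OF cC] Cm[OF c'C]] v(4) v'(4) by argo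
    qed
    ultimately show "?c \<in> C n" unfolding C_def by blast
  qed (use Cm in blast)+
  have "\<forall>n. \<exists>v. v \<in> ?S \<and> is_weak_grad \<Omega> v (c n) \<and> E f0 v (c n) \<le> m + inverse (real (Suc n))"
    using cw(1) unfolding C_def by blast
  from choice[OF this] obtain v where v: "\<And>n. v n \<in> ?S" "\<And>n. is_weak_grad \<Omega> (v n) (c n)"
    "\<And>n. E f0 (v n) (c n) \<le> m + inverse (real (Suc n))" by blast
  \<comment> \<open>Uniform boundedness and the common Lipschitz constant give a uniformly
    convergent subsequence. The gradients already converge along the full sequence, so nothing is
    lost in thinning it out.\<close>
  obtain u k where k: "strict_mono (k :: nat \<Rightarrow> nat)"
    and unif: "\<And>e. 0 < e \<Longrightarrow> \<exists>N. \<forall>n x. n \<ge> N \<and> x \<in> closure \<Omega> \<longrightarrow> norm (v (k n) x - u x) < e"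
  proof (rule Arzela_Ascoli[of "closure \<Omega>" v B])
    show "compact (closure \<Omega>)" using \<Omega>_bounded by simp
    show "norm (v n x) \<le> B" if "x \<in> closure \<Omega>" for n x using B(2)[OF v(1) that] by simp
    show "\<exists>d>0. \<forall>n y. y \<in> closure \<Omega> \<and> norm (x - y) < d \<longrightarrow> norm (v n x - v n y) < e"
      if x: "x \<in> closure \<Omega>" and e: "0 < e" for x e
    proof (intro exI[of _ "e / \<sigma>"] conjI allI impI)
      show "0 < e / \<sigma>" using e \<sigma>_pos by simp
      fix n y assume y: "y \<in> closure \<Omega> \<and> norm (x - y) < e / \<sigma>"
      have "norm (v n x - v n y) \<le> \<sigma> * norm (x - y)"
        using lipschitz_onD[OF lip[OF v(1)[of n]] x] y by (simp add: dist_norm)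
      also have "\<dots> < e" using y \<sigma>_pos by (simp add: less_divide_eq mult.commute)
      finally show "norm (v n x - v n y) < e" .
    qed
  qed blast
  have lim: "(\<lambda>n. v (k n) x) \<longlonglongrightarrow> u x" if "x \<in> closure \<Omega>" for x
    using unif that by (intro LIMSEQ_I) blast
  have uS: "u \<in> ?S"
    unfolding S
  proof (intro conjI ballI lipschitz_onI)
    fix x y assume x: "x \<in> closure \<Omega>" and y: "y \<in> closure \<Omega>"
    have "(\<lambda>n. dist (v (k n) x) (v (k n) y)) \<longlonglongrightarrow> dist (u x) (u y)" by (intro tendsto_dist lim x y)
    then show "dist (u x) (u y) \<le> \<sigma> * dist x y"
      by (rule LIMSEQ_le_const2) (use lipschitz_onD[OF lip[OF v(1)] x y] in blast)
  next
    fix x assume x: "x \<in> frontier \<Omega>"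
    then have "x \<in> closure \<Omega>" by (simp add: frontier_def)
    moreover have "v (k n) x = g x" for n using S[of "v (k n)"] v(1) x by blast
    ultimately show "u x = g x" using lim[of x] by (simp add: LIMSEQ_const_iff)
  qed (use \<sigma>_pos in simp)
  have ae: "AE x in M. (\<lambda>n. c (k n) x) \<longlonglongrightarrow> w x \<and> (\<forall>n. norm (c n x) \<le> \<sigma>) \<and> norm (w x) \<le> \<sigma>"
  proof -
    have "AE x in M. \<forall>n. norm (c n x) \<le> \<sigma>" using Cm(2)[OF cw(1)] by (simp add: AE_all_countable)
    with cw(3) show ?thesis
    proof eventually_elim
      case (elim x)
      have "norm (w x) \<le> \<sigma>" by (rule LIMSEQ_le_const2[OF tendsto_norm[OF elim(1)]]) (use elim(2) in blast)
      then show ?case using elim LIMSEQ_subseq_LIMSEQ[OF elim(1) k] by (simp add: comp_def)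
    qed
  qed
  have wb: "AE x in M. norm (w x) \<le> \<sigma>" using ae by eventually_elim blast
  \<comment> \<open>The limit of the gradients is the gradient of the limit: both sides of the weak
    identity converge, dominated by constants on a finite measure space.\<close>
  have wg: "is_weak_grad \<Omega> u w"
    unfolding is_weak_grad_def
  proof (intro conjI allI impI ballI)
    show "w \<in> borel_measurable M" by (rule cw(2))
    show "integrable (lebesgue_on K) w" if K: "compact K \<and> K \<subseteq> \<Omega>" for K
    proof -
      have "integrable M w" by (rule integrable_const_bound[OF wb cw(2)])
      from integrable_lebesgue_on_subset[OF this \<Omega>_measurable(1)] show ?thesis
        using K by (auto intro!: fmeasurableD lmeasurable_compact)
    qed
    fix \<phi> assume \<phi>: "\<phi> \<in> test_functions \<Omega>"
    note T = test_functions_C1c[OF \<phi>]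
    obtain D where D: "\<And>x. \<bar>\<phi> x\<bar> \<le> D" "\<And>x. norm (grad \<phi> x) \<le> D" using C1c_bounds[OF T(1,2)] by metis
    have D0: "0 \<le> D" using order_trans[OF abs_ge_zero D(1)] .
    have "(\<lambda>n. LINT x|M. v (k n) x *\<^sub>R grad \<phi> x) \<longlonglongrightarrow> (LINT x|M. u x *\<^sub>R grad \<phi> x)"
    proof (rule integral_dominated_convergence[where w="\<lambda>x. B * D"])
      have "(\<lambda>x. z x *\<^sub>R grad \<phi> x) \<in> borel_measurable M" if "z \<in> ?S" for z
        by (intro borel_measurable_scaleR continuous_borel_measurable_lebesgue_on[OF grad_continuous[OF T(1)]]
            lipschitz_closure_measurable[OF lip[OF that]])
      from this[OF uS] this[OF v(1)]
      show "(\<lambda>x. u x *\<^sub>R grad \<phi> x) \<in> borel_measurable M" "\<And>n. (\<lambda>x. v (k n) x *\<^sub>R grad \<phi> x) \<in> borel_measurable M" .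
      show "AE x in M. (\<lambda>n. v (k n) x *\<^sub>R grad \<phi> x) \<longlonglongrightarrow> u x *\<^sub>R grad \<phi> x"
        using closure_subset[of \<Omega>] by (intro AE_I2 tendsto_scaleR tendsto_const lim) auto
      show "AE x in M. norm (v (k n) x *\<^sub>R grad \<phi> x) \<le> B * D" for n
        using closure_subset[of \<Omega>] B(1) by (intro AE_I2) (auto intro!: mult_mono B(2)[OF v(1)] D)
    qed auto
    moreover have "(\<lambda>n. LINT x|M. \<phi> x *\<^sub>R c (k n) x) \<longlonglongrightarrow> (LINT x|M. \<phi> x *\<^sub>R w x)"
    proof (rule integral_dominated_convergence[where w="\<lambda>x. D * \<sigma>"])
      show "(\<lambda>x. \<phi> x *\<^sub>R w x) \<in> borel_measurable M" "\<And>n. (\<lambda>x. \<phi> x *\<^sub>R c (k n) x) \<in> borel_measurable M"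
        using cw(2) Cm(1)[OF cw(1)]
        by (auto intro!: borel_measurable_scaleR continuous_borel_measurable_lebesgue_on[OF C_diff_continuous[OF T(1)]])
      show "AE x in M. (\<lambda>n. \<phi> x *\<^sub>R c (k n) x) \<longlonglongrightarrow> \<phi> x *\<^sub>R w x"
        using ae by eventually_elim (intro tendsto_intros, blast)
      show "AE x in M. norm (\<phi> x *\<^sub>R c (k n) x) \<le> D * \<sigma>" for n
        using ae by eventually_elim (auto intro!: mult_mono D D0)
    qed auto
    then have "(\<lambda>n. - (LINT x|M. \<phi> x *\<^sub>R c (k n) x)) \<longlonglongrightarrow> - (LINT x|M. \<phi> x *\<^sub>R w x)"
      by (rule tendsto_minus)
    moreover have "(LINT x|M. v (k n) x *\<^sub>R grad \<phi> x) = - (LINT x|M. \<phi> x *\<^sub>R c (k n) x)" for n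
      using v(2) \<phi> unfolding is_weak_grad_def by blast
    ultimately show "(LINT x|M. u x *\<^sub>R grad \<phi> x) = - (LINT x|M. \<phi> x *\<^sub>R w x)"
      using LIMSEQ_unique by auto
  qed
  have "(\<lambda>n. J (c (k n))) \<longlonglongrightarrow> J w"
    unfolding J_def
  proof (rule integral_dominated_convergence[where w="\<lambda>x. Phi a \<sigma>"])
    show "AE x in M. (\<lambda>n. Phi a (norm (c (k n) x))) \<longlonglongrightarrow> Phi a (norm (w x))"
      using ae by eventually_elim (auto intro!: Phi_norm_tendsto)
    show "AE x in M. norm (Phi a (norm (c (k n) x))) \<le> Phi a \<sigma>" for n
      using ae by eventually_elim (simp add: Phi_norm_bounds)
  qed (use cw(2) Cm(1)[OF cw(1)] in \<open>auto intro!: Phi_norm_measurable\<close>)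
  moreover have "(\<lambda>n. LINT x|M. f0 x * v (k n) x) \<longlonglongrightarrow> (LINT x|M. f0 x * u x)"
  proof (rule integral_dominated_convergence[where w="\<lambda>x. B * norm (f0 x)"])
    show "AE x in M. (\<lambda>n. f0 x * v (k n) x) \<longlonglongrightarrow> f0 x * u x"
      using closure_subset[of \<Omega>] by (intro AE_I2 tendsto_mult tendsto_const lim) auto
    show "AE x in M. norm (f0 x * v (k n) x) \<le> B * norm (f0 x)" for n
      using fvb[OF v(1)] by (intro AE_I2) auto
  qed (use fv[OF uS] fv[OF v(1)] f0 in auto)
  ultimately have "(\<lambda>n. E f0 (v (k n)) (c (k n))) \<longlonglongrightarrow> E f0 u w"
    unfolding E_def by (intro tendsto_diff)
  moreover have "(\<lambda>n. m + inverse (real (Suc (k n)))) \<longlonglongrightarrow> m + 0"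
    using LIMSEQ_subseq_LIMSEQ[OF LIMSEQ_inverse_real_of_nat k] by (intro tendsto_intros) (simp add: comp_def)
  ultimately have Eu: "E f0 u w \<le> m"
    using LIMSEQ_le[of "\<lambda>n. E f0 (v (k n)) (c (k n))" "E f0 u w" "\<lambda>n. m + inverse (real (Suc (k n)))" "m + 0"] v(3) by simp
  show ?thesis
  proof (rule that)
    have "energy a \<sigma> \<Omega> f0 u \<le> energy a \<sigma> \<Omega> f0 z" if z: "z \<in> ?S" for z
      using energy_eq[OF wg wb] energy_eq[OF S_class_weak_grad[OF z]] Eu m_le[OF z] by simp
    then show "is_minimizer a \<sigma> \<Omega> g f0 u" using uS by (simp add: is_minimizer_def)
  qed
qed

text \<open>The midpoint of two minimizers is admissible and would save energy unless their
  gradients agree almost everywhere. Their difference then has zero gradient and zero boundary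
  values.\<close>

lemma minimizer_unique:
  assumes g: "\<sigma>-lipschitz_on (frontier \<Omega>) g" and f0: "integrable M f0"
    and u: "is_minimizer a \<sigma> \<Omega> g f0 u" and v: "is_minimizer a \<sigma> \<Omega> g f0 v" and x: "x \<in> closure \<Omega>"
  shows "v x = u x"
proof -
  interpret finite_measure M by (rule finite_measure_M)
  let ?S = "S_class \<sigma> \<Omega> g"
  note S = S_class_iff'[OF g]
  have uS: "u \<in> ?S" and vS: "v \<in> ?S" using u v by (auto simp: is_minimizer_def)
  note wu = S_class_weak_grad[OF uS] and wv = S_class_weak_grad[OF vS]
  have lip: "\<sigma>-lipschitz_on (closure \<Omega>) u" "\<sigma>-lipschitz_on (closure \<Omega>) v" using S uS vS by blast+
  note int = lipschitz_closure_integrable[OF \<Omega>_open \<Omega>_bounded lip(1)] lipschitz_closure_integrable[OF \<Omega>_open \<Omega>_bounded lip(2)]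
  let ?u = "weak_grad \<Omega> u" and ?v = "weak_grad \<Omega> v"
  let ?m = "\<lambda>x. (1/2) * u x + (1/2) * v x" and ?w = "\<lambda>x. (1/2) *\<^sub>R (?u x + ?v x)"
  have meas: "?u \<in> borel_measurable M" "?v \<in> borel_measurable M" using wu(1) wv(1) by (auto simp: is_weak_grad_def)
  have mS: "?m \<in> ?S"
    unfolding S using lipschitz_on_linear_combination[OF lip, of "1/2" "1/2"] S[of u] S[of v] uS vS by simp
  have mg: "is_weak_grad \<Omega> ?m ?w"
    using is_weak_grad_linear_combination[OF \<Omega>_open int wu(1) wv(1), of "1/2" "1/2"] by (simp add: scaleR_add_right)
  have mb: "AE x in M. norm (?w x) \<le> \<sigma>"
    using wu(2) wv(2)
  proof eventually_elim
    case (elim x)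
    then show ?case using norm_triangle_ineq[of "?u x" "?v x"] by simp
  qed
  have "E f0 u ?u \<le> E f0 ?m ?w" "E f0 v ?v \<le> E f0 ?m ?w"
    using u v mS energy_eq[OF mg mb, of f0] energy_eq[OF wu, of f0] energy_eq[OF wv, of f0]
    unfolding is_minimizer_def by auto
  then have "a 2 / 8 * (LINT x|M. norm (?u x - ?v x) ^ 2) \<le> 0"
    using E_midpoint[OF f0 lip meas(1) wu(2) meas(2) wv(2)] by argo
  then have le: "(LINT x|M. norm (?u x - ?v x) ^ 2) \<le> 0"
    using a2_pos by (simp add: mult_le_0_iff)
  have db: "AE x in M. norm (?u x - ?v x) \<le> 2 * \<sigma>"
    using wu(2) wv(2)
  proof eventually_elim
    case (elim x)
    then show ?case using norm_triangle_ineq4[of "?u x" "?v x"] by simp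
  qed
  have "integrable M (\<lambda>x. norm (?u x - ?v x) ^ 2)"
    by (rule integrable_bounded_power[OF _ db]) (use meas in auto)
  then have "AE x in M. norm (?u x - ?v x) ^ 2 = 0"
    using le integral_nonneg_eq_0_iff_AE[of M "\<lambda>x. norm (?u x - ?v x) ^ 2"] by (auto intro: antisym)
  then have d0: "AE x in M. norm (1 *\<^sub>R ?v x + (- 1) *\<^sub>R ?u x) \<le> 0" by eventually_elim simp
  let ?d = "\<lambda>x. 1 * v x + (- 1) * u x"
  have dg: "is_weak_grad \<Omega> ?d (\<lambda>x. 1 *\<^sub>R ?v x + (- 1) *\<^sub>R ?u x)"
    by (rule is_weak_grad_linear_combination[OF \<Omega>_open int(2,1) wv(1) wu(1)])
  \<comment> \<open>Slope 0 turns the characterization of \<open>S_class\<close> into constancy on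
    the entire closure.\<close>
  have "?d \<in> S_class 0 \<Omega> (\<lambda>_. 0)"
  proof -
    have "grad_Linf \<Omega> ?d \<le> ereal 0" using grad_Linf_le_iff[OF \<Omega>_open dg, of 0] d0 by blast
    moreover have "lipschitz_fun_on (closure \<Omega>) ?d"
      using lipschitz_on_linear_combination[OF lip(2,1), of 1 "- 1"] unfolding lipschitz_fun_on_def by blast
    moreover have "\<forall>x\<in>frontier \<Omega>. ?d x = 0" using S[of u] S[of v] uS vS by simp
    ultimately show ?thesis unfolding S_class_def by blast
  qed
  then have d: "0-lipschitz_on (closure \<Omega>) ?d" "\<forall>x\<in>frontier \<Omega>. ?d x = 0"
    using S_class_iff[OF \<Omega>_open \<Omega>_bounded, of 0 "\<lambda>_. 0" ?d] lipschitz_on_constant[of "frontier \<Omega>" "0::real"] by blast+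
  obtain z where z: "z \<in> frontier \<Omega>" using frontier_nonempty by blast
  then have "dist (?d x) (?d z) \<le> 0 * dist x z"
    by (intro lipschitz_onD[OF d(1) x]) (simp add: frontier_def)
  then show ?thesis using d(2) z by simp
qed

subsection \<open>Comparison with a concentrating test function\<close>

lemma W0_1inf_if_C1c:
  assumes "C_diff 1 \<psi>" "compact (supp \<psi>)" "supp \<psi> \<subseteq> \<Omega>"
  shows "\<psi> \<in> W0_1inf \<Omega>"
proof -
  obtain B where B: "B > 0" "\<And>x. norm (grad \<psi> x) \<le> B" using C1c_bounds[OF assms(1,2)] by metis
  have "B-lipschitz_on (closure \<Omega>) \<psi>"
    by (rule lipschitz_onI) (use C1c_lipschitz[OF assms(1) B(2)] B(1) in \<open>auto simp: dist_real_def\<close>)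
  moreover have "\<psi> x = 0" if "x \<in> frontier \<Omega>" for x
  proof -
    have "x \<notin> \<Omega>" using that \<Omega>_open by (simp add: frontier_def interior_open)
    then show ?thesis using assms(3) supp_eq_0[of x \<psi>] by blast
  qed
  ultimately show ?thesis unfolding W0_1inf_def lipschitz_fun_on_def by blast
qed

lemma grad_norm_integrable:
  fixes \<psi> :: "'a \<Rightarrow> real"
  assumes "C_diff 1 \<psi>" "compact (supp \<psi>)"
  shows "integrable M (\<lambda>x. norm (grad \<psi> x))"
proof -
  interpret finite_measure M by (rule finite_measure_M)
  obtain B where "\<And>x. norm (grad \<psi> x) \<le> B" using C1c_bounds[OF assms] by metis
  moreover have "(\<lambda>x. norm (grad \<psi> x)) \<in> borel_measurable M"
    by (rule measurable_compose[OF continuous_borel_measurable_lebesgue_on[OF grad_continuous[OF assms(1)]] borel_measurable_norm])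
  ultimately show ?thesis by (intro integrable_const_bound[where B=B]) auto
qed

text \<open>The term of order p is at most a_p \<sigma>^(p-1) times the integral of the length of
  \<open>grad \<psi>\<close>. This yields the absolute convergence that the weak formulation demands
  of \<psi>, and in the sum the bound \<open>L\<close> that the datum exceeds.\<close>

lemma no_weak_solution:
  assumes \<psi>: "C_diff 1 \<psi>" "compact (supp \<psi>)" "supp \<psi> \<subseteq> \<Omega>"
    and less: "L * (LINT x|M. norm (grad \<psi> x)) < (LINT x|M. f0 x * \<psi> x)"
  shows "\<not> weak_solution a \<sigma> \<Omega> g f0 u"
proof
  assume sol: "weak_solution a \<sigma> \<Omega> g f0 u"
  then have "u \<in> S_class \<sigma> \<Omega> g" by (simp add: weak_solution_def)
  note wu = S_class_weak_grad[OF this]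
  let ?I = "LINT x|M. norm (grad \<psi> x)"
  have \<psi>g: "AE x in M. weak_grad \<Omega> \<psi> x = grad \<psi> x"
    by (rule weak_grad_eq[OF \<Omega>_open is_weak_grad_C1[OF \<Omega>_open \<psi>(1)]])
  have term_le: "\<bar>weak_term a \<Omega> u \<psi> k\<bar> \<le> a (k + 2) * \<sigma> ^ (k + 1) * ?I" for k
  proof -
    have "\<bar>LINT x|M. norm (weak_grad \<Omega> u x) ^ k * (weak_grad \<Omega> u x \<bullet> weak_grad \<Omega> \<psi> x)\<bar> \<le>
       (LINT x|M. \<bar>norm (weak_grad \<Omega> u x) ^ k * (weak_grad \<Omega> u x \<bullet> weak_grad \<Omega> \<psi> x)\<bar>)"
      by (rule integral_abs_bound)
    also have "\<dots> \<le> (LINT x|M. \<sigma> ^ (k + 1) * norm (grad \<psi> x))"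
    proof (rule integral_mono_AE')
      show "integrable M (\<lambda>x. \<sigma> ^ (k + 1) * norm (grad \<psi> x))"
        using grad_norm_integrable[OF \<psi>(1,2)] by simp
      show "AE x in M. \<bar>norm (weak_grad \<Omega> u x) ^ k * (weak_grad \<Omega> u x \<bullet> weak_grad \<Omega> \<psi> x)\<bar> \<le> \<sigma> ^ (k + 1) * norm (grad \<psi> x)"
        using wu(2) \<psi>g
      proof eventually_elim
        case (elim x)
        have "\<bar>norm (weak_grad \<Omega> u x) ^ k * (weak_grad \<Omega> u x \<bullet> weak_grad \<Omega> \<psi> x)\<bar> \<le>
          norm (weak_grad \<Omega> u x) ^ k * (norm (weak_grad \<Omega> u x) * norm (grad \<psi> x))"
          unfolding abs_mult elim(2) using Cauchy_Schwarz_ineq2[of "weak_grad \<Omega> u x" "grad \<psi> x"]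
          by (intro mult_mono) auto
        also have "\<dots> = norm (weak_grad \<Omega> u x) ^ (k + 1) * norm (grad \<psi> x)" by simp
        also have "\<dots> \<le> \<sigma> ^ (k + 1) * norm (grad \<psi> x)"
          using elim(1) by (intro mult_right_mono power_mono) auto
        finally show ?case .
      qed
    qed (use \<sigma>_pos in simp)
    also have "\<dots> = \<sigma> ^ (k + 1) * ?I" by simp
    finally show ?thesis
      unfolding weak_term_def abs_mult using a_nonneg'(1)[of k]
      by (simp add: mult.assoc mult_left_mono del: add_2_eq_Suc')
  qed
  have sI: "summable (\<lambda>k. a (k + 2) * \<sigma> ^ (k + 1) * ?I)" by (rule summable_mult2[OF summable_L])
  have sabs: "summable (\<lambda>k. \<bar>weak_term a \<Omega> u \<psi> k\<bar>)"
    by (rule summable_comparison_test'[OF sI]) (use term_le in simp)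
  then have "(LINT x|M. f0 x * \<psi> x) = (\<Sum>k. weak_term a \<Omega> u \<psi> k)"
    using sol W0_1inf_if_C1c[OF \<psi>] by (simp add: weak_solution_def)
  also have "\<dots> \<le> (\<Sum>k. a (k + 2) * \<sigma> ^ (k + 1) * ?I)"
    using term_le by (intro suminf_le sI summable_rabs_cancel[OF sabs]) (simp add: abs_le_iff)
  also have "\<dots> = L * ?I" unfolding L_def by (rule suminf_mult2[OF summable_L, symmetric])
  finally show False using less by simp
qed

text \<open>
  If the gradient bound were strict, the minimizer could be shifted by a small multiple of \<open>\<psi>\<close>,
  which lowers the energy because \<open>Phi a\<close> is Lipschitz with constant \<open>L\<close>.
\<close>
lemma minimizer_grad_Linf:
  assumes \<psi>: "C_diff 1 \<psi>" "compact (supp \<psi>)" "supp \<psi> \<subseteq> \<Omega>"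
    and less: "L * (LINT x|M. norm (grad \<psi> x)) < (LINT x|M. f0 x * \<psi> x)"
    and f0: "integrable M f0" and u: "is_minimizer a \<sigma> \<Omega> g f0 u"
  shows "grad_Linf \<Omega> u = ereal \<sigma>"
proof (rule ccontr)
  assume ne: "grad_Linf \<Omega> u \<noteq> ereal \<sigma>"
  have uS: "u \<in> S_class \<sigma> \<Omega> g" using u by (simp add: is_minimizer_def)
  then obtain K where K: "K-lipschitz_on (closure \<Omega>) u" and ug: "\<forall>x\<in>frontier \<Omega>. u x = g x" and "grad_Linf \<Omega> u \<le> ereal \<sigma>"
    by (auto simp: S_class_def lipschitz_fun_on_def)
  with ne have "grad_Linf \<Omega> u < ereal \<sigma>" by simp
  then obtain s where s: "grad_Linf \<Omega> u < ereal s" "ereal s < ereal \<sigma>" using ereal_dense2 by blast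
  note wu = S_class_weak_grad[OF uS]
  let ?u = "weak_grad \<Omega> u"
  have us: "AE x in M. norm (?u x) \<le> s"
    using grad_Linf_le_iff[OF \<Omega>_open wu(1)] s(1) less_imp_le by blast
  obtain B where B: "B > 0" "\<And>x. norm (grad \<psi> x) \<le> B" using C1c_bounds[OF \<psi>(1,2)] by metis
  \<comment> \<open>The slack between \<open>s\<close> and \<sigma> divided by the bound on
    \<open>grad \<psi>\<close>, so that the shifted gradient just stays within \<sigma>.\<close>
  define t where "t = (\<sigma> - s) / B"
  have t: "t > 0" "t * B = \<sigma> - s" using s(2) B(1) by (auto simp: t_def)
  obtain K' where K': "K'-lipschitz_on (closure \<Omega>) \<psi>" and \<psi>0: "\<forall>x\<in>frontier \<Omega>. \<psi> x = 0"
    using W0_1inf_if_C1c[OF \<psi>] by (auto simp: W0_1inf_def lipschitz_fun_on_def)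
  let ?v = "\<lambda>x. 1 * u x + t * \<psi> x" and ?w = "\<lambda>x. 1 *\<^sub>R ?u x + t *\<^sub>R grad \<psi> x"
  have wv: "is_weak_grad \<Omega> ?v ?w"
    by (intro is_weak_grad_linear_combination[OF \<Omega>_open] wu(1) is_weak_grad_C1[OF \<Omega>_open \<psi>(1)]
        lipschitz_closure_integrable[OF \<Omega>_open \<Omega>_bounded K] lipschitz_closure_integrable[OF \<Omega>_open \<Omega>_bounded K'])
  have shift: "norm (\<xi> + t *\<^sub>R grad \<psi> x) \<le> norm \<xi> + t * norm (grad \<psi> x)" for \<xi> x
    using norm_triangle_ineq[of \<xi> "t *\<^sub>R grad \<psi> x"] t(1) by simp
  have vb: "AE x in M. norm (?w x) \<le> \<sigma>"
    using us
  proof eventually_elim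
    case (elim x)
    have "t * norm (grad \<psi> x) \<le> t * B" using B(2) t(1) by simp
    then show ?case using shift[of "?u x" x] elim t(2) by simp
  qed
  have vS: "?v \<in> S_class \<sigma> \<Omega> g"
  proof -
    have "grad_Linf \<Omega> ?v \<le> ereal \<sigma>" using grad_Linf_le_iff[OF \<Omega>_open wv] vb by blast
    moreover have "lipschitz_fun_on (closure \<Omega>) ?v"
      using lipschitz_on_linear_combination[OF K K'] unfolding lipschitz_fun_on_def by blast
    moreover have "\<forall>x\<in>frontier \<Omega>. ?v x = g x" using ug \<psi>0 by simp
    ultimately show ?thesis unfolding S_class_def by blast
  qed
  have meas: "?u \<in> borel_measurable M" "?w \<in> borel_measurable M" using wu(1) wv by (auto simp: is_weak_grad_def)
  note gi = grad_norm_integrable[OF \<psi>(1,2)]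
  have "J ?w \<le> (LINT x|M. Phi a (norm (?u x)) + L * (t * norm (grad \<psi> x)))"
    unfolding J_def
  proof (rule integral_mono_AE)
    show "AE x in M. Phi a (norm (?w x)) \<le> Phi a (norm (?u x)) + L * (t * norm (grad \<psi> x))"
      using wu(2) vb
    proof eventually_elim
      case (elim x)
      show ?case by (rule Phi_add_le) (use elim shift[of "?u x" x] t(1) in auto)
    qed
  qed (use Phi_norm_integrable[OF meas(2) vb] Phi_norm_integrable[OF meas(1) wu(2)] gi in auto)
  also have "\<dots> = J ?u + L * (t * (LINT x|M. norm (grad \<psi> x)))"
    unfolding J_def using Phi_norm_integrable[OF meas(1) wu(2)] gi by simp
  finally have Jw: "J ?w \<le> J ?u + L * (t * (LINT x|M. norm (grad \<psi> x)))" .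
  have "(LINT x|M. f0 x * ?v x) = (LINT x|M. f0 x * u x + t * (f0 x * \<psi> x))"
    by (intro Bochner_Integration.integral_cong refl) (simp add: algebra_simps)
  also have "\<dots> = (LINT x|M. f0 x * u x) + t * (LINT x|M. f0 x * \<psi> x)"
    using integrable_mult_lipschitz[OF f0 K] integrable_mult_lipschitz[OF f0 K'] by simp
  finally have fv: "(LINT x|M. f0 x * ?v x) = (LINT x|M. f0 x * u x) + t * (LINT x|M. f0 x * \<psi> x)" .
  \<comment> \<open>The gain from the datum exceeds the most that the density can increase.\<close>
  have "t * (L * (LINT x|M. norm (grad \<psi> x))) < t * (LINT x|M. f0 x * \<psi> x)"
    using less t(1) by simp
  then have "E f0 ?v ?w < E f0 u ?u"
    using Jw fv unfolding E_def by (simp add: mult_ac)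
  moreover have "energy a \<sigma> \<Omega> f0 u \<le> energy a \<sigma> \<Omega> f0 ?v"
    using u vS unfolding is_minimizer_def by blast
  ultimately show False using energy_eq[OF wu, of f0] energy_eq[OF wv vb, of f0] by simp
qed

end

subsection \<open>Mollified indicator functions\<close>

lemma correlation_C_diff_1:
  fixes f :: "'a::euclidean_space \<Rightarrow> 'b::euclidean_space" and \<eta> :: "'a \<Rightarrow> real"
  assumes S: "S \<in> sets lebesgue" and f: "integrable (lebesgue_on S) f"
    and \<eta>: "C_diff 1 \<eta>" "compact (supp \<eta>)"
  shows "C_diff 1 (\<lambda>x. LINT y|lebesgue_on S. \<eta> (y - x) *\<^sub>R f y)"
  unfolding One_nat_def
proof (rule C_diffI[OF correlation_has_derivative[OF S f \<eta>]])
  fix i :: 'a assume i: "i \<in> Basis"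
  obtain B where B: "\<And>x. norm (grad \<eta> x) \<le> B" using C1c_bounds[OF \<eta>] by metis
  have "\<bar>grad \<eta> x \<bullet> i\<bar> \<le> B" for x
    using Cauchy_Schwarz_ineq2[of "grad \<eta> x" i] B[of x] i by simp
  then have "continuous_on UNIV (\<lambda>x. LINT y|lebesgue_on S. (grad \<eta> (y - x) \<bullet> i) *\<^sub>R f y)"
    by (intro correlation_continuous[OF S f, of "\<lambda>z. grad \<eta> z \<bullet> i" B] continuous_on_inner
        grad_continuous[OF \<eta>(1)] continuous_on_const)
  then show "C_diff 0 (\<lambda>x. - (LINT y|lebesgue_on S. (grad \<eta> (y - x) \<bullet> i) *\<^sub>R f y))"
    by (simp add: continuous_on_minus)
qed

lemma supp_correlation_compact:
  fixes f :: "'a::euclidean_space \<Rightarrow> 'b::euclidean_space" and \<eta> :: "'a \<Rightarrow> real"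
  assumes K: "compact K" "S \<subseteq> K" and \<eta>: "\<And>z. \<eta> z \<noteq> 0 \<Longrightarrow> norm z \<le> r"
  shows "supp (\<lambda>x. LINT y|lebesgue_on S. \<eta> (y - x) *\<^sub>R f y) \<subseteq> (\<Union>z\<in>K. cball z r)"
    "compact (supp (\<lambda>x. LINT y|lebesgue_on S. \<eta> (y - x) *\<^sub>R f y))"
proof -
  let ?F = "\<lambda>x. LINT y|lebesgue_on S. \<eta> (y - x) *\<^sub>R f y"
  have cpt: "compact (\<Union>z\<in>K. cball z r)" by (rule compact_minkowski_sum_cball[OF K(1)])
  have "x \<in> (\<Union>z\<in>K. cball z r)" if "?F x \<noteq> 0" for x
  proof (rule ccontr)
    assume x: "x \<notin> (\<Union>z\<in>K. cball z r)"
    have "\<eta> (y - x) = 0" if "y \<in> S" for y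
      using \<eta>[of "y - x"] x K(2) that by (auto simp: dist_norm)
    then have "?F x = (LINT y|lebesgue_on S. 0)"
      by (intro Bochner_Integration.integral_cong) auto
    then show False using that by simp
  qed
  then show sub: "supp ?F \<subseteq> (\<Union>z\<in>K. cball z r)"
    unfolding supp_def by (intro closure_minimal compact_imp_closed[OF cpt]) blast
  show "compact (supp ?F)"
    using bounded_subset[OF compact_imp_bounded[OF cpt] sub] by (simp add: compact_eq_bounded_closed supp_def)
qed

text \<open>The box is symmetric about the origin, so the product bump is even. Evenness allows x
  and y to be exchanged when the kernel is moved from the indicator to the vector field.\<close>

lemma even_mollifier:
  fixes r :: real
  assumes "r > 0"
  obtains \<eta> :: "'a::euclidean_space \<Rightarrow> real" where "C_diff 1 \<eta>" "compact (supp \<eta>)" "\<And>z. 0 \<le> \<eta> z"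
    "\<And>z. \<eta> (- z) = \<eta> z" "\<And>z. \<eta> z \<noteq> 0 \<Longrightarrow> norm z \<le> r" "(LINT z|lebesgue. \<eta> z) = 1"
proof -
  obtain e where e: "e > 0" "cbox (0 - e *\<^sub>R One) (0 + e *\<^sub>R One) \<subseteq> cball (0::'a) r"
      "box (0 - e *\<^sub>R One) (0 + e *\<^sub>R One) \<noteq> ({} :: 'a set)"
    using small_cbox[OF assms] by blast
  define b where "b = e *\<^sub>R (One :: 'a)"
  define \<beta> where "\<beta> = bump (- b) b 0"
  define I where "I = (LINT z|lebesgue. \<beta> z)"
  have I: "I > 0" unfolding I_def \<beta>_def by (rule test_function_bump_integral_pos) (use e in \<open>simp add: b_def\<close>)
  let ?\<eta> = "\<lambda>z. (1 / I) * \<beta> z"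
  show ?thesis
  proof (rule that[of ?\<eta>])
    show "C_diff 1 ?\<eta>" unfolding \<beta>_def by (intro C_diff_mult C_diff_const C_diff_bump)
    have "supp ?\<eta> = supp \<beta>" using I by (simp add: supp_def)
    then show "compact (supp ?\<eta>)" by (simp add: \<beta>_def compact_supp_bump)
    show "0 \<le> ?\<eta> z" for z using I by (simp add: \<beta>_def bump_nonneg)
    have "\<beta> (- z) = \<beta> z" for z
      unfolding \<beta>_def bump_def by (simp add: mult.commute add.commute)
    then show "?\<eta> (- z) = ?\<eta> z" for z by simp
    show "norm z \<le> r" if "?\<eta> z \<noteq> 0" for z
    proof -
      have "z \<in> box (- b) b" using that bump_eq_0[of z "- b" b 0] by (auto simp: \<beta>_def)
      then show ?thesis using e(2) box_subset_cbox[of "- b" b] by (auto simp: b_def)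
    qed
    show "(LINT z|lebesgue. ?\<eta> z) = 1" using I by (simp add: I_def[symmetric])
  qed
qed

lemma grad_odd_if_even:
  fixes \<eta> :: "'a::euclidean_space \<Rightarrow> real"
  assumes \<eta>: "C_diff 1 \<eta>" "\<And>z. \<eta> (- z) = \<eta> z"
  shows "grad \<eta> (- z) = - grad \<eta> z"
proof -
  have "((\<lambda>z. \<eta> (- z)) has_derivative (\<lambda>h. grad \<eta> (- z) \<bullet> (- h))) (at z)"
  proof (rule has_derivative_compose[OF _ grad_has_derivative[OF \<eta>(1)]])
    show "(uminus has_derivative uminus) (at z)" by (auto intro!: derivative_eq_intros)
  qed
  then have "(\<eta> has_derivative (\<lambda>h. (- grad \<eta> (- z)) \<bullet> h)) (at z)"
    by (simp add: \<eta>(2))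
  then show ?thesis using grad_eqI by fastforce
qed

text \<open>Fubini is used on the product of Borel spaces, whereas \<open>S\<close> is only Lebesgue
  measurable. One Borel part of full measure serves all Borel integrands.\<close>

lemma integral_lebesgue_on_borel_part:
  fixes S :: "'a::euclidean_space set"
  assumes S: "S \<in> sets lebesgue"
  obtains S' where "S' \<in> sets borel" "S' \<subseteq> S"
    "\<And>h :: 'a \<Rightarrow> real. h \<in> borel_measurable borel \<Longrightarrow> (LINT x|lebesgue_on S. h x) = (LINT x|lborel. indicator S' x *\<^sub>R h x)"
proof -
  obtain S' N N' where SN: "S = S' \<union> N" "N \<subseteq> N'" "N' \<in> null_sets lborel" "S' \<in> sets lborel"
    using sets_completionE[OF S] by blast
  have "N' \<in> null_sets lebesgue" using SN(3) by (rule null_sets_completionI)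
  then have ae: "AE x in lebesgue. x \<notin> N'" by (rule AE_not_in)
  show ?thesis
  proof (rule that[of S'])
    fix h :: "'a \<Rightarrow> real" assume h: "h \<in> borel_measurable borel"
    then have hl: "h \<in> borel_measurable lebesgue" by (simp add: measurable_completion)
    have S'l: "S' \<in> sets lebesgue" using SN(4) by simp
    have "(LINT x|lebesgue_on S. h x) = (LINT x|lebesgue. indicator S x *\<^sub>R h x)"
      using S by (simp add: integral_restrict_space)
    also have "\<dots> = (LINT x|lebesgue. indicator S' x *\<^sub>R h x)"
    proof (rule integral_cong_AE)
      show "AE x in lebesgue. indicator S x *\<^sub>R h x = indicator S' x *\<^sub>R h x"
        using ae by eventually_elim (use SN in \<open>auto simp: indicator_def\<close>)
    qed (use S S'l hl in \<open>auto intro!: borel_measurable_scaleR borel_measurable_indicator\<close>)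
    also have "\<dots> = (LINT x|lborel. indicator S' x *\<^sub>R h x)"
      by (rule integral_completion) (use SN(4) h in \<open>auto intro!: borel_measurable_scaleR borel_measurable_indicator\<close>)
    finally show "(LINT x|lebesgue_on S. h x) = (LINT x|lborel. indicator S' x *\<^sub>R h x)" .
  qed (use SN in auto)
qed

text \<open>A bounded function that vanishes off a rectangle of finite measure is integrable on the
  product.\<close>

lemma lborel_Fubini_bounded:
  fixes Q :: "'a::euclidean_space \<Rightarrow> 'b::euclidean_space \<Rightarrow> real"
  assumes Q: "(\<lambda>(x, y). Q x y) \<in> borel_measurable (borel \<Otimes>\<^sub>M borel)" "\<And>x y. \<bar>Q x y\<bar> \<le> B"
    and out: "\<And>x y. x \<notin> K \<or> y \<notin> S \<Longrightarrow> Q x y = 0"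
    and K: "K \<in> sets borel" "emeasure lborel K < \<infinity>" and S: "S \<in> sets borel" "emeasure lborel S < \<infinity>"
  shows "(LINT x|lborel. LINT y|lborel. Q x y) = (LINT y|lborel. LINT x|lborel. Q x y)"
proof -
  have "integrable (lborel \<Otimes>\<^sub>M lborel) (\<lambda>z. B * indicator (K \<times> S) z)"
  proof (intro integrable_mult_right integrable_real_indicator)
    show "K \<times> S \<in> sets (lborel \<Otimes>\<^sub>M lborel)" using K S by auto
    show "emeasure (lborel \<Otimes>\<^sub>M lborel) (K \<times> S) < \<infinity>"
      using K S by (simp add: lborel.emeasure_pair_measure_Times ennreal_mult_less_top)
  qed
  then have "integrable (lborel \<Otimes>\<^sub>M lborel) (\<lambda>(x, y). Q x y)"
  proof (rule Bochner_Integration.integrable_bound)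
    have "sets (lborel \<Otimes>\<^sub>M lborel) = sets (borel \<Otimes>\<^sub>M (borel :: 'b measure))"
      by (rule sets_pair_measure_cong) auto
    then show "(\<lambda>(x, y). Q x y) \<in> borel_measurable (lborel \<Otimes>\<^sub>M lborel)"
      using Q(1) measurable_cong_sets by blast
    have "\<bar>Q x y\<bar> \<le> \<bar>B * indicator (K \<times> S) (x, y)\<bar>" for x y
      using Q(2)[of x y] out[of x y] by (cases "x \<in> K \<and> y \<in> S") (auto simp: indicator_def)
    then show "AE z in lborel \<Otimes>\<^sub>M lborel. norm (case z of (x, y) \<Rightarrow> Q x y) \<le> norm (B * indicator (K \<times> S) z)"
      by (intro AE_I2) (auto split: prod.splits)
  qed
  then show ?thesis by (rule lborel_pair.Fubini_integral[symmetric])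
qed

lemma perimeter_nonneg: "0 \<le> perimeter (S :: 'a::euclidean_space set)"
  unfolding perimeter_def
proof (rule SUP_upper2)
  let ?T = "\<lambda>x :: 'a. 0 :: 'a"
  show "?T \<in> {T. C_diff 1 T \<and> compact (supp T) \<and> (\<forall>x. norm (T x) \<le> 1)}"
    using C_diff_const[of 1 "0 :: 'a"] by (simp add: supp_def)
  have "divergence ?T x = 0" for x by (simp add: divergence_def)
  then show "0 \<le> ereal (LINT x|lebesgue_on S. divergence ?T x)" by simp
qed

text \<open>
  The total variation of the mollified indicator function is tested with the normalized gradient;
  moving the mollifier onto that field produces an admissible field for the perimeter.
\<close>
lemma mollified_indicator:
  fixes \<Omega> S :: "'a::euclidean_space set"
  assumes \<Omega>: "open \<Omega>" and S: "S \<in> sets lebesgue" "compact (closure S)" "closure S \<subseteq> \<Omega>"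
  obtains \<psi> where "C_diff 1 \<psi>" "compact (supp \<psi>)" "supp \<psi> \<subseteq> \<Omega>"
    "(LINT x|lebesgue_on \<Omega>. \<psi> x) = measure lebesgue S"
    "ereal (LINT x|lebesgue_on \<Omega>. norm (grad \<psi> x)) \<le> perimeter S"
proof -
  have \<Omega>m: "\<Omega> \<in> sets lebesgue" using \<Omega> by auto
  obtain r where r: "r > 0" "(\<Union>z\<in>closure S. cball z r) \<subseteq> \<Omega>"
    by (rule compact_subset_open_imp_cball_epsilon_subset[OF S(2) \<Omega> S(3)])
  obtain \<eta> :: "'a \<Rightarrow> real" where \<eta>: "C_diff 1 \<eta>" "compact (supp \<eta>)" and \<eta>0: "\<And>z. 0 \<le> \<eta> z"
    and \<eta>even: "\<And>z. \<eta> (- z) = \<eta> z" and \<eta>r: "\<And>z. \<eta> z \<noteq> 0 \<Longrightarrow> norm z \<le> r" and \<eta>1: "(LINT z|lebesgue. \<eta> z) = 1"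
    using even_mollifier[OF r(1)] by blast
  obtain B where B: "B > 0" "\<And>x. \<bar>\<eta> x\<bar> \<le> B" "\<And>x. norm (grad \<eta> x) \<le> B" using C1c_bounds[OF \<eta>] by metis
  have \<eta>m [measurable]: "\<eta> \<in> borel_measurable borel"
    by (rule borel_measurable_continuous_onI[OF C_diff_continuous[OF \<eta>(1)]])
  have g\<eta>m [measurable]: "grad \<eta> \<in> borel_measurable borel"
    by (rule borel_measurable_continuous_onI[OF grad_continuous[OF \<eta>(1)]])
  have "bounded S" by (rule bounded_subset[OF compact_imp_bounded[OF S(2)] closure_subset])
  then have Slm: "S \<in> lmeasurable" using S(1) by (simp add: bounded_set_imp_lmeasurable)
  interpret finite_measure "lebesgue_on S" by (rule finite_measure_lebesgue_on[OF Slm])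
  have one: "integrable (lebesgue_on S) (\<lambda>y. 1::real)" by simp
  define \<psi> where "\<psi> x = (LINT y|lebesgue_on S. \<eta> (y - x) *\<^sub>R (1::real))" for x
  have \<psi>: "C_diff 1 \<psi>" unfolding \<psi>_def by (rule correlation_C_diff_1[OF S(1) one \<eta>])
  have sub: "supp \<psi> \<subseteq> (\<Union>z\<in>closure S. cball z r)" and cpt: "compact (supp \<psi>)"
    unfolding \<psi>_def by (rule supp_correlation_compact[OF S(2) closure_subset \<eta>r], assumption)+
  have \<psi>\<Omega>: "supp \<psi> \<subseteq> \<Omega>" using sub r(2) by blast
  \<comment> \<open>A compact neighbourhood of width \<open>r\<close> containing the support of
    \<psi>; all integrals in x can run over it instead of \<Omega>.\<close>
  define K where "K = (\<Union>z\<in>closure S. cball z r)"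
  have Kc: "compact K" unfolding K_def by (rule compact_minkowski_sum_cball[OF S(2)])
  have Kb: "K \<in> sets borel" "K \<in> sets lebesgue" "emeasure lborel K < \<infinity>"
    using borel_compact[OF Kc] fmeasurableD[OF lmeasurable_compact[OF Kc]]
      emeasure_bounded_finite[OF compact_imp_bounded[OF Kc]] by auto
  obtain S' where S': "S' \<in> sets borel" "S' \<subseteq> S" and S'int: "\<And>h :: 'a \<Rightarrow> real. h \<in> borel_measurable borel \<Longrightarrow>
      (LINT x|lebesgue_on S. h x) = (LINT x|lborel. indicator S' x *\<^sub>R h x)"
    using integral_lebesgue_on_borel_part[OF S(1)] by blast
  have S'f: "emeasure lborel S' < \<infinity>"
    using emeasure_bounded_finite[OF bounded_subset[OF \<open>bounded S\<close> S'(2)]] by simp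
  note [measurable] = S'(1) Kb(1)
  have Kint: "(LINT x|lebesgue_on K. h x) = (LINT x|lborel. indicator K x *\<^sub>R h x)"
    if h: "h \<in> borel_measurable borel" for h :: "'a \<Rightarrow> real"
  proof -
    have "(LINT x|lebesgue_on K. h x) = (LINT x|lebesgue. indicator K x *\<^sub>R h x)"
      using Kb(2) by (simp add: integral_restrict_space)
    also have "\<dots> = (LINT x|lborel. indicator K x *\<^sub>R h x)"
      by (rule integral_completion) (use h in measurable)
    finally show ?thesis .
  qed
  have \<psi>K: "\<psi> x = 0" "grad \<psi> x = 0" if "x \<notin> K" for x
  proof -
    have "x \<notin> supp \<psi>" by (rule contra_subsetD[OF sub that[unfolded K_def]])
    then show "\<psi> x = 0" "grad \<psi> x = 0" by (rule supp_eq_0, rule grad_eq_0)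
  qed
  have \<Omega>K: "(LINT x|lebesgue_on \<Omega>. h x) = (LINT x|lebesgue_on K. h x)" if "\<And>x. x \<notin> K \<Longrightarrow> h x = 0" for h :: "'a \<Rightarrow> real"
    using integral_lebesgue_on_eq[OF \<Omega>m, of h] integral_lebesgue_on_eq[OF Kb(2), of h] that r(2)
    by (auto simp: K_def[symmetric])
  have g\<psi>: "grad \<psi> x \<bullet> h = - (LINT y|lebesgue_on S. grad \<eta> (y - x) \<bullet> h)" for x h
  proof -
    have "(\<psi> has_derivative (\<lambda>h. - (LINT y|lebesgue_on S. (grad \<eta> (y - x) \<bullet> h) *\<^sub>R (1::real)))) (at x)"
      unfolding \<psi>_def by (rule correlation_has_derivative[OF S(1) one \<eta>])
    then have "(\<lambda>h. grad \<psi> x \<bullet> h) = (\<lambda>h. - (LINT y|lebesgue_on S. (grad \<eta> (y - x) \<bullet> h) *\<^sub>R (1::real)))"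
      by (rule has_derivative_unique[OF grad_has_derivative[OF \<psi>]])
    then show ?thesis by (simp add: fun_eq_iff)
  qed
  \<comment> \<open>Pairing with this field returns the length of the gradient. As
    \<open>sgn 0 = 0\<close>, the field is defined everywhere and vanishes off
    \<open>K\<close>.\<close>
  define U where "U x = sgn (grad \<psi> x)" for x
  have U1: "norm (U x) \<le> 1" for x by (simp add: U_def norm_sgn)
  have UK: "U x = 0" if "x \<notin> K" for x using \<psi>K(2)[OF that] by (simp add: U_def)
  have g\<psi>m [measurable]: "grad \<psi> \<in> borel_measurable borel"
    by (rule borel_measurable_continuous_onI[OF grad_continuous[OF \<psi>]])
  have Um [measurable]: "U \<in> borel_measurable borel" unfolding U_def[abs_def] sgn_div_norm by measurable
  interpret K: finite_measure "lebesgue_on K"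
    by (rule finite_measure_lebesgue_on[OF lmeasurable_compact[OF Kc]])
  have Ui: "integrable (lebesgue_on K) U"
    by (rule K.integrable_const_bound[where B=1])
       (use U1 Um in \<open>auto intro!: measurable_restrict_space1 measurable_completion\<close>)
  \<comment> \<open>The minus sign offsets the one from differentiating the kernel, so the
    divergence of \<open>T\<close> appears with the sign required by the perimeter.\<close>
  define T where "T y = - (LINT x|lebesgue_on K. \<eta> (x - y) *\<^sub>R U x)" for y
  have T: "C_diff 1 T" "compact (supp T)"
  proof -
    have mU: "integrable (lebesgue_on K) (\<lambda>x. - U x)" using Ui by simp
    have eq: "T = (\<lambda>y. LINT x|lebesgue_on K. \<eta> (x - y) *\<^sub>R - U x)"
      by (simp add: T_def fun_eq_iff)
    show "C_diff 1 T" unfolding eq by (rule correlation_C_diff_1[OF Kb(2) mU \<eta>])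
    show "compact (supp T)" unfolding eq
      by (rule supp_correlation_compact(2)[where K=K and r=r]) (use Kc \<eta>r in auto)
  qed
  \<comment> \<open>An average of vectors of length at most 1 against a nonnegative kernel of mass
    1.\<close>
  have T1: "norm (T y) \<le> 1" for y
  proof -
    have mi: "integrable lebesgue (\<lambda>x. \<eta> (x - y))"
    proof (rule integrable_continuous_compact_supp[of _ "cball y r"])
      show "continuous_on UNIV (\<lambda>x. \<eta> (x - y))"
        by (intro continuous_on_compose2[OF C_diff_continuous[OF \<eta>(1)]]) (auto intro!: continuous_intros)
      show "\<eta> (x - y) = 0" if "x \<notin> cball y r" for x
        using \<eta>r[of "x - y"] that by (auto simp: dist_norm norm_minus_commute)
    qed simp
    have iK: "integrable (lebesgue_on K) (\<lambda>x. \<eta> (x - y))"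
      using integrable_mult_indicator[OF Kb(2) mi] Kb(2) by (simp add: integrable_restrict_space)
    have "norm (T y) = norm (LINT x|lebesgue_on K. \<eta> (x - y) *\<^sub>R U x)" by (simp add: T_def)
    also have "\<dots> \<le> (LINT x|lebesgue_on K. \<eta> (x - y))"
    proof (rule Bochner_Integration.integral_norm_bound_integral[OF _ iK])
      show "integrable (lebesgue_on K) (\<lambda>x. \<eta> (x - y) *\<^sub>R U x)"
        by (rule integrable_bounded_scaleR[OF Ui, where B=B])
           (use iK B(2) in auto)
      show "norm (\<eta> (x - y) *\<^sub>R U x) \<le> \<eta> (x - y)" for x
        using mult_left_mono[OF U1[of x] \<eta>0[of "x - y"]] \<eta>0[of "x - y"] by simp
    qed
    also have "\<dots> = (LINT x|lebesgue. indicator K x *\<^sub>R \<eta> (x - y))"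
      using Kb(2) by (simp add: integral_restrict_space)
    also have "\<dots> \<le> (LINT x|lebesgue. \<eta> (x - y))"
      by (rule integral_mono[OF integrable_mult_indicator[OF Kb(2) mi] mi])
         (use \<eta>0 in \<open>auto simp: indicator_def\<close>)
    also have "\<dots> = 1" using integral_lebesgue_translate[OF \<eta>m, of "- y"] \<eta>1 by simp
    finally show ?thesis .
  qed
  have divT: "divergence T y = (LINT x|lebesgue_on K. grad \<eta> (x - y) \<bullet> U x)" for y
  proof -
    have "(T has_derivative (\<lambda>h. - (- (LINT x|lebesgue_on K. (grad \<eta> (x - y) \<bullet> h) *\<^sub>R U x)))) (at y)"
      unfolding T_def by (rule has_derivative_minus[OF correlation_has_derivative[OF Kb(2) Ui \<eta>]])
    then have "frechet_derivative T (at y) = (\<lambda>h. LINT x|lebesgue_on K. (grad \<eta> (x - y) \<bullet> h) *\<^sub>R U x)"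
      using frechet_derivative_at by fastforce
    moreover have int: "integrable (lebesgue_on K) (\<lambda>x. (grad \<eta> (x - y) \<bullet> i) *\<^sub>R U x)"
      "integrable (lebesgue_on K) (\<lambda>x. (grad \<eta> (x - y) \<bullet> i) * (U x \<bullet> i))" for i
    proof -
      have "\<bar>grad \<eta> (x - y) \<bullet> i\<bar> \<le> B * norm i" for x
        using Cauchy_Schwarz_ineq2[of "grad \<eta> (x - y)" i] mult_right_mono[OF B(3)[of "x - y"] norm_ge_zero[of i]] by simp
      then show *: "integrable (lebesgue_on K) (\<lambda>x. (grad \<eta> (x - y) \<bullet> i) *\<^sub>R U x)"
        by (intro integrable_bounded_scaleR[OF Ui, where B="B * norm i"] continuous_borel_measurable_lebesgue_on
            continuous_on_inner continuous_on_compose2[OF grad_continuous[OF \<eta>(1)]] AE_I2)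
           (auto intro!: continuous_intros)
      show "integrable (lebesgue_on K) (\<lambda>x. (grad \<eta> (x - y) \<bullet> i) * (U x \<bullet> i))"
        using integrable_inner_left[of i, OF *] by simp
    qed
    ultimately have "divergence T y = (\<Sum>i\<in>Basis. (LINT x|lebesgue_on K. (grad \<eta> (x - y) \<bullet> i) *\<^sub>R U x) \<bullet> i)"
      by (simp add: divergence_def)
    also have "\<dots> = (\<Sum>i\<in>Basis. LINT x|lebesgue_on K. (grad \<eta> (x - y) \<bullet> i) * (U x \<bullet> i))"
    proof (intro sum.cong refl)
      fix i :: 'a assume i: "i \<in> Basis"
      show "(LINT x|lebesgue_on K. (grad \<eta> (x - y) \<bullet> i) *\<^sub>R U x) \<bullet> i = (LINT x|lebesgue_on K. (grad \<eta> (x - y) \<bullet> i) * (U x \<bullet> i))"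
        by (subst integral_inner_left[symmetric]) (use int(1)[of i] in auto)
    qed
    also have "\<dots> = (LINT x|lebesgue_on K. (\<Sum>i\<in>Basis. (grad \<eta> (x - y) \<bullet> i) * (U x \<bullet> i)))"
      by (subst Bochner_Integration.integral_sum) (use int(2) in auto)
    also have "\<dots> = (LINT x|lebesgue_on K. grad \<eta> (x - y) \<bullet> U x)"
      by (simp add: euclidean_inner[symmetric])
    finally show ?thesis .
  qed
  have bound: "\<bar>grad \<eta> (y - x) \<bullet> U x\<bar> \<le> B" for x y
    using Cauchy_Schwarz_ineq2[of "grad \<eta> (y - x)" "U x"] mult_mono[OF B(3)[of "y - x"] U1[of x]] B(1) by simp
  show ?thesis
  proof (rule that[OF \<psi> cpt \<psi>\<Omega>])
    have "(LINT x|lebesgue_on \<Omega>. \<psi> x) = (LINT x|lborel. indicator K x *\<^sub>R \<psi> x)"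
      using \<Omega>K[of \<psi>] \<psi>K(1) Kint[OF borel_measurable_continuous_onI[OF C_diff_continuous[OF \<psi>]]] by simp
    also have "\<dots> = (LINT x|lborel. LINT y|lborel. indicator K x * (indicator S' y * \<eta> (y - x)))"
      by (simp add: \<psi>_def S'int)
    also have "\<dots> = (LINT y|lborel. LINT x|lborel. indicator K x * (indicator S' y * \<eta> (y - x)))"
    proof (rule lborel_Fubini_bounded[where B=B and K=K and S=S'])
      show "\<bar>indicator K x * (indicator S' y * \<eta> (y - x))\<bar> \<le> B" for x y
        using B(1,2) by (auto simp: indicator_def less_imp_le)
    qed (use Kb S' S'f in \<open>auto simp: indicator_def\<close>)
    also have "\<dots> = (LINT y|lborel. indicator S' y *\<^sub>R (1 :: real))"
    proof (intro Bochner_Integration.integral_cong refl)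
      fix y
      show "(LINT x|lborel. indicator K x * (indicator S' y * \<eta> (y - x))) = indicator S' y *\<^sub>R 1"
      proof (cases "y \<in> S'")
        case True
        have "indicator K x * (indicator S' y * \<eta> (y - x)) = \<eta> (x + - y)" for x
        proof (cases "x \<in> K")
          case False
          have "y \<in> closure S" using True S'(2) closure_subset by blast
          then have "\<not> norm (x + - y) \<le> r" using False by (auto simp: K_def dist_norm norm_minus_commute)
          then show ?thesis using \<eta>r[of "x + - y"] False by auto
        qed (use True \<eta>even[of "x - y"] in simp)
        then have "(LINT x|lborel. indicator K x * (indicator S' y * \<eta> (y - x))) = (LINT x|lborel. \<eta> (x + - y))"
          by simp
        also have "\<dots> = 1"
          using integral_lebesgue_translate[OF \<eta>m, of "- y"] \<eta>1 by (simp add: integral_completion)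
        finally show ?thesis using True by simp
      qed simp
    qed
    also have "\<dots> = (LINT y|lebesgue_on S. 1)" by (rule S'int[of "\<lambda>_. 1", symmetric]) simp
    also have "\<dots> = measure lebesgue S" using S(1) by (simp add: measure_restrict_space)
    finally show "(LINT x|lebesgue_on \<Omega>. \<psi> x) = measure lebesgue S" .
    have "(LINT x|lebesgue_on \<Omega>. norm (grad \<psi> x)) = (LINT x|lebesgue_on K. grad \<psi> x \<bullet> U x)"
    proof -
      have "z \<bullet> sgn z = norm z" for z :: 'a
        by (cases "z = 0") (simp_all add: sgn_div_norm dot_square_norm power2_eq_square)
      then show ?thesis using \<Omega>K[of "\<lambda>x. norm (grad \<psi> x)"] \<psi>K(2) by (simp add: U_def)
    qed
    also have "\<dots> = (LINT x|lborel. indicator K x *\<^sub>R (grad \<psi> x \<bullet> U x))" by (rule Kint) measurable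
    also have "\<dots> = (LINT x|lborel. LINT y|lborel. indicator K x * (indicator S' y * (- (grad \<eta> (y - x) \<bullet> U x))))"
      by (simp add: g\<psi> S'int)
    also have "\<dots> = (LINT y|lborel. LINT x|lborel. indicator K x * (indicator S' y * (- (grad \<eta> (y - x) \<bullet> U x))))"
    proof (rule lborel_Fubini_bounded[where B=B and K=K and S=S'])
      show "\<bar>indicator K x * (indicator S' y * (- (grad \<eta> (y - x) \<bullet> U x)))\<bar> \<le> B" for x y
        using B(1) bound[of y x] by (auto simp: indicator_def less_imp_le)
    qed (use Kb S' S'f in \<open>auto simp: indicator_def\<close>)
    also have "\<dots> = (LINT y|lborel. indicator S' y *\<^sub>R divergence T y)"
    proof (intro Bochner_Integration.integral_cong refl)
      fix y
      \<comment> \<open>The gradient of an even function is odd; this turns the derivative of \<psi>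
        into the divergence of \<open>T\<close>.\<close>
      have "- (grad \<eta> (y - x) \<bullet> U x) = grad \<eta> (x - y) \<bullet> U x" for x
        using grad_odd_if_even[OF \<eta>(1) \<eta>even, of "x - y"] by simp
      then have "(LINT x|lborel. indicator K x * (indicator S' y * (- (grad \<eta> (y - x) \<bullet> U x)))) =
        (LINT x|lborel. indicator S' y * (indicator K x *\<^sub>R (grad \<eta> (x - y) \<bullet> U x)))"
        by (simp add: mult_ac)
      also have "\<dots> = indicator S' y * (LINT x|lebesgue_on K. grad \<eta> (x - y) \<bullet> U x)"
        by (subst Kint) auto
      finally show "(LINT x|lborel. indicator K x * (indicator S' y * (- (grad \<eta> (y - x) \<bullet> U x)))) = indicator S' y *\<^sub>R divergence T y"
        by (simp add: divT)
    qed
    also have "\<dots> = (LINT y|lebesgue_on S. divergence T y)"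
    proof (rule S'int[symmetric])
      have "continuous_on UNIV (divergence T)"
        unfolding divergence_def using T(1) by (auto intro!: continuous_intros)
      then show "divergence T \<in> borel_measurable borel" by (rule borel_measurable_continuous_onI)
    qed
    finally have "ereal (LINT x|lebesgue_on \<Omega>. norm (grad \<psi> x)) = ereal (LINT y|lebesgue_on S. divergence T y)"
      by simp
    also have "\<dots> \<le> perimeter S"
      unfolding perimeter_def by (rule SUP_upper) (use T T1 in auto)
    finally show "ereal (LINT x|lebesgue_on \<Omega>. norm (grad \<psi> x)) \<le> perimeter S" .
  qed
qed

section \<open>Test functions for the two kinds of data\<close>

context energy_problem
begin

lemma less_divide_if_Lambda_mult_less:
  assumes "Lambda a \<sigma> * x < ereal y"
  shows "x < ereal (y / L)"
proof (rule ccontr)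
  assume "\<not> x < ereal (y / L)"
  then have "ereal L * ereal (y / L) \<le> ereal L * x"
    using L_pos by (intro ereal_mult_left_mono) auto
  then show False using assms L_pos by (simp add: Lambda_eq)
qed

lemma cheeger_test_function:
  assumes less: "Lambda a \<sigma> * cheeger \<Omega> < ereal \<bar>l\<bar>"
  obtains \<psi> where "C_diff 1 \<psi>" "compact (supp \<psi>)" "supp \<psi> \<subseteq> \<Omega>"
    "L * (LINT x|M. norm (grad \<psi> x)) < (LINT x|M. l * \<psi> x)"
proof -
  obtain S where S: "S \<in> sets lebesgue" "compact (closure S)" "closure S \<subseteq> \<Omega>"
      "0 < emeasure lebesgue S" "emeasure lebesgue S < \<infinity>" "perimeter S < \<infinity>"
    and q: "perimeter S / ereal (measure lebesgue S) < ereal (\<bar>l\<bar> / L)"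
    using less_divide_if_Lambda_mult_less[OF less] unfolding cheeger_def INF_less_iff by blast
  have S0: "0 < measure lebesgue S" using S(4,5) by (simp add: measure_def enn2real_positive_iff)
  obtain p where p: "perimeter S = ereal p" "0 \<le> p"
    using S(6) perimeter_nonneg[of S] by (cases "perimeter S") auto
  have "p / measure lebesgue S < \<bar>l\<bar> / L" using q p S0 by simp
  then have pl: "L * p < \<bar>l\<bar> * measure lebesgue S" using L_pos S0 by (simp add: field_simps)
  obtain \<psi> where \<psi>: "C_diff 1 \<psi>" "compact (supp \<psi>)" "supp \<psi> \<subseteq> \<Omega>"
    and int: "(LINT x|M. \<psi> x) = measure lebesgue S" and gp: "(LINT x|M. norm (grad \<psi> x)) \<le> p"
    using mollified_indicator[OF \<Omega>_open S(1-3)] p(1) by (metis ereal_less_eq(3))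
  \<comment> \<open>The sign of \<open>l\<close> makes the pairing with the datum positive for
    negative constants too.\<close>
  let ?\<psi> = "\<lambda>x. sgn l * \<psi> x"
  have sub: "supp ?\<psi> \<subseteq> supp \<psi>" unfolding supp_def by (rule closure_mono) auto
  show ?thesis
  proof (rule that[of ?\<psi>])
    show "C_diff 1 ?\<psi>" by (intro C_diff_mult C_diff_const \<psi>)
    show "compact (supp ?\<psi>)"
      using bounded_subset[OF compact_imp_bounded[OF \<psi>(2)] sub] by (simp add: compact_eq_bounded_closed supp_def)
    show "supp ?\<psi> \<subseteq> \<Omega>" using sub \<psi>(3) by simp
    have "grad ?\<psi> x = sgn l *\<^sub>R grad \<psi> x" for x
    proof (rule grad_eqI)
      show "(?\<psi> has_derivative (\<lambda>h. (sgn l *\<^sub>R grad \<psi> x) \<bullet> h)) (at x)"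
        using has_derivative_mult_right[OF grad_has_derivative[OF \<psi>(1)], of "sgn l" x] by simp
    qed
    then have "norm (grad ?\<psi> x) \<le> norm (grad \<psi> x)" for x by (simp add: sgn_if)
    then have "(LINT x|M. norm (grad ?\<psi> x)) \<le> (LINT x|M. norm (grad \<psi> x))"
      by (intro integral_mono grad_norm_integrable \<psi> \<open>C_diff 1 ?\<psi>\<close> \<open>compact (supp ?\<psi>)\<close>)
    then have "L * (LINT x|M. norm (grad ?\<psi> x)) \<le> L * p" using gp L_pos by simp
    also note pl
    also have "\<bar>l\<bar> * measure lebesgue S = (LINT x|M. l * ?\<psi> x)"
      by (simp add: int[symmetric] mult.assoc[symmetric] abs_sgn)
    finally show "L * (LINT x|M. norm (grad ?\<psi> x)) < (LINT x|M. l * ?\<psi> x)" .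
  qed
qed

lemma Lambda_f_test_function:
  assumes less: "Lambda_f a \<sigma> \<Omega> f < ereal \<mu>"
  obtains \<psi> where "C_diff 1 \<psi>" "compact (supp \<psi>)" "supp \<psi> \<subseteq> \<Omega>"
    "L * (LINT x|M. norm (grad \<psi> x)) < (LINT x|M. \<mu> * f x * \<psi> x)"
proof -
  obtain \<psi> where \<psi>: "\<psi> \<in> test_functions \<Omega>" "0 < (LINT x|M. f x * \<psi> x)"
    "ereal ((LINT x|M. norm (grad \<psi> x)) / (LINT x|M. f x * \<psi> x)) < ereal (\<mu> / L)"
    using less_divide_if_Lambda_mult_less[OF less[unfolded Lambda_f_def]] unfolding INF_less_iff by blast
  then have "L * (LINT x|M. norm (grad \<psi> x)) < \<mu> * (LINT x|M. f x * \<psi> x)"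
    using L_pos by (simp add: field_simps)
  also have "\<dots> = (LINT x|M. \<mu> * f x * \<psi> x)" by (simp add: mult.assoc)
  finally show ?thesis using that test_functions_C1c[OF \<psi>(1)] by blast
qed

end

section \<open>Boundary data and the conclusion\<close>

lemma lipschitz_on_if_lip_seminorm_le:
  assumes "lip_seminorm S g \<le> ereal \<sigma>" "0 \<le> \<sigma>"
  shows "\<sigma>-lipschitz_on S g"
proof (rule lipschitz_onI[OF _ assms(2)])
  fix x y assume xy: "x \<in> S" "y \<in> S"
  show "dist (g x) (g y) \<le> \<sigma> * dist x y"
  proof (cases "x = y")
    case False
    then have "ereal (\<bar>g x - g y\<bar> / dist x y) \<le> lip_seminorm S g"
      unfolding lip_seminorm_def using xy by (intro SUP_upper2[of "(x, y)"]) auto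
    then have "ereal (\<bar>g x - g y\<bar> / dist x y) \<le> ereal \<sigma>" using assms(1) by (rule order_trans)
    then show ?thesis using False by (simp add: dist_real_def divide_le_eq)
  qed simp
qed

theorem corollary5p2:
  fixes \<Omega> :: "'a::euclidean_space set" and a :: "nat \<Rightarrow> real" and \<sigma> :: real
  assumes "open \<Omega>" and "connected \<Omega>" and "bounded \<Omega>" and "\<Omega> \<noteq> {}" and "lipschitz_boundary \<Omega>"
    and "\<And>p. p \<ge> 2 \<Longrightarrow> a p \<ge> 0" and "a 2 > 0" and "infinite {p. p \<ge> 2 \<and> a p \<noteq> 0}"
    and "0 < \<sigma>" and "1 / ereal \<sigma> = limsup (\<lambda>p. ereal (root p (a p)))"
    and "Lambda a \<sigma> < \<infinity>"
  shows
    "(\<forall>l::real. Lambda a \<sigma> * cheeger \<Omega> < ereal \<bar>l\<bar> \<longrightarrow>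
        (\<forall>g. lipschitz_fun_on (frontier \<Omega>) g \<longrightarrow> \<not> (\<exists>u. weak_solution a \<sigma> \<Omega> g (\<lambda>x. l) u)))
   \<and> (\<forall>f. integrable (lebesgue_on \<Omega>) f \<and> (AE x in lebesgue_on \<Omega>. 0 \<le> f x) \<and>
          \<not> (AE x in lebesgue_on \<Omega>. f x = 0) \<longrightarrow>
        (\<forall>\<mu>::real. Lambda_f a \<sigma> \<Omega> f < ereal \<mu> \<longrightarrow>
          (\<forall>g. lipschitz_fun_on (frontier \<Omega>) g \<longrightarrow> \<not> (\<exists>u. weak_solution a \<sigma> \<Omega> g (\<lambda>x. \<mu> * f x) u))))
   \<and> (\<forall>f0. (\<exists>l::real. Lambda a \<sigma> * cheeger \<Omega> < ereal \<bar>l\<bar> \<and> f0 = (\<lambda>x. l)) \<or>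
           (\<exists>f \<mu>. integrable (lebesgue_on \<Omega>) f \<and> (AE x in lebesgue_on \<Omega>. 0 \<le> f x) \<and>
              \<not> (AE x in lebesgue_on \<Omega>. f x = 0) \<and>
              Lambda_f a \<sigma> \<Omega> f < ereal \<mu> \<and> f0 = (\<lambda>x. \<mu> * f x)) \<longrightarrow>
        (\<forall>g. lipschitz_fun_on (frontier \<Omega>) g \<and> lip_seminorm (frontier \<Omega>) g \<le> ereal \<sigma> \<longrightarrow>
          (\<exists>u. is_minimizer a \<sigma> \<Omega> g f0 u \<and> grad_Linf \<Omega> u = ereal \<sigma> \<and>
             (\<forall>v. is_minimizer a \<sigma> \<Omega> g f0 v \<longrightarrow> (\<forall>x\<in>closure \<Omega>. v x = u x)))))"
proof -
  interpret energy_problem a \<sigma> \<Omega>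
    using assms by unfold_locales auto
  \<comment> \<open>Stated for any integrable datum with a suitable \<psi>, so that it covers both
    kinds. Uniqueness on the closure is included to justify speaking of the minimizer.\<close>
  have iii: "\<exists>u. is_minimizer a \<sigma> \<Omega> g f0 u \<and> grad_Linf \<Omega> u = ereal \<sigma> \<and>
      (\<forall>v. is_minimizer a \<sigma> \<Omega> g f0 v \<longrightarrow> (\<forall>x\<in>closure \<Omega>. v x = u x))"
    if \<psi>: "C_diff 1 \<psi>" "compact (supp \<psi>)" "supp \<psi> \<subseteq> \<Omega>"
      and less: "L * (LINT x|M. norm (grad \<psi> x)) < (LINT x|M. f0 x * \<psi> x)"
      and f0: "integrable M f0" and g: "lip_seminorm (frontier \<Omega>) g \<le> ereal \<sigma>" for f0 g \<psi>
  proof -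
    have g': "\<sigma>-lipschitz_on (frontier \<Omega>) g"
      using \<sigma>_pos by (intro lipschitz_on_if_lip_seminorm_le[OF g]) simp
    obtain u where u: "is_minimizer a \<sigma> \<Omega> g f0 u" using minimizer_exists[OF g' f0] by blast
    then show ?thesis
      using minimizer_grad_Linf[OF \<psi> less f0 u] minimizer_unique[OF g' f0 u] by blast
  qed
  interpret fin: finite_measure M by (rule finite_measure_M)
  show ?thesis
  proof (intro conjI allI impI)
    fix l :: real and g
    assume "Lambda a \<sigma> * cheeger \<Omega> < ereal \<bar>l\<bar>"
    from cheeger_test_function[OF this] obtain \<psi> where "C_diff 1 \<psi>" "compact (supp \<psi>)" "supp \<psi> \<subseteq> \<Omega>"
      "L * (LINT x|M. norm (grad \<psi> x)) < (LINT x|M. l * \<psi> x)" .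
    from no_weak_solution[OF this] show "\<not> (\<exists>u. weak_solution a \<sigma> \<Omega> g (\<lambda>x. l) u)" by blast
  next
    fix f \<mu> g
    assume "Lambda_f a \<sigma> \<Omega> f < ereal \<mu>"
    from Lambda_f_test_function[OF this] obtain \<psi> where "C_diff 1 \<psi>" "compact (supp \<psi>)" "supp \<psi> \<subseteq> \<Omega>"
      "L * (LINT x|M. norm (grad \<psi> x)) < (LINT x|M. \<mu> * f x * \<psi> x)" .
    from no_weak_solution[OF this] show "\<not> (\<exists>u. weak_solution a \<sigma> \<Omega> g (\<lambda>x. \<mu> * f x) u)" by blast
  next
    fix f0 g
    assume f0: "(\<exists>l::real. Lambda a \<sigma> * cheeger \<Omega> < ereal \<bar>l\<bar> \<and> f0 = (\<lambda>x. l)) \<or>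
        (\<exists>f \<mu>. integrable M f \<and> (AE x in M. 0 \<le> f x) \<and> \<not> (AE x in M. f x = 0) \<and>
          Lambda_f a \<sigma> \<Omega> f < ereal \<mu> \<and> f0 = (\<lambda>x. \<mu> * f x))"
      and g: "lipschitz_fun_on (frontier \<Omega>) g \<and> lip_seminorm (frontier \<Omega>) g \<le> ereal \<sigma>"
    have "\<exists>\<psi>. C_diff 1 \<psi> \<and> compact (supp \<psi>) \<and> supp \<psi> \<subseteq> \<Omega> \<and>
        L * (LINT x|M. norm (grad \<psi> x)) < (LINT x|M. f0 x * \<psi> x) \<and> integrable M f0"
      using f0
    proof (elim disjE exE conjE)
      fix l :: real assume "Lambda a \<sigma> * cheeger \<Omega> < ereal \<bar>l\<bar>" "f0 = (\<lambda>x. l)"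
      then show ?thesis by (elim cheeger_test_function) (auto intro!: exI)
    next
      fix f \<mu> assume "integrable M f" "Lambda_f a \<sigma> \<Omega> f < ereal \<mu>" "f0 = (\<lambda>x. \<mu> * f x)"
      then show ?thesis by (elim Lambda_f_test_function) (auto intro!: exI)
    qed
    then show "\<exists>u. is_minimizer a \<sigma> \<Omega> g f0 u \<and> grad_Linf \<Omega> u = ereal \<sigma> \<and>
        (\<forall>v. is_minimizer a \<sigma> \<Omega> g f0 v \<longrightarrow> (\<forall>x\<in>closure \<Omega>. v x = u x))"
      using iii g by blast
  qed
qed

end
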